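(* There is an open set $\mathcal{P}\subset\mathbb{C}^4$ containing $(0,0,0,0)$ and each of the parameters $(A(a),B(a),C(a),D(a))$, $a\in(-2,2)$, where $A(a)=B(a)=C(a)=2a+4$ and $D(a)=-(a^2+8a+8)$, such that for every $(A,B,C,D)\in\mathcal{P}$ there is a set $\mathscr{B}_{A,B,C,D}\subset\partial\mathcal{N}_{A,B,C,D}=\partial\mathcal{D}_{A,B,C,D}$ that has topological dimension equal to three and is invariant under $\mathcal{G}_{A,B,C,D}$.
   Context: For $(A,B,C,D)\in\mathbb{C}^4$ let $S_{A,B,C,D}=\{(x,y,z)\in\mathbb{C}^3: x^2+y^2+z^2+xyz=Ax+By+Cz+D\}$. The involutions $s_x(x,y,z)=(-x-yz+A,\,y,\,z)$, $s_y(x,y,z)=(x,\,-y-xz+B,\,z)$, $s_z(x,y,z)=(x,\,y,\,-z-xy+C)$ preserve $S_{A,B,C,D}$. Let $\mathcal{G}_{A,B,C,D}=\langle g_x,g_y,g_z\rangle$ be the group of automorphisms of $S_{A,B,C,D}$ generated by $g_x=s_z\circ s_y$, $g_y=s_x\circ s_z$, $g_z=s_y\circ s_x$. The group $\mathcal{G}_{A,B,C,D}$ is locally non-discrete on an open set $U\subset S_{A,B,C,D}$ if there is a sequence $f_n\in\mathcal{G}_{A,B,C,D}\setminus\{\mathrm{id}\}$ converging uniformly to the identity on compact subsets of $U$. $\mathcal{N}_{A,B,C,D}$ is the set of $p\in S_{A,B,C,D}$ having an open neighborhood on which $\mathcal{G}_{A,B,C,D}$ is locally non-discrete, and $\mathcal{D}_{A,B,C,D}=S_{A,B,C,D}\setminus\mathcal{N}_{A,B,C,D}$.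 $\partial$ denotes topological boundary in $S_{A,B,C,D}$. *)

theory Defs
  imports "HOL-Analysis.Analysis" "HOL-Algebra.Bij" "HOL-Algebra.Generated_Groups"
begin

type_synonym point = "complex \<times> complex \<times> complex"

definition surf :: "complex \<Rightarrow> complex \<Rightarrow> complex \<Rightarrow> complex \<Rightarrow> point set" where
  "surf A B C D =
     {(x, y, z). x\<^sup>2 + y\<^sup>2 + z\<^sup>2 + x * y * z = A * x + B * y + C * z + D}"

definition s_x :: "complex \<Rightarrow> point \<Rightarrow> point" where
  "s_x A = (\<lambda>(x, y, z). (- x - y * z + A, y, z))"

definition s_y :: "complex \<Rightarrow> point \<Rightarrow> point" where
  "s_y B = (\<lambda>(x, y, z). (x, - y - x * z + B, z))"

definition s_z :: "complex \<Rightarrow> point \<Rightarrow> point" where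
  "s_z C = (\<lambda>(x, y, z). (x, y, - z - x * y + C))"

definition g_x :: "complex \<Rightarrow> complex \<Rightarrow> point \<Rightarrow> point" where
  "g_x B C = s_z C \<circ> s_y B"

definition g_y :: "complex \<Rightarrow> complex \<Rightarrow> point \<Rightarrow> point" where
  "g_y A C = s_x A \<circ> s_z C"

definition g_z :: "complex \<Rightarrow> complex \<Rightarrow> point \<Rightarrow> point" where
  "g_z A B = s_y B \<circ> s_x A"

(* Elements are self-maps of the surface, in BijGroup's convention of functions that are
   "undefined" off the carrier set; hence the restrictions. The automorphisms are
   polynomial, so generating inside the group of all bijections loses nothing. *)
definition \<G> :: "complex \<Rightarrow> complex \<Rightarrow> complex \<Rightarrow> complex \<Rightarrow> (point \<Rightarrow> point) set" where
  "\<G> A B C D = generate (BijGroup (surf A B C D))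
     {restrict (g_x B C) (surf A B C D),
      restrict (g_y A C) (surf A B C D),
      restrict (g_z A B) (surf A B C D)}"

lemma s_x_surf: "p \<in> surf A B C D \<Longrightarrow> s_x A p \<in> surf A B C D"
proof -
  have "(- x - y * z + A)\<^sup>2 + y\<^sup>2 + z\<^sup>2 + (- x - y * z + A) * y * z = A * (- x - y * z + A) + B * y + C * z + D"
    if "x\<^sup>2 + y\<^sup>2 + z\<^sup>2 + x * y * z = A * x + B * y + C * z + D" for x y z :: complex
    using that by algebra
  then show "p \<in> surf A B C D \<Longrightarrow> s_x A p \<in> surf A B C D"
    by (auto simp only: surf_def s_x_def mem_Collect_eq prod.case split: prod.splits)
qed

lemma s_y_surf: "p \<in> surf A B C D \<Longrightarrow> s_y B p \<in> surf A B C D"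
proof -
  have "x\<^sup>2 + (- y - x * z + B)\<^sup>2 + z\<^sup>2 + x * (- y - x * z + B) * z = A * x + B * (- y - x * z + B) + C * z + D"
    if "x\<^sup>2 + y\<^sup>2 + z\<^sup>2 + x * y * z = A * x + B * y + C * z + D" for x y z :: complex
    using that by algebra
  then show "p \<in> surf A B C D \<Longrightarrow> s_y B p \<in> surf A B C D"
    by (auto simp only: surf_def s_y_def mem_Collect_eq prod.case split: prod.splits)
qed

lemma s_z_surf: "p \<in> surf A B C D \<Longrightarrow> s_z C p \<in> surf A B C D"
proof -
  have "x\<^sup>2 + y\<^sup>2 + (- z - x * y + C)\<^sup>2 + x * y * (- z - x * y + C) = A * x + B * y + C * (- z - x * y + C) + D"
    if "x\<^sup>2 + y\<^sup>2 + z\<^sup>2 + x * y * z = A * x + B * y + C * z + D" for x y z :: complex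
    using that by algebra
  then show "p \<in> surf A B C D \<Longrightarrow> s_z C p \<in> surf A B C D"
    by (auto simp only: surf_def s_z_def mem_Collect_eq prod.case split: prod.splits)
qed

lemma s_x_invol [simp]: "s_x A (s_x A p) = p"
  by (cases p) (simp add: s_x_def)

lemma s_y_invol [simp]: "s_y B (s_y B p) = p"
  by (cases p) (simp add: s_y_def)

lemma s_z_invol [simp]: "s_z C (s_z C p) = p"
  by (cases p) (simp add: s_z_def)

lemma generators_in_Bij:
  "restrict (g_x B C) (surf A B C D) \<in> Bij (surf A B C D)"
  "restrict (g_y A C) (surf A B C D) \<in> Bij (surf A B C D)"
  "restrict (g_z A B) (surf A B C D) \<in> Bij (surf A B C D)"
proof -
  let ?S = "surf A B C D"
  have "bij_betw (g_x B C) ?S ?S"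
    by (rule bij_betw_byWitness[where f' = "s_y B \<circ> s_z C"])
       (auto simp: g_x_def s_y_surf s_z_surf)
  moreover have "bij_betw (g_y A C) ?S ?S"
    by (rule bij_betw_byWitness[where f' = "s_z C \<circ> s_x A"])
       (auto simp: g_y_def s_x_surf s_z_surf)
  moreover have "bij_betw (g_z A B) ?S ?S"
    by (rule bij_betw_byWitness[where f' = "s_x A \<circ> s_y B"])
       (auto simp: g_z_def s_x_surf s_y_surf)
  ultimately show "restrict (g_x B C) ?S \<in> Bij ?S" "restrict (g_y A C) ?S \<in> Bij ?S"
    "restrict (g_z A B) ?S \<in> Bij ?S"
    by (simp_all add: Bij_def cong: bij_betw_cong)
qed

lemma subgroup_\<G>: "subgroup (\<G> A B C D) (BijGroup (surf A B C D))"
  unfolding \<G>_def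
  by (rule group.generate_is_subgroup[OF group_BijGroup])
     (use generators_in_Bij in \<open>auto simp: BijGroup_def\<close>)

definition locally_nondiscrete ::
    "complex \<Rightarrow> complex \<Rightarrow> complex \<Rightarrow> complex \<Rightarrow> point set \<Rightarrow> bool" where
  "locally_nondiscrete A B C D U \<longleftrightarrow>
     openin (top_of_set (surf A B C D)) U \<and>
     (\<exists>f :: nat \<Rightarrow> point \<Rightarrow> point.
        (\<forall>n. f n \<in> \<G> A B C D - {\<one>\<^bsub>BijGroup (surf A B C D)\<^esub>}) \<and>
        (\<forall>K. compact K \<and> K \<subseteq> U \<longrightarrow> uniform_limit K f (\<lambda>p. p) sequentially))"

definition \<N> :: "complex \<Rightarrow> complex \<Rightarrow> complex \<Rightarrow> complex \<Rightarrow> point set" where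
  "\<N> A B C D = {p. \<exists>U. p \<in> U \<and> locally_nondiscrete A B C D U}"

definition \<D> :: "complex \<Rightarrow> complex \<Rightarrow> complex \<Rightarrow> complex \<Rightarrow> point set" where
  "\<D> A B C D = surf A B C D - \<N> A B C D"

(* Small inductive dimension, via the library's dim_le; on separable metrizable spaces,
   such as subsets of the surface, it agrees with covering dimension. *)
definition has_top_dim :: "'a topology \<Rightarrow> int \<Rightarrow> bool" where
  "has_top_dim X n \<longleftrightarrow> X dim_le n \<and> \<not> X dim_le (n - 1)"

end

theory Submission
  imports Defs "HOL-Complex_Analysis.Complex_Analysis"
begin

text \<open>
  The frontier of \<open>\<N>\<close> is itself the required set: it is invariant since the reflections normalise the group.
  It is closed and nowhere dense, and its image under the finite projection \<open>(x, y, z) \<mapsto> (x, y)\<close>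
  to \<open>\<complex>\<^sup>2\<close> is still nowhere dense, so it misses some translated rational grid; boxes with faces on the
  grid then bound the dimension by 3.

  The dimension is at least 3 as soon as both \<open>\<N>\<close> and the complement of its closure are
  nonempty. Away from the discriminant curve, which does not disconnect \<open>\<complex>\<^sup>2\<close>, the frontier locally
  separates 4-space. A compact set of dimension at most 2 has the extension property for maps into
  3-space minus the origin, and an inversion centred on the far side of the frontier turns this into a
  null-homotopy contradicting Borsuk's separation criterion.

  Both open sets are nonempty near the given parameters. At a real diagonal point with large
  negative coordinates every reflection strictly increases the size of the new coordinate, and so does every further
  letter of a reduced word, so no nontrivial element is close to the identity there. The points
  \<open>(0, 0, 0)\<close> and \<open>(2, 2, a)\<close> are fixed by all reflections, and \<open>g\<^sub>z\<close> acts on the tangent space there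
  as an elliptic element, hence some power of it is close to the identity; its iterated commutators with a
  conjugate converge to the identity quadratically fast, and a ping-pong argument at infinity shows
  that none of them is trivial. All of these estimates persist for nearby parameters.
\<close>

section \<open>Extension of maps and the dimension of a separator\<close>

text \<open>A point is fixed by all three reflections exactly when the gradient of the defining
  polynomial vanishes there. So (0, 0, 0) and (2, 2, a) are singular points of their surfaces, and
  no chart of the surface is available near them. This shapes both halves. Displacements of words
  are measured on balls of the ambient 3-space, where words are polynomial maps: the Schwarz lemma
  applies along arbitrary complex lines, and the estimates survive when a nearby surface no longer
  contains the fixed point. The topology is carried out in the (x, y)-plane, over which the surface
  is a two-sheeted branched cover with sheet exchange \<open>s_z\<close>; sets invariant under
  \<open>s_z\<close> pass up and down without charts. The parameter family is forced by the point:
  that the reflections fix (2, 2, a) gives A = B = C = 2a + 4, and that it lies on the surface then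
  gives D. The condition |a| < 2 makes the Hermitian form preserved by the tangent maps of
  \<open>s_x\<close> and \<open>s_y\<close> definite, which is what elliptic means here.\<close>

definition extension_property :: "'b::euclidean_space itself \<Rightarrow> 'a::euclidean_space set \<Rightarrow> bool" where
  "extension_property (T :: 'b itself) Y \<longleftrightarrow>
     (\<forall>C (f :: 'a \<Rightarrow> 'b). compact C \<and> C \<subseteq> Y \<and> continuous_on C f \<and> 0 \<notin> f ` C \<longrightarrow>
        (\<exists>g. continuous_on Y g \<and> 0 \<notin> g ` Y \<and> (\<forall>x\<in>C. g x = f x)))"

lemma extension_propertyD:
  fixes f :: "'a::euclidean_space \<Rightarrow> 'b::euclidean_space"
  assumes "extension_property TYPE('b) Y" "compact C" "C \<subseteq> Y" "continuous_on C f" "0 \<notin> f ` C"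
  obtains g where "continuous_on Y g" "0 \<notin> g ` Y" "\<And>x. x \<in> C \<Longrightarrow> g x = f x"
proof -
  have "\<exists>g. continuous_on Y g \<and> 0 \<notin> g ` Y \<and> (\<forall>x\<in>C. g x = f x)"
    using assms(1)[unfolded extension_property_def, THEN spec, of C, THEN spec, of f] assms(2-) by simp
  then show thesis using that by blast
qed

lemma extension_property_empty: "extension_property T {}"
  by (auto simp: extension_property_def)

lemma extension_property_subset:
  assumes "extension_property TYPE('b::euclidean_space) Y" "Z \<subseteq> Y"
  shows "extension_property TYPE('b) Z"
  unfolding extension_property_def
proof (intro allI impI, elim conjE)
  fix C and f :: "_ \<Rightarrow> 'b"
  assume "compact C" "C \<subseteq> Z" "continuous_on C f" "0 \<notin> f ` C"
  then obtain g where "continuous_on Y g" "0 \<notin> g ` Y" "\<forall>x\<in>C. g x = f x"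
    using extension_propertyD[of Y C f] assms by (metis order_trans)
  then show "\<exists>g. continuous_on Z g \<and> 0 \<notin> g ` Z \<and> (\<forall>x\<in>C. g x = f x)"
    using assms(2) by (intro exI[of _ g]) (auto intro: continuous_on_subset)
qed

text \<open>Independent extensions over the two pieces could disagree on the overlap. So the
  extension over \<open>Y1\<close> comes first, and the one over \<open>Y2\<close> is prescribed on
  all of \<open>(C \<union> Y1) \<inter> Y2\<close>.\<close>

lemma extension_property_Un:
  fixes Y1 Y2 :: "'a::euclidean_space set"
  assumes "compact Y1" "compact Y2" and e1: "extension_property TYPE('b::euclidean_space) Y1"
    and e2: "extension_property TYPE('b) Y2"
  shows "extension_property TYPE('b) (Y1 \<union> Y2)"
  unfolding extension_property_def
proof (intro allI impI, elim conjE)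
  fix C and f :: "'a \<Rightarrow> 'b"
  assume C: "compact C" "C \<subseteq> Y1 \<union> Y2" "continuous_on C f" "0 \<notin> f ` C"
  have cl: "closed Y1" "closed Y2" "closed C"
    using assms C compact_imp_closed by auto
  obtain g1 where g1: "continuous_on Y1 g1" "0 \<notin> g1 ` Y1" "\<And>x. x \<in> C \<inter> Y1 \<Longrightarrow> g1 x = f x"
  proof (rule extension_propertyD[OF e1, of "C \<inter> Y1" f])
    show "continuous_on (C \<inter> Y1) f" using C by (meson continuous_on_subset inf_le1)
  qed (use C assms in auto)
  define h where "h x = (if x \<in> C then f x else g1 x)" for x
  have h: "continuous_on (C \<union> Y1) h"
    unfolding h_def
  proof (rule continuous_on_cases[OF cl(3) cl(1) C(3) g1(1)])
    show "\<forall>x. x \<in> C \<and> x \<notin> C \<or> x \<in> Y1 \<and> x \<in> C \<longrightarrow> f x = g1 x"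
      using g1(3) by (metis Int_iff)
  qed
  obtain g2 where g2: "continuous_on Y2 g2" "0 \<notin> g2 ` Y2" "\<And>x. x \<in> (C \<union> Y1) \<inter> Y2 \<Longrightarrow> g2 x = h x"
  proof (rule extension_propertyD[OF e2, of "(C \<union> Y1) \<inter> Y2" h])
    show "compact ((C \<union> Y1) \<inter> Y2)" using C assms by (auto intro: compact_Un)
    show "continuous_on ((C \<union> Y1) \<inter> Y2) h" using h by (meson continuous_on_subset inf_le1)
    show "0 \<notin> h ` ((C \<union> Y1) \<inter> Y2)" using C(4) g1(2) by (auto simp: h_def)
  qed auto
  define g where "g x = (if x \<in> Y1 then g1 x else g2 x)" for x
  have "continuous_on (Y1 \<union> Y2) g"
    unfolding g_def by (rule continuous_on_cases) (use cl g1 g2 in \<open>auto simp: h_def\<close>)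
  moreover have "0 \<notin> g ` (Y1 \<union> Y2)" using g1(2) g2(2) by (auto simp: g_def image_iff)
  moreover have "\<forall>x\<in>C. g x = f x"
    using C(2) g1(3) g2(3) by (metis Int_iff UnE Un_iff g_def h_def subsetD)
  ultimately show "\<exists>g. continuous_on (Y1 \<union> Y2) g \<and> 0 \<notin> g ` (Y1 \<union> Y2) \<and> (\<forall>x\<in>C. g x = f x)"
    by blast
qed

lemma extension_property_homeomorphic:
  fixes Y :: "'a::euclidean_space set" and Y' :: "'c::euclidean_space set"
  assumes ext: "extension_property TYPE('b::euclidean_space) Y"
    and hom: "homeomorphism Y Y' m m'"
  shows "extension_property TYPE('b) Y'"
  unfolding extension_property_def
proof (intro allI impI, elim conjE)
  fix C and f :: "'c \<Rightarrow> 'b"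
  assume C: "compact C" "C \<subseteq> Y'" "continuous_on C f" "0 \<notin> f ` C"
  note m = homeomorphism_cont1[OF hom] homeomorphism_cont2[OF hom] homeomorphism_image1[OF hom]
      homeomorphism_image2[OF hom] homeomorphism_apply1[OF hom] homeomorphism_apply2[OF hom]
  have im: "m ` m' ` C = C"
    unfolding image_image using m(6) C(2) by (metis (no_types, lifting) image_cong image_ident subset_iff)
  obtain g where g: "continuous_on Y g" "0 \<notin> g ` Y" "\<And>x. x \<in> m' ` C \<Longrightarrow> g x = (f \<circ> m) x"
  proof (rule extension_propertyD[OF ext, of "m' ` C" "f \<circ> m"])
    show "compact (m' ` C)" using C(1,2) m(2) by (meson compact_continuous_image continuous_on_subset)
    show "m' ` C \<subseteq> Y" using C(2) m(4) by blast
    then show "continuous_on (m' ` C) (f \<circ> m)"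
      using m(1) C(3) im by (intro continuous_on_compose) (simp_all add: continuous_on_subset)
    show "0 \<notin> (f \<circ> m) ` m' ` C" using C(4) im by (metis image_comp)
  qed (rule that)
  have "continuous_on Y' (g \<circ> m')" using g(1) m(2,4) by (intro continuous_on_compose) simp_all
  moreover have "0 \<notin> (g \<circ> m') ` Y'" using g(2) m(4) by (metis image_comp)
  moreover have "\<forall>x\<in>C. (g \<circ> m') x = f x" using g(3) m(6) C(2) by (metis comp_apply imageI subsetD)
  ultimately show "\<exists>g. continuous_on Y' g \<and> 0 \<notin> g ` Y' \<and> (\<forall>x\<in>C. g x = f x)"
    by blast
qed

text \<open>This trades one dimension: extension into \<open>'b\<close> minus the origin kills maps
  into \<open>'b \<times> real\<close> minus the origin. Only the lower part has to extend, and
  \<open>separator_not_extension\<close> relies on this asymmetry to place an auxiliary sphere in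
  the upper part.\<close>

lemma inessential_if_lower_part_extends:
  fixes f :: "'a::euclidean_space \<Rightarrow> 'b::euclidean_space \<times> real"
  assumes "compact Z" and f: "continuous_on Z f" "0 \<notin> f ` Z"
    and ext: "extension_property TYPE('b) {z \<in> Z. snd (f z) \<le> 0}"
  obtains c where "homotopic_with_canon (\<lambda>_. True) Z (- {0}) f (\<lambda>_. c)"
proof -
  define L where "L = {z \<in> Z. snd (f z) \<le> 0}"
  define M where "M = {z \<in> Z. snd (f z) \<ge> 0}"
  define E where "E = {z \<in> Z. snd (f z) = 0}"
  have cs: "continuous_on Z (\<lambda>z. snd (f z))" "continuous_on Z (\<lambda>z. fst (f z))"
    using f by (auto intro: continuous_intros)
  have clZ: "closed Z" using assms compact_imp_closed by auto
  have "L = Z \<inter> (\<lambda>z. snd (f z)) -` {..0}" "M = Z \<inter> (\<lambda>z. snd (f z)) -` {0..}"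
    "E = Z \<inter> (\<lambda>z. snd (f z)) -` {0}"
    by (auto simp: L_def M_def E_def)
  then have cl: "closed L" "closed M" "closed E"
    using continuous_closed_preimage[OF cs(1) clZ] by simp_all
  have "E = Z \<inter> E" by (auto simp: E_def)
  then have cE: "compact E" using compact_Int_closed[OF assms(1) cl(3)] by simp
  obtain g where g: "continuous_on L g" "0 \<notin> g ` L" "\<And>x. x \<in> E \<Longrightarrow> g x = fst (f x)"
  proof (rule extension_propertyD[OF ext, of E "\<lambda>z. fst (f z)"])
    show "continuous_on E (\<lambda>z. fst (f z))"
      using cs(2) by (rule continuous_on_subset) (auto simp: E_def)
    show "0 \<notin> (\<lambda>z. fst (f z)) ` E"
      using f(2) by (auto simp: E_def image_iff) (metis prod.collapse zero_prod_def)
  qed (use cE in \<open>auto simp: E_def L_def\<close>)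
  \<comment> \<open>Replacing \<open>f\<close> on the lower part by a map into the equator changes it only by a homotopy, and the
    new map omits the negative axis.\<close>
  define f' where "f' z = (if z \<in> M then f z else (g z, 0))" for z
  have Z: "Z = M \<union> L" "E = M \<inter> L" by (auto simp: M_def L_def E_def)
  have cf': "continuous_on Z f'"
    unfolding Z f'_def
  proof (rule continuous_on_cases[OF cl(2) cl(1)])
    show "continuous_on M f" using f(1) by (rule continuous_on_subset) (auto simp: M_def)
    show "continuous_on L (\<lambda>z. (g z, 0))" using g(1) by (intro continuous_intros)
    show "\<forall>x. x \<in> M \<and> x \<notin> M \<or> x \<in> L \<and> x \<in> M \<longrightarrow> f x = (g x, 0)"
    proof (intro allI impI)
      fix x assume "x \<in> M \<and> x \<notin> M \<or> x \<in> L \<and> x \<in> M"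
      then have "x \<in> E" by (auto simp: Z(2))
      then have "g x = fst (f x)" "snd (f x) = 0" using g(3) by (auto simp: E_def)
      then show "f x = (g x, 0)" by (simp add: prod_eq_iff)
    qed
  qed
  have nz': "f' z \<noteq> 0" "snd (f' z) \<ge> 0" if "z \<in> Z" for z
  proof -
    have "f' z \<noteq> 0 \<and> snd (f' z) \<ge> 0"
    proof (cases "z \<in> M")
      case True
      then show ?thesis using f(2) that by (auto simp: f'_def M_def image_iff)
    next
      case False
      then have "z \<in> L" using that Z(1) by blast
      then have "g z \<noteq> 0" using g(2) by (metis imageI)
      then show ?thesis using False by (simp add: f'_def zero_prod_def)
    qed
    then show "f' z \<noteq> 0" "snd (f' z) \<ge> 0" by auto
  qed
  have h1: "homotopic_with_canon (\<lambda>_. True) Z (- {0}) f f'"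
  proof (rule homotopic_with_linear[OF f(1) cf'])
    fix z assume z: "z \<in> Z"
    show "closed_segment (f z) (f' z) \<subseteq> - {0}"
    proof (cases "z \<in> M")
      case True
      then show ?thesis using nz'(1)[OF z] by (simp add: f'_def)
    next
      case False
      then have neg: "snd (f z) < 0" and zL: "z \<in> L" using z by (auto simp: M_def L_def)
      have "0 \<notin> closed_segment (f z) (f' z)"
      proof
        assume "0 \<in> closed_segment (f z) (f' z)"
        then obtain u where u: "0 = (1 - u) *\<^sub>R f z + u *\<^sub>R f' z" "0 \<le> u" "u \<le> 1"
          unfolding closed_segment_def by blast
        then have "(1 - u) * snd (f z) = 0"
          using False by (simp add: f'_def prod_eq_iff)
        then have "u = 1" using neg by simp
        then show False using u(1) nz'(1)[OF z] by simp
      qed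
      then show ?thesis by blast
    qed
  qed
  have h2: "homotopic_with_canon (\<lambda>_. True) Z (- {0}) f' (\<lambda>_. (0, 1))"
  proof (rule homotopic_with_linear[OF cf'])
    fix z assume z: "z \<in> Z"
    have "0 \<notin> closed_segment (f' z) (0, 1)"
    proof
      assume "0 \<in> closed_segment (f' z) (0, 1)"
      then obtain u where u: "0 = (1 - u) *\<^sub>R f' z + u *\<^sub>R (0, 1)" "0 \<le> u" "u \<le> 1"
        unfolding closed_segment_def by blast
      then have "(1 - u) * snd (f' z) + u = 0" by (simp add: prod_eq_iff)
      moreover have "(1 - u) * snd (f' z) \<ge> 0" using nz'(2)[OF z] u(2,3) by simp
      ultimately have "u = 0" using u(2) by linarith
      then show False using u(1) nz'(1)[OF z] by (simp add: zero_prod_def[symmetric])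
    qed
    then show "closed_segment (f' z) (0, 1) \<subseteq> - {0}" by blast
  qed auto
  show thesis using homotopic_with_trans[OF h1 h2] that by blast
qed

text \<open>The inductive step of dimension theory. Near \<open>C\<close> a Tietze extension has no
  zeros; finitely many small relatively open sets cover \<open>C\<close>, and on the frontier of
  their union the map is null-homotopic, so it continues over the rest of \<open>Y\<close>. The
  class \<open>Q\<close> of admissible frontiers is abstract so that the same argument serves
  dimension 0 (empty frontiers) and every later dimension.\<close>

lemma extension_property_if_frontiers_inessential:
  fixes Y :: "'a::euclidean_space set" and Q :: "'a set \<Rightarrow> bool"
  assumes Y: "compact Y"
    and Q_empty: "Q {}" and Q_Un: "\<And>A B. compact A \<Longrightarrow> compact B \<Longrightarrow> Q A \<Longrightarrow> Q B \<Longrightarrow> Q (A \<union> B)"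
    and Q_sub: "\<And>A B. Q B \<Longrightarrow> A \<subseteq> B \<Longrightarrow> Q A"
    and Q_null: "\<And>A (f :: 'a \<Rightarrow> 'c::euclidean_space). compact A \<Longrightarrow> Q A \<Longrightarrow> continuous_on A f \<Longrightarrow> 0 \<notin> f ` A \<Longrightarrow>
        \<exists>c. homotopic_with_canon (\<lambda>_. True) A (- {0}) f (\<lambda>_. c)"
    and nbhd: "\<And>p V. p \<in> Y \<Longrightarrow> open V \<Longrightarrow> p \<in> V \<Longrightarrow>
        \<exists>U. p \<in> U \<and> U \<subseteq> V \<and> openin (top_of_set Y) U \<and> Q (top_of_set Y frontier_of U)"
  shows "extension_property TYPE('c) Y"
  unfolding extension_property_def
proof (intro allI impI, elim conjE)
  fix C and f :: "'a \<Rightarrow> 'c"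
  assume C: "compact C" "C \<subseteq> Y" "continuous_on C f" "0 \<notin> f ` C"
  have clY: "closed Y" using Y compact_imp_closed by auto
  have fr: "top_of_set Y frontier_of U = closure U - U" if "openin (top_of_set Y) U" for U
  proof -
    have "U \<subseteq> Y" using that openin_imp_subset by blast
    then have "Y \<inter> closure (Y \<inter> U) = closure U"
      using clY by (metis Int_absorb1 closure_minimal)
    then show ?thesis
      using that by (simp add: frontier_of_def interior_of_openin closure_of_subtopology euclidean_closure_of)

  qed
  \<comment> \<open>This extension may vanish away from \<open>C\<close>; it is kept only on
    \<open>closure G\<close>, which lies inside the zero-free set \<open>W\<close>.\<close>
  obtain F where F: "continuous_on UNIV F" "\<And>x. x \<in> C \<Longrightarrow> F x = f x"
  proof (rule Tietze_unbounded[OF C(3), of UNIV])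
    show "closedin (top_of_set UNIV) C"
      using compact_imp_closed[OF C(1)] closed_subset by blast
  qed (rule that)
  define W where "W = {x. F x \<noteq> 0}"
  have "W = F -` (- {0})" by (auto simp: W_def)
  moreover have "open (F -` (- {0}))" by (rule open_vimage[OF open_Compl[OF closed_singleton] F(1)])
  ultimately have W: "open W" by simp
  have CW: "C \<subseteq> W"
  proof
    fix x assume "x \<in> C"
    then show "x \<in> W" using C(4) F(2)[of x] by (auto simp: W_def)
  qed
  have "\<forall>p\<in>C. \<exists>U. p \<in> U \<and> openin (top_of_set Y) U \<and> closure U \<subseteq> W \<and> Q (closure U - U)"
  proof
    fix p assume p: "p \<in> C"
    obtain r where r: "r > 0" "cball p r \<subseteq> W" using W CW p unfolding open_contains_cball by blast
    obtain U where U: "p \<in> U" "U \<subseteq> ball p r" "openin (top_of_set Y) U" "Q (top_of_set Y frontier_of U)"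
      using nbhd[of p "ball p r"] p C(2) r(1) by (metis centre_in_ball open_ball subsetD)
    have "closure U \<subseteq> W" using U(2) r by (meson ball_subset_cball closed_cball closure_minimal order_trans)
    then show "\<exists>U. p \<in> U \<and> openin (top_of_set Y) U \<and> closure U \<subseteq> W \<and> Q (closure U - U)"
      using U fr by (intro exI[of _ U]) simp
  qed
  then obtain U where U: "\<And>p. p \<in> C \<Longrightarrow> p \<in> U p" "\<And>p. p \<in> C \<Longrightarrow> openin (top_of_set Y) (U p)"
    "\<And>p. p \<in> C \<Longrightarrow> closure (U p) \<subseteq> W" "\<And>p. p \<in> C \<Longrightarrow> Q (closure (U p) - U p)"
    by metis
  obtain O' where O': "\<And>p. p \<in> C \<Longrightarrow> open (O' p)" "\<And>p. p \<in> C \<Longrightarrow> U p = Y \<inter> O' p"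
    using U(2) unfolding openin_open by metis
  obtain I where I: "I \<subseteq> C" "finite I" "C \<subseteq> (\<Union>p\<in>I. O' p)"
    by (rule compactE_image[OF C(1), of C O']) (use O' U(1) in auto)
  define G where "G = (\<Union>p\<in>I. U p)"
  have CG: "C \<subseteq> G"
  proof
    fix x assume "x \<in> C"
    then obtain p where p: "p \<in> I" "x \<in> O' p" "x \<in> Y" using I(3) C(2) by blast
    then have "x \<in> U p" using O'(2) I(1) by blast
    then show "x \<in> G" using p(1) unfolding G_def by blast
  qed
  have opG: "openin (top_of_set Y) G" unfolding G_def by (rule openin_Union) (use U(2) I(1) in blast)
  then obtain OG where OG: "open OG" "G = Y \<inter> OG" unfolding openin_open by auto
  have clG: "closure G = (\<Union>p\<in>I. closure (U p))" unfolding G_def using I(2) by (induction I rule: finite_induct) simp_all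
  have clGW: "closure G \<subseteq> W" using clG U(3) I(1) by auto
  have clGY: "closure G \<subseteq> Y" using OG clY by (simp add: closure_minimal)
  \<comment> \<open>The frontier of \<open>G\<close> in \<open>Y\<close>. It is covered by the
    frontiers of the finitely many \<open>U p\<close>, so it inherits \<open>Q\<close> from
    them.\<close>
  define Z where "Z = closure G - OG"
  have clZ: "closed Z" unfolding Z_def using OG by blast
  have ZY: "Z \<subseteq> Y - OG" using clGY by (auto simp: Z_def)
  have "Y \<inter> Z = Z" using ZY by blast
  then have cZ: "compact Z" using compact_Int_closed[OF Y clZ] by simp
  have QZ: "Q Z"
  proof -
    have "Z \<subseteq> (\<Union>p\<in>I. closure (U p) - O' p)"
    proof
      fix x assume x: "x \<in> Z"
      then obtain p where p: "p \<in> I" "x \<in> closure (U p)" unfolding Z_def clG by blast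
      have "x \<notin> O' p"
      proof
        assume "x \<in> O' p"
        then have "x \<in> U p" using O'(2) p I(1) ZY x by blast
        then have "x \<in> G" using p(1) unfolding G_def by blast
        then show False using x OG(2) unfolding Z_def by blast
      qed
      then show "x \<in> (\<Union>p\<in>I. closure (U p) - O' p)" using p by blast
    qed
    moreover have "Q (\<Union>p\<in>J. closure (U p) - O' p) \<and> compact (\<Union>p\<in>J. closure (U p) - O' p)"
      if "finite J" "J \<subseteq> C" for J
      using that
    proof (induction J rule: finite_induct)
      case (insert p J)
      have "closure (U p) \<subseteq> Y" using insert.prems O'(2) clY by (simp add: closure_minimal)
      then have "closure (U p) - O' p = closure (U p) - U p" using O'(2) insert.prems by blast
      then have q: "Q (closure (U p) - O' p)" using U(4) insert.prems by simp
      have "compact (closure (U p))"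
        using compact_Int_closed[OF Y closed_closure[of "U p"]] \<open>closure (U p) \<subseteq> Y\<close>
        by (simp add: inf.absorb2)
      then have "compact (closure (U p) - O' p)"
        using O'(1) insert.prems by (simp add: compact_diff)
      moreover have "Q (\<Union>p\<in>J. closure (U p) - O' p)" "compact (\<Union>p\<in>J. closure (U p) - O' p)"
        using insert.IH insert.prems by simp_all
      ultimately show ?case using q Q_Un by (simp add: compact_Un)
    qed (auto simp: Q_empty)
    ultimately show ?thesis using I Q_sub by blast
  qed
  have cF: "continuous_on S F" for S using F(1) continuous_on_subset by blast
  have FZ: "0 \<notin> F ` Z" using clGW by (auto simp: Z_def W_def)
  obtain g' where g': "continuous_on (Y - OG) g'" "0 \<notin> g' ` (Y - OG)" "\<And>x. x \<in> Z \<Longrightarrow> g' x = F x"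
  proof (cases "Z = {}")
    case True
    \<comment> \<open>A null-homotopy over the empty set says nothing about its constant, which
      might be 0; here any nonzero constant map extends.\<close>
    obtain b :: 'c where "b \<in> Basis" using nonempty_Basis by blast
    then have "b \<noteq> 0" by auto
    then show ?thesis using True that[of "\<lambda>_. b"] by auto
  next
    case False
    obtain c where c: "homotopic_with_canon (\<lambda>_. True) Z (- {0}) F (\<lambda>_. c)"
      using Q_null[OF cZ QZ cF FZ] by blast
    then have cnz: "c \<noteq> 0" using False homotopic_with_imp_subset2[OF c] by auto
    have clo: "closedin (top_of_set (Y - OG)) Z"
      using clZ ZY closed_subset by blast
    have c': "homotopic_with_canon (\<lambda>_. True) Z (- {0}) (\<lambda>_. c) F"
      using c by (simp add: homotopic_with_sym)
    have anr: "ANR (- {0::'c})" by (simp add: open_imp_ANR open_Compl)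
    \<comment> \<open>The constant map extends trivially, and the homotopy extension property for
      ANR targets carries the extension along to \<open>F\<close>.\<close>
    obtain g' where "continuous_on (Y - OG) g'" "g' ` (Y - OG) \<subseteq> - {0}" "\<And>x. x \<in> Z \<Longrightarrow> g' x = F x"
      by (rule Borsuk_homotopy_extension_homotopic[OF clo disjI2[OF anr] _ _ c']) (use cnz in auto)
    then show ?thesis using that by blast
  qed
  define g where "g x = (if x \<in> closure G then F x else g' x)" for x
  have "continuous_on (closure G \<union> (Y - OG)) g"
    unfolding g_def
  proof (rule continuous_on_cases)
    show "closed (Y - OG)" using clY OG(1) by blast
    show "\<forall>x. x \<in> closure G \<and> x \<notin> closure G \<or> x \<in> Y - OG \<and> x \<in> closure G \<longrightarrow> F x = g' x"
      using g'(3) by (auto simp: Z_def)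
  qed (use g'(1) cF in simp_all)
  moreover have eq: "closure G \<union> (Y - OG) = Y" using clGY OG closure_subset[of G] by auto
  moreover have "0 \<notin> g ` Y"
  proof
    assume "0 \<in> g ` Y"
    then obtain x where x: "x \<in> Y" "g x = 0" by auto
    show False
    proof (cases "x \<in> closure G")
      case True then show ?thesis using x clGW by (auto simp: g_def W_def)
    next
      case False then show ?thesis using x g'(2) eq by (force simp: g_def image_iff)
    qed
  qed
  moreover have "\<forall>x\<in>C. g x = f x" using CG F(2) closure_subset[of G] by (auto simp: g_def)
  ultimately show "\<exists>g. continuous_on Y g \<and> 0 \<notin> g ` Y \<and> (\<forall>x\<in>C. g x = f x)"
    by metis
qed

lemma dim_le_frontier_nbhd:
  assumes "top_of_set Y dim_le n" "p \<in> Y" "open V" "p \<in> V"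
  obtains U where "p \<in> U" "U \<subseteq> V" "openin (top_of_set Y) U"
    "top_of_set (top_of_set Y frontier_of U) dim_le (n - 1)"
proof -
  have dim: "\<exists>U. a \<in> U \<and> U \<subseteq> W \<and> openin (top_of_set Y) U \<and>
      subtopology (top_of_set Y) (top_of_set Y frontier_of U) dim_le (n - 1)"
    if "openin (top_of_set Y) W" "a \<in> W" for W a
    using assms(1)
  proof cases
    case 1
    then show ?thesis using that by simp
  qed
  have "openin (top_of_set Y) (Y \<inter> V)" using assms(3) by blast
  then obtain U where U: "p \<in> U" "U \<subseteq> Y \<inter> V" "openin (top_of_set Y) U"
    "subtopology (top_of_set Y) (top_of_set Y frontier_of U) dim_le (n - 1)"
    using dim[of "Y \<inter> V" p] assms(2,4) by (metis Int_iff)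
  have "top_of_set Y frontier_of U \<subseteq> Y" by (metis frontier_of_subset_topspace topspace_euclidean_subtopology)
  then have "subtopology (top_of_set Y) (top_of_set Y frontier_of U) = top_of_set (top_of_set Y frontier_of U)"
    by (simp add: subtopology_subtopology inf.absorb2)
  then show thesis using U(2,4) by (intro that[OF U(1) _ U(3)]) simp_all
qed

lemma compact_frontier_of:
  assumes "compact (Y :: 'a::metric_space set)"
  shows "compact (top_of_set Y frontier_of U)"
  using closedin_frontier_of[of "top_of_set Y" U] assms closedin_compact by blast

lemma dim_le_0_extension:
  fixes Y :: "'a::euclidean_space set"
  assumes "compact Y" "top_of_set Y dim_le 0"
  shows "extension_property TYPE('b::euclidean_space) Y"
proof (rule extension_property_if_frontiers_inessential[where Q = "\<lambda>A. A = {}", OF assms(1)])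
  fix p V assume p: "p \<in> Y" "open V" "p \<in> V"
  obtain U where U: "p \<in> U" "U \<subseteq> V" "openin (top_of_set Y) U"
    "top_of_set (top_of_set Y frontier_of U) dim_le (0 - 1)"
    by (rule dim_le_frontier_nbhd[OF assms(2) p])
  then have "top_of_set Y frontier_of U = {}"
    by (simp add: subtopology_trivial_iff)
  then show "\<exists>U. p \<in> U \<and> U \<subseteq> V \<and> openin (top_of_set Y) U \<and> top_of_set Y frontier_of U = {}"
    using U by blast
next
  fix A :: "'a set" and f :: "'a \<Rightarrow> 'b" assume "A = {}"
  then show "\<exists>c. homotopic_with_canon (\<lambda>_. True) A (- {0}) f (\<lambda>_. c)"
    using homotopic_with_canon_on_empty by blast
qed auto

lemma dim_le_Suc_extension:
  fixes Y :: "'a::euclidean_space set"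
  assumes Y: "compact Y" "top_of_set Y dim_le n"
    and lower: "\<And>Z :: 'a set. compact Z \<Longrightarrow> top_of_set Z dim_le (n - 1) \<Longrightarrow> extension_property TYPE('b::euclidean_space) Z"
  shows "extension_property TYPE('b \<times> real) Y"
proof (rule extension_property_if_frontiers_inessential[where Q = "extension_property TYPE('b)", OF Y(1)])
  fix A and f :: "'a \<Rightarrow> 'b \<times> real"
  assume A: "compact A" "extension_property TYPE('b) A" "continuous_on A f" "0 \<notin> f ` A"
  have "extension_property TYPE('b) {z \<in> A. snd (f z) \<le> 0}"
    by (rule extension_property_subset[OF A(2)]) auto
  then obtain c where "homotopic_with_canon (\<lambda>_. True) A (- {0}) f (\<lambda>_. c)"
    by (rule inessential_if_lower_part_extends[OF A(1,3,4)])
  then show "\<exists>c. homotopic_with_canon (\<lambda>_. True) A (- {0}) f (\<lambda>_. c)" ..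
next
  fix p V assume p: "p \<in> Y" "open V" "p \<in> V"
  obtain U where U: "p \<in> U" "U \<subseteq> V" "openin (top_of_set Y) U"
    "top_of_set (top_of_set Y frontier_of U) dim_le (n - 1)"
    by (rule dim_le_frontier_nbhd[OF Y(2) p])
  then show "\<exists>U. p \<in> U \<and> U \<subseteq> V \<and> openin (top_of_set Y) U \<and>
      extension_property TYPE('b) (top_of_set Y frontier_of U)"
    using lower[OF compact_frontier_of[OF Y(1)] U(4)] by (intro exI[of _ U]) simp
qed (rule extension_property_empty, rule extension_property_Un, assumption+, rule extension_property_subset)

text \<open>Dimension n is matched with maps into (n+1)-space minus the origin, homotopically the
  n-sphere. The induction starts from \<open>real\<close> in dimension 0, and each step adds one
  factor, hence the left-nested type.\<close>

lemma dim_le_2_extension: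
  fixes Y :: "'a::euclidean_space set"
  assumes "compact Y" "top_of_set Y dim_le 2"
  shows "extension_property TYPE((real \<times> real) \<times> real) Y"
proof (rule dim_le_Suc_extension[OF assms])
  fix Z :: "'a set" assume Z: "compact Z" "top_of_set Z dim_le (2 - 1)"
  show "extension_property TYPE(real \<times> real) Z"
    by (rule dim_le_Suc_extension[OF Z]) (simp add: dim_le_0_extension)
qed

text \<open>Any isometry, followed by the Householder reflection along \<open>w\<close> that
  exchanges \<open>f e\<close> with the pole (0, 1). If they already coincide then
  \<open>w = 0\<close>, and division by zero turns \<open>R\<close> into the identity.\<close>

lemma linear_chart_with_prescribed_last_coordinate:
  fixes e :: "'a::euclidean_space"
  assumes "DIM('a) = DIM('b::euclidean_space) + 1" "norm e = 1"
  obtains \<phi> :: "'a \<Rightarrow> 'b::euclidean_space \<times> real" and \<psi> where "linear \<phi>" "linear \<psi>" "\<And>x. \<psi> (\<phi> x) = x"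
    "\<And>y. \<phi> (\<psi> y) = y" "\<And>x. snd (\<phi> x) = x \<bullet> e"
proof -
  obtain f :: "'a \<Rightarrow> 'b \<times> real" and g where fg: "linear f" "linear g" "\<And>x. norm (f x) = norm x"
    "\<And>y. norm (g y) = norm y" "\<And>x. g (f x) = x" "\<And>y. f (g y) = y"
  proof (rule isomorphisms_UNIV_UNIV[where 'M='a and 'N="'b \<times> real"])
    show "DIM('a) = DIM('b \<times> real)" using assms by simp
  qed (rule that)
  have inner_f: "f x \<bullet> f y = x \<bullet> y" for x y
    using fg(3)[of "x + y"] fg(3)[of x] fg(3)[of y] linear_add[OF fg(1), of x y]
    by (metis dot_norm)
  define w where "w = f e - (0, 1)"
  define R where "R y = y - (2 * (y \<bullet> w) / (w \<bullet> w)) *\<^sub>R w" for y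
  have linR: "linear R" unfolding R_def
    by (rule linearI) (simp_all add: inner_add_left algebra_simps add_divide_distrib)
  have RR: "R (R y) = y" for y
  proof (cases "w = 0")
    case False
    then show ?thesis
      by (simp add: R_def inner_diff_left algebra_simps flip: scaleR_left_distrib)
  qed (simp add: R_def)
  have sn: "snd (R y) = y \<bullet> f e" for y
  proof (cases "w = 0")
    case True
    then have "f e = (0, 1)" by (simp add: w_def)
    then show ?thesis using True by (simp add: R_def inner_prod_def)
  next
    case False
    have n: "f e \<bullet> f e = 1" using inner_f[of e e] assms(2) by (simp add: norm_eq_1)
    have ww: "w \<bullet> w = 2 * (1 - snd (f e))"
      by (simp add: w_def inner_diff n inner_commute inner_prod_def[of _ "(0, 1)"])
    have "w \<bullet> w \<noteq> 0" using False by simp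
    then have ne: "1 - snd (f e) \<noteq> 0" using ww by simp
    have sw: "snd w = snd (f e) - 1" by (simp add: w_def)
    have yw: "y \<bullet> w = y \<bullet> f e - snd y" by (simp add: w_def inner_diff_right inner_prod_def[of _ "(0, 1)"])
    have "snd (R y) = snd y - (2 * (y \<bullet> w) / (w \<bullet> w)) * snd w" by (simp add: R_def)
    also have "\<dots> = y \<bullet> f e" unfolding ww sw yw using ne by (simp add: field_simps)
    finally show ?thesis .
  qed
  show thesis
  proof (rule that[of "R \<circ> f" "g \<circ> R"])
    show "linear (R \<circ> f)" "linear (g \<circ> R)" using linR fg by (auto intro: linear_compose)
  qed (simp_all add: fg RR sn inner_f)
qed

text \<open>A local form of the fact that a closed set separating n-space cannot have dimension n -
  2 or less: only the part of the frontier in a ball around an exterior point \<open>v\<close> is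
  used, provided that the ball reaches a point of \<open>U\<close>. The contradiction is between an
  essential Borsuk map around a bounded component and the null-homotopy produced by the extension
  property.\<close>

lemma separator_not_extension:
  fixes U :: "'a::euclidean_space set"
  assumes dims: "DIM('a) = DIM('b::euclidean_space) + 1"
    and U: "open U" and v: "v \<notin> closure U" and u: "u \<in> U" "dist v u < R"
  shows "\<not> extension_property TYPE('b) (frontier U \<inter> cball v R)"
proof
  assume ext: "extension_property TYPE('b) (frontier U \<inter> cball v R)"
  define m where "m x = inverse ((norm (x - v))\<^sup>2) *\<^sub>R (x - v)" for x
  define m' where "m' y = v + inverse ((norm y)\<^sup>2) *\<^sub>R y" for y :: 'a
  have norm_m: "norm (m x) = inverse (norm (x - v))" for x
    by (cases "x = v") (simp_all add: m_def power2_eq_square)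
  have m'm: "m' (m x) = x" if "x \<noteq> v" for x
  proof -
    have "inverse ((norm (m x))\<^sup>2) * inverse ((norm (x - v))\<^sup>2) = 1"
      unfolding norm_m using that by (simp add: power_inverse)
    then show ?thesis unfolding m'_def by (subst (2) m_def) simp
  qed
  have m'_ne: "m' y \<noteq> v" if "y \<noteq> 0" for y using that by (simp add: m'_def)
  have mm': "m (m' y) = y" if "y \<noteq> 0" for y
  proof -
    have "m' y - v = inverse ((norm y)\<^sup>2) *\<^sub>R y" by (simp add: m'_def)
    moreover from this have "norm (m' y - v) = inverse (norm y)"
      using that by (simp add: power2_eq_square)
    ultimately show ?thesis unfolding m_def using that by (simp add: power_inverse)
  qed
  have contm: "continuous_on S m" if "v \<notin> S" for S
    unfolding m_def using that by (intro continuous_intros) auto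
  have contm': "continuous_on S m'" if "0 \<notin> S" for S
    unfolding m'_def using that by (intro continuous_intros) auto
  \<comment> \<open>Since \<open>dist v u < R\<close>, the inversion \<open>m\<close> about \<open>v\<close> moves the sphere of radius \<open>R\<close> strictly to one
    side of \<open>m u\<close>, so only the part of the separator in \<open>frontier U\<close> has to be extended over.\<close>
  define X where "X = frontier U \<inter> cball v R"
  have vX: "v \<notin> X" using v by (auto simp: X_def frontier_def)
  have uv: "u \<noteq> v" using v u(1) closure_subset by auto
  have R: "R > 0" using u(2) by (meson le_less_trans zero_le_dist)
  have cX: "compact X" unfolding X_def by (simp add: closed_Int_compact)
  define a where "a = m u"
  have na: "norm a > inverse R"
    using u(2) uv R unfolding a_def norm_m by (simp add: dist_norm norm_minus_commute)
  have a0: "a \<noteq> 0" using na R by auto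
  \<comment> \<open>The piece of frontier inside the ball need not bound anything by itself; adding
    the sphere closes it up, so that \<open>U \<inter> ball v R\<close> has its boundary in
    \<open>K\<close>.\<close>
  define K where "K = X \<union> sphere v R"
  have vK: "v \<notin> K" using vX R by (auto simp: K_def)
  have cK: "compact K" using cX by (simp add: K_def compact_Un)
  define Z where "Z = m ` K"
  have cZ: "compact Z" unfolding Z_def using contm[OF vK] cK by (rule compact_continuous_image)
  have aZ: "a \<notin> Z"
  proof
    assume "a \<in> Z"
    then obtain x where x: "x \<in> K" "m u = m x" by (auto simp: a_def Z_def)
    then have "u = x" using m'm[of u] m'm[of x] uv vK by metis
    then have "u \<in> frontier U \<or> dist v u = R" using x(1) by (auto simp: K_def X_def)
    then show False using u U by (auto simp: frontier_def interior_open)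
  qed
  define W where "W = U \<inter> ball v R"
  have "open (- closure U)" by (rule open_Compl[OF closed_closure])
  then obtain d where d: "d > 0" "ball v d \<subseteq> - closure U"
    using v unfolding open_contains_ball by blast
  then have dU: "ball v d \<inter> U = {}" using closure_subset[of U] by blast
  define Om where "Om = (- {0}) \<inter> m' -` W"
  have openOm: "open Om" unfolding Om_def
    by (rule continuous_open_preimage[OF contm']) (use U in \<open>auto simp: W_def\<close>)
  have Om_norm: "norm y \<le> inverse d" "inverse R \<le> norm y" if "y \<in> Om" for y
  proof -
    have y: "m' y \<in> W" "y \<noteq> 0" using that by (auto simp: Om_def)
    have ny: "norm y = inverse (norm (m' y - v))" using norm_m[of "m' y"] mm'[OF y(2)] by simp
    have pos: "norm (m' y - v) > 0" using m'_ne[OF y(2)] by simp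
    have "norm (m' y - v) \<ge> d"
    proof (rule ccontr)
      assume "\<not> d \<le> norm (m' y - v)"
      then have "m' y \<in> ball v d" by (simp add: dist_norm norm_minus_commute)
      then show False using y(1) dU by (auto simp: W_def)
    qed
    then show "norm y \<le> inverse d" unfolding ny using d(1) by (simp add: le_imp_inverse_le)
    have "norm (m' y - v) \<le> R" using y(1) by (auto simp: W_def dist_norm norm_minus_commute)
    then show "inverse R \<le> norm y" unfolding ny using pos by (simp add: le_imp_inverse_le)
  qed
  have bOm: "bounded Om" using Om_norm(1) by (meson boundedI)
  have frOm: "frontier Om \<subseteq> Z"
  proof
    fix y assume y: "y \<in> frontier Om"
    then have yc: "y \<in> closure Om" "y \<notin> Om" using openOm by (auto simp: frontier_def interior_open)
    have "closure Om \<subseteq> - ball 0 (inverse R)"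
      by (rule closure_minimal) (use Om_norm(2) in \<open>fastforce simp: not_less[symmetric]\<close>)+
    then have y0: "y \<noteq> 0" using yc(1) R by auto
    have "isCont m' y" using contm'[of "- {0}"] y0 continuous_on_eq_continuous_at[of "- {0}" m'] open_Compl[OF closed_singleton[of "0::'a"]]
    by blast
    moreover obtain s where s: "\<And>n. s n \<in> Om" "s \<longlonglongrightarrow> y"
      using yc(1) unfolding closure_sequential by blast
    ultimately have "(\<lambda>n. m' (s n)) \<longlonglongrightarrow> m' y" by (simp add: isCont_tendsto_compose)
    moreover have "m' (s n) \<in> W" for n using s(1)[of n] by (simp add: Om_def)
    ultimately have "m' y \<in> closure W"
      unfolding closure_sequential by (intro exI[of _ "\<lambda>n. m' (s n)"]) simp
    then have c: "m' y \<in> closure U" "m' y \<in> cball v R"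
      using closure_mono[of W U] closure_mono[of W "ball v R"] R by (auto simp: W_def)
    have "m' y \<notin> W" using yc(2) y0 by (simp add: Om_def)
    then have "m' y \<in> K" using c U by (auto simp: K_def X_def W_def frontier_def interior_open)
    then show "y \<in> Z" unfolding Z_def using mm'[OF y0] by (metis imageI)
  qed
  \<comment> \<open>A connected set that avoids \<open>Z\<close>, and hence the frontier of
    \<open>Om\<close>, cannot leave the bounded set \<open>Om\<close>.\<close>
  have "connected_component_set (- Z) a \<subseteq> Om"
  proof (rule ccontr)
    assume n: "\<not> connected_component_set (- Z) a \<subseteq> Om"
    have "a \<in> Om" using u uv m'm[OF uv] a0 by (simp add: Om_def W_def a_def)
    moreover have "a \<in> connected_component_set (- Z) a"
      using aZ connected_component_refl[of a "- Z"] by simp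
    ultimately have "connected_component_set (- Z) a \<inter> Om \<noteq> {}" by blast
    then have "connected_component_set (- Z) a \<inter> frontier Om \<noteq> {}"
      using n by (intro connected_Int_frontier) auto
    then show False using frOm connected_component_subset[of "- Z" a] by blast
  qed
  then have "bounded (connected_component_set (- Z) a)" using bOm bounded_subset by blast
  then have essential: "\<nexists>c. homotopic_with_canon (\<lambda>x. True) Z (sphere 0 1)
      (\<lambda>x. inverse (norm (x - a)) *\<^sub>R (x - a)) (\<lambda>x. c)"
    using Borsuk_map_essential_bounded_component[OF cZ aZ] by blast
  \<comment> \<open>With this pole, a point of the lower part has inner product with
    \<open>a\<close> at least the square of \<open>norm a\<close>, hence norm at least
    \<open>norm a > inverse R\<close>. The image of the sphere has norm exactly
    \<open>inverse R\<close> and so stays in the upper part.\<close>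
  define e where "e = - (inverse (norm a) *\<^sub>R a)"
  have ne: "norm e = 1" using a0 by (simp add: e_def)
  obtain \<phi> :: "'a \<Rightarrow> 'b \<times> real" and \<psi> where phi: "linear \<phi>" "linear \<psi>" "\<And>x. \<psi> (\<phi> x) = x"
    "\<And>y. \<phi> (\<psi> y) = y" "\<And>x. snd (\<phi> x) = x \<bullet> e"
    by (rule linear_chart_with_prescribed_last_coordinate[OF dims ne]) (rule that)
  define f where "f x = \<phi> (x - a)" for x
  have cf: "continuous_on Z f" unfolding f_def
    by (intro linear_continuous_on_compose[OF _ phi(1)] continuous_intros)
  have f0: "0 \<notin> f ` Z"
  proof
    assume "0 \<in> f ` Z"
    then obtain x where "x \<in> Z" "\<phi> (x - a) = 0" by (auto simp: f_def)
    then have "x - a = 0" using phi(3)[of "x - a"] linear_0[OF phi(2)] by simp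
    then show False using aZ \<open>x \<in> Z\<close> by simp
  qed
  have extX: "extension_property TYPE('b) (m ` X)"
  proof (rule extension_property_homeomorphic[OF ext[folded X_def]])
    show "homeomorphism X (m ` X) m m'"
    proof (rule homeomorphismI)
      show "continuous_on X m" using contm vX by blast
      show "continuous_on (m ` X) m'"
      proof (rule contm')
        show "0 \<notin> m ` X" using vX by (auto simp: m_def)
      qed
      have inv: "m' (m x) = x" if "x \<in> X" for x using m'm[of x] vX that by metis
      show "m' (m x) = x" if "x \<in> X" for x using inv that .
      show "m' ` m ` X \<subseteq> X" using inv by auto
      show "m (m' y) = y" if "y \<in> m ` X" for y using that inv by auto
    qed auto
  qed
  have "extension_property TYPE('b) {z \<in> Z. snd (f z) \<le> 0}"
  proof (rule extension_property_subset[OF extX])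
    show "{z \<in> Z. snd (f z) \<le> 0} \<subseteq> m ` X"
    proof clarify
      fix z assume z: "z \<in> Z" "snd (f z) \<le> 0"
      then obtain x where x: "x \<in> K" "z = m x" by (auto simp: Z_def)
      have "x \<notin> sphere v R"
      proof
        assume "x \<in> sphere v R"
        then have "norm z = inverse R" using x(2) norm_m by (simp add: dist_norm norm_minus_commute)
        moreover have "\<bar>z \<bullet> e\<bar> \<le> norm z" using Cauchy_Schwarz_ineq2[of z e] ne by simp
        moreover have "a \<bullet> e = - norm a" using a0 by (simp add: e_def dot_square_norm power2_eq_square)
        moreover have "z \<bullet> e - a \<bullet> e \<le> 0" using z(2) by (simp add: f_def phi(5) inner_diff_left)
        ultimately show False using na by linarith
      qed
      then show "z \<in> m ` X" using x by (auto simp: K_def)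
    qed
  qed
  then obtain c where c: "homotopic_with_canon (\<lambda>_. True) Z (- {0}) f (\<lambda>_. c)"
    by (rule inessential_if_lower_part_extends[OF cZ cf f0])
  define h where "h y = inverse (norm (\<psi> y)) *\<^sub>R \<psi> y" for y
  have psi0: "\<psi> y \<noteq> 0" if "y \<noteq> 0" for y using phi(4)[of y] linear_0[OF phi(1)] that by metis
  have ch: "continuous_on (- {0}) h" unfolding h_def
    by (intro continuous_intros linear_continuous_on_compose[OF _ phi(2)]) (use psi0 in auto)
  have "homotopic_with_canon (\<lambda>_. True) Z (sphere 0 1) (h \<circ> f) (h \<circ> (\<lambda>_. c))"
    by (rule homotopic_with_compose_continuous_left[OF c ch]) (use psi0 in \<open>auto simp: h_def\<close>)
  moreover have "h \<circ> f = (\<lambda>x. inverse (norm (x - a)) *\<^sub>R (x - a))" by (auto simp: h_def f_def phi(3))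
  ultimately show False using essential by (auto simp: comp_def)
qed

corollary frontier_not_dim_le_2:
  fixes U :: "(complex \<times> complex) set"
  assumes "open U" "v \<notin> closure U" "u \<in> U" "dist v u < R"
  shows "\<not> top_of_set (frontier U \<inter> cball v R) dim_le 2"
proof
  assume dim: "top_of_set (frontier U \<inter> cball v R) dim_le 2"
  have "compact (frontier U \<inter> cball v R)" by (simp add: closed_Int_compact)
  then show False
    using separator_not_extension[OF _ assms, where 'b = "(real \<times> real) \<times> real"] dim_le_2_extension[OF _ dim] by simp
qed

section \<open>Dimension of nowhere dense subsets\<close>

lemma dense_avoiding_finite:
  fixes E :: "real set"
  assumes dense: "\<And>a b. a < b \<Longrightarrow> \<exists>e\<in>E. a < e \<and> e < b" and "finite F" "d > 0"
  obtains a b where "a \<in> E" "b \<in> E" "a \<notin> F" "b \<notin> F" "c - d < a" "a < c" "c < b" "b < c + d"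
    "\<And>x. x \<in> F \<Longrightarrow> a \<le> x \<Longrightarrow> x \<le> b \<Longrightarrow> x = c"
proof -
  obtain r where r: "r > 0" "\<And>x. x \<in> F \<Longrightarrow> x \<noteq> c \<Longrightarrow> r \<le> dist c x"
    using finite_set_avoid[OF assms(2), of c] by blast
  define s where "s = min r d"
  have s: "s > 0" "s \<le> r" "s \<le> d" using r(1) assms(3) by (auto simp: s_def)
  obtain a where a: "a \<in> E" "c - s < a" "a < c" using dense[of "c - s" c] s(1) by auto
  obtain b where b: "b \<in> E" "c < b" "b < c + s" using dense[of c "c + s"] s(1) by auto
  have only: "x = c" if "x \<in> F" "a \<le> x" "x \<le> b" for x
  proof (rule ccontr)
    assume "x \<noteq> c"
    then have "r \<le> \<bar>c - x\<bar>" using r(2)[OF that(1)] by (simp add: dist_real_def)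
    then show False using that a b s by linarith
  qed
  have "a \<notin> F" "b \<notin> F" using a b only[of a] only[of b] by auto
  moreover have "c - d < a" "b < c + d" using a b s by linarith+
  ultimately show thesis using a b only by (intro that[of a b]) assumption+
qed

text \<open>The assumption \<open>slices\<close> replaces a coordinate chart. The functions
  \<open>c i\<close> may take equal values at several points of \<open>X\<close>, but some
  \<open>W\<close> around \<open>p\<close> isolates the points near \<open>p\<close> from the others
  with close coordinates: nothing of the small box lies on the boundary of \<open>W\<close>. All
  frontier points are therefore on the faces of the box.\<close>

lemma grid_avoiding_dim_le:
  fixes c :: "nat \<Rightarrow> 'a::metric_space \<Rightarrow> real"
  assumes cont: "\<And>i. i < n \<Longrightarrow> continuous_on UNIV (c i)"
    and dense: "\<And>i a b. i < n \<Longrightarrow> a < b \<Longrightarrow> \<exists>e\<in>E i. a < e \<and> e < b"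
    and slices: "\<And>p V. p \<in> X \<Longrightarrow> open V \<Longrightarrow> p \<in> V \<Longrightarrow> \<exists>\<delta>>0. \<exists>W. open W \<and> p \<in> W \<and>
        (\<forall>q\<in>X \<inter> closure W. (\<forall>i<n. \<bar>c i q - c i p\<bar> \<le> \<delta>) \<longrightarrow> q \<in> W \<inter> V)"
    and avoid: "\<And>p. p \<in> X \<Longrightarrow> \<exists>i<n. c i p \<notin> E i"
  shows "top_of_set X dim_le (int n - 1)"
proof -
  \<comment> \<open>The frontier of a small box with faces in the grid has one more coordinate in a finite part of the
    grid than the set itself; after \<open>n\<close> steps nothing is left.\<close>
  have main: "top_of_set Y dim_le (int k - 1)"
    if "k \<le> n" "Y \<subseteq> X" "\<And>i. i < n \<Longrightarrow> finite (F i) \<and> F i \<subseteq> E i"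
      "\<And>q. q \<in> Y \<Longrightarrow> n - k \<le> card {i. i < n \<and> c i q \<in> F i}" for k Y F
    using that
  proof (induction k arbitrary: Y F)
    case 0
    have "Y = {}"
    proof (rule ccontr)
      assume "Y \<noteq> {}"
      then obtain q where q: "q \<in> Y" by auto
      have "n \<le> card {i. i < n \<and> c i q \<in> F i}" using 0(4)[OF q] by simp
      moreover have "{i. i < n \<and> c i q \<in> F i} \<subseteq> {..<n}" by auto
      ultimately have "{i. i < n \<and> c i q \<in> F i} = {..<n}"
        by (metis card_lessThan card_seteq finite_lessThan)
      moreover obtain i where "i < n" "c i q \<notin> E i" using avoid q 0(2) by blast
      ultimately show False using 0(3)[of i] by auto
    qed
    then show ?case by simp
  next
    case (Suc k)
    show ?case
    proof (rule dimension_le.intros)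
      fix V p assume V: "openin (top_of_set Y) V" "p \<in> V"
      obtain V' where V': "open V'" "V = Y \<inter> V'" using V(1) unfolding openin_open by blast
      have pY: "p \<in> Y" "p \<in> V'" using V V' by auto
      obtain \<delta> W where W123: "\<delta> > 0" "open W" "p \<in> W"
        and W4: "\<forall>q\<in>X \<inter> closure W. (\<forall>i<n. \<bar>c i q - c i p\<bar> \<le> \<delta>) \<longrightarrow> q \<in> W \<inter> V'"
        using slices[OF subsetD[OF Suc.prems(2) pY(1)] V'(1) pY(2)] by blast
      have "q \<in> W \<inter> V'" if "q \<in> X" "q \<in> closure W" "\<And>i. i < n \<Longrightarrow> \<bar>c i q - c i p\<bar> \<le> \<delta>" for q
        using W4 that by simp
      note W = W123 this
      have "\<exists>a b. a \<in> E i \<and> b \<in> E i \<and> a \<notin> F i \<and> b \<notin> F i \<and> c i p - \<delta> < a \<and> a < c i p \<and> c i p < b \<and>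
          b < c i p + \<delta> \<and> (\<forall>x\<in>F i. a \<le> x \<longrightarrow> x \<le> b \<longrightarrow> x = c i p)" if i: "i < n" for i
      proof -
        have fin: "finite (F i)" using Suc.prems(3) i by blast
        show ?thesis
          by (rule dense_avoiding_finite[of "E i" "F i" \<delta> "c i p", OF dense[OF i] fin W(1)]) blast+
      qed
      then obtain a b where ab: "\<And>i. i < n \<Longrightarrow> a i \<in> E i \<and> b i \<in> E i \<and> a i \<notin> F i \<and> b i \<notin> F i \<and> c i p - \<delta> < a i \<and>
          a i < c i p \<and> c i p < b i \<and> b i < c i p + \<delta> \<and> (\<forall>x\<in>F i. a i \<le> x \<longrightarrow> x \<le> b i \<longrightarrow> x = c i p)"
        by metis
      define Q where "Q = (\<Inter>i<n. {q. a i < c i q \<and> c i q < b i})"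
      define K where "K = (\<Inter>i<n. {q. a i \<le> c i q \<and> c i q \<le> b i})"
      have "open Q" unfolding Q_def
      proof (intro open_INT ballI)
        fix i assume "i \<in> {..<n}"
        then have "open (c i -` {a i<..<b i})" by (intro open_vimage cont) auto
        then show "open {q. a i < c i q \<and> c i q < b i}" by (simp add: vimage_def)
      qed simp
      have "closed K" unfolding K_def
      proof (intro closed_INT ballI)
        fix i assume "i \<in> {..<n}"
        then have "closed (c i -` {a i..b i})" by (intro closed_vimage cont) auto
        then show "closed {q. a i \<le> c i q \<and> c i q \<le> b i}" by (simp add: vimage_def)
      qed
      define U where "U = Y \<inter> (Q \<inter> W)"
      have opU: "openin (top_of_set Y) U" unfolding U_def using \<open>open Q\<close> W(2) by blast
      have QK: "Q \<subseteq> K" by (auto simp: Q_def K_def less_imp_le)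
      have K_small: "\<bar>c i q - c i p\<bar> \<le> \<delta>" if "q \<in> K" "i < n" for q i
      proof -
        have "a i \<le> c i q" "c i q \<le> b i" using that by (auto simp: K_def)
        then show ?thesis using ab[OF that(2)] by linarith
      qed
      define Z where "Z = top_of_set Y frontier_of U"
      have ZY: "Z \<subseteq> Y" unfolding Z_def
        by (metis frontier_of_subset_topspace topspace_euclidean_subtopology)
      have Z: "q \<in> K \<and> q \<in> W \<and> q \<notin> Q" if q: "q \<in> Z" for q
      proof -
        have "Y \<inter> U = U" by (auto simp: U_def)
        then have "q \<in> closure U" "q \<notin> U"
          using q opU unfolding Z_def frontier_of_def
          by (simp_all add: interior_of_openin closure_of_subtopology)
        moreover have "closure U \<subseteq> K" "closure U \<subseteq> closure W"
          by (rule closure_minimal[OF _ \<open>closed K\<close>]; use QK in \<open>auto simp: U_def\<close>)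
            (rule closure_mono; auto simp: U_def)
        ultimately have qK: "q \<in> K" "q \<in> closure W" "q \<notin> U" by auto
        have "q \<in> W" using W(4)[of q] qK ZY q Suc.prems(2) K_small by blast
        then show ?thesis using qK ZY q by (auto simp: U_def)
      qed
      define F' where "F' i = F i \<union> {a i, b i}" for i
      have "top_of_set Z dim_le (int k - 1)"
      proof (rule Suc.IH[where F = F'])
        show "k \<le> n" "Z \<subseteq> X" using Suc.prems ZY by auto
        show "finite (F' i) \<and> F' i \<subseteq> E i" if "i < n" for i
          using Suc.prems(3)[OF that] ab[OF that] by (auto simp: F'_def)
        fix q assume q: "q \<in> Z"
        then obtain i where i: "i < n" "\<not> (a i < c i q \<and> c i q < b i)" using Z[OF q] by (auto simp: Q_def)
        then have "a i \<le> c i q" "c i q \<le> b i" using Z[OF q] by (auto simp: K_def)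
        then have ci: "c i q = a i \<or> c i q = b i" using i(2) by linarith
        \<comment> \<open>The new faces were chosen outside the finite set \<open>F i\<close>, so
          coordinate \<open>i\<close> was not counted before and the count rises by one.\<close>
        have "i \<notin> {i. i < n \<and> c i q \<in> F i}" using ci ab[OF i(1)] by auto
        then have "card (insert i {i. i < n \<and> c i q \<in> F i}) = Suc (card {i. i < n \<and> c i q \<in> F i})" by simp
        moreover have "card (insert i {i. i < n \<and> c i q \<in> F i}) \<le> card {i. i < n \<and> c i q \<in> F' i}"
          by (rule card_mono) (use ci i(1) in \<open>auto simp: F'_def\<close>)
        moreover have "n - Suc k \<le> card {i. i < n \<and> c i q \<in> F i}" using Suc.prems(4) q ZY by blast
        ultimately show "n - k \<le> card {i. i < n \<and> c i q \<in> F' i}" by linarith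
      qed
      moreover have "subtopology (top_of_set Y) Z = top_of_set Z"
        using ZY by (simp add: subtopology_subtopology inf.absorb2)
      moreover have "p \<in> U" using pY W(3) ab by (auto simp: U_def Q_def)
      moreover have "U \<subseteq> V"
      proof
        fix q assume q: "q \<in> U"
        then have "q \<in> K" "q \<in> closure W" "q \<in> X" "q \<in> Y"
          using QK closure_subset[of W] Suc.prems(2) by (auto simp: U_def)
        then show "q \<in> V" using W(4)[of q] K_small V'(2) by blast
      qed
      ultimately show "\<exists>U. p \<in> U \<and> U \<subseteq> V \<and> openin (top_of_set Y) U \<and>
          subtopology (top_of_set Y) (top_of_set Y frontier_of U) dim_le (int (Suc k) - 1 - 1)"
        using opU by (intro exI[of _ U]) (simp add: Z_def)
    qed simp
  qed
  show ?thesis by (rule main[of n X "\<lambda>_. {}"]) auto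
qed

section \<open>The projection of the surface to the (x, y)-plane\<close>

definition proj :: "point \<Rightarrow> complex \<times> complex" where
  "proj = (\<lambda>(x, y, z). (x, y))"

lemma proj_simp [simp]: "proj (x, y, z) = (x, y)"
  by (simp add: proj_def)

lemma continuous_on_proj [continuous_intros]: "continuous_on S proj"
  unfolding proj_def case_prod_unfold by (intro continuous_intros)

lemma closed_surf: "closed (surf A B C D)"
proof -
  have "surf A B C D = {p. (fst p)\<^sup>2 + (fst (snd p))\<^sup>2 + (snd (snd p))\<^sup>2 + fst p * fst (snd p) * snd (snd p) =
      A * fst p + B * fst (snd p) + C * snd (snd p) + D}"
    by (auto simp: surf_def)
  also have "closed \<dots>" by (intro closed_Collect_eq continuous_intros)
  finally show ?thesis .
qed

text \<open>The surface equation is a monic quadratic in z with coefficients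
  \<open>x * y - C\<close> and \<open>x\<^sup>2 + y\<^sup>2 - A * x - B * y - D\<close>; this is the
  usual root bound. It makes \<open>proj\<close> proper on the surface, hence a closed map.\<close>

lemma surf_third_bound:
  assumes "(x, y, z) \<in> surf A B C D"
  shows "norm z \<le> 1 + norm (x * y - C) + norm (x\<^sup>2 + y\<^sup>2 - A * x - B * y - D)"
proof (rule ccontr)
  define b where "b = norm (x * y - C)"
  define c where "c = norm (x\<^sup>2 + y\<^sup>2 - A * x - B * y - D)"
  assume "\<not> ?thesis"
  then have big: "norm z > 1 + b + c" by (simp add: b_def c_def)
  have pos: "b \<ge> 0" "c \<ge> 0" by (simp_all add: b_def c_def)
  have "x\<^sup>2 + y\<^sup>2 + z\<^sup>2 + x * y * z = A * x + B * y + C * z + D"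
    using assms by (simp add: surf_def)
  then have "z\<^sup>2 = - ((x * y - C) * z) - (x\<^sup>2 + y\<^sup>2 - A * x - B * y - D)"
    by (simp add: algebra_simps add_eq_0_iff)
  then have "norm z ^ 2 = norm (- ((x * y - C) * z) - (x\<^sup>2 + y\<^sup>2 - A * x - B * y - D))"
    by (metis norm_power)
  also have "\<dots> \<le> b * norm z + c"
    unfolding b_def c_def by (rule order_trans[OF norm_triangle_ineq4]) (simp add: norm_mult)
  finally have "norm z ^ 2 \<le> b * norm z + c" .
  moreover have "c \<le> c * norm z" using big pos by (simp add: mult_le_cancel_left1)
  ultimately have "norm z * norm z \<le> (b + c) * norm z" by (simp add: power2_eq_square algebra_simps)
  then show False using big pos by (simp add: mult_le_cancel_right)
qed

lemma closed_proj_image: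
  assumes "closed Y" "Y \<subseteq> surf A B C D"
  shows "closed (proj ` Y)"
  unfolding closed_sequential_limits
proof (intro allI impI, elim conjE)
  fix s l assume s: "\<forall>n. s n \<in> proj ` Y" and l: "s \<longlonglongrightarrow> l"
  have "\<exists>z. (fst (s n), snd (s n), z) \<in> Y" for n
  proof -
    obtain p where "p \<in> Y" "s n = proj p" using s by blast
    then show ?thesis by (cases p) auto
  qed
  then obtain z where z: "\<And>n. (fst (s n), snd (s n), z n) \<in> Y" by metis
  define x y where "x = (\<lambda>n. fst (s n))" and "y = (\<lambda>n. snd (s n))"
  have xy: "x \<longlonglongrightarrow> fst l" "y \<longlonglongrightarrow> snd l"
    unfolding x_def y_def using l by (auto intro: tendsto_intros)
  define M where "M n = 1 + norm (x n * y n - C) + norm ((x n)\<^sup>2 + (y n)\<^sup>2 - A * x n - B * y n - D)" for n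
  have "M \<longlonglongrightarrow> 1 + norm (fst l * snd l - C) + norm ((fst l)\<^sup>2 + (snd l)\<^sup>2 - A * fst l - B * snd l - D)"
    unfolding M_def by (intro tendsto_intros xy)
  then have "bounded (range M)" using convergent_imp_bounded by blast
  then obtain m where m: "\<And>n. norm (M n) \<le> m" by (auto simp: bounded_iff)
  have "norm (z n) \<le> m" for n
  proof -
    have "norm (z n) \<le> M n"
      unfolding M_def x_def y_def using surf_third_bound z assms(2) by blast
    then show ?thesis using m[of n] by simp
  qed
  then have "\<forall>n. z n \<in> cball 0 m" by simp
  then obtain w r where w: "strict_mono (r :: nat \<Rightarrow> nat)" "(z \<circ> r) \<longlonglongrightarrow> w"
    using compact_cball[of "0::complex" m] unfolding compact_def by blast
  have "(\<lambda>n. (x (r n), y (r n), z (r n))) \<longlonglongrightarrow> (fst l, snd l, w)"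
    using LIMSEQ_subseq_LIMSEQ[OF xy(1) w(1)] LIMSEQ_subseq_LIMSEQ[OF xy(2) w(1)] w(2)
    by (auto simp: o_def intro!: tendsto_intros)
  then have "(fst l, snd l, w) \<in> Y"
    using closed_sequentially[OF assms(1)] z by (metis (no_types, lifting) x_def y_def)
  then show "l \<in> proj ` Y" by (force simp: proj_def)
qed

definition base_coord :: "nat \<Rightarrow> point \<Rightarrow> real" where
  "base_coord i p = [Re (fst p), Im (fst p), Re (fst (snd p)), Im (fst (snd p))] ! i"

lemma all_less_4: "(\<forall>i<4. P i) \<longleftrightarrow> P 0 \<and> P 1 \<and> P 2 \<and> P (3::nat)"
  by (auto simp: less_Suc_eq numeral_eq_Suc)

lemma base_coord_simps [simp]:
  "base_coord 0 p = Re (fst p)" "base_coord (Suc 0) p = Im (fst p)"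
  "base_coord 2 p = Re (fst (snd p))" "base_coord 3 p = Im (fst (snd p))"
  by (simp_all add: base_coord_def numeral_eq_Suc)

lemma surf_fibre:
  assumes "(x, y, z) \<in> surf A B C D" "(x, y, z') \<in> surf A B C D"
  shows "z' = z \<or> z' = C - x * y - z"
proof -
  have "(z' - z) * (z' - (C - x * y - z)) = 0"
    using assms unfolding surf_def mem_Collect_eq prod.case by algebra
  then show ?thesis by auto
qed

lemma continuous_on_base_coord:
  assumes "i < 4" shows "continuous_on S (base_coord i)"
proof -
  have "\<forall>i<4. continuous_on S (base_coord i)"
    unfolding all_less_4 by (auto simp: base_coord_def intro!: continuous_intros)
  then show ?thesis using assms by blast
qed

text \<open>The fibre over (x0, y0) consists of z0 and its conjugate root z1. A circle around z0
  that misses both keeps missing the fibres over all nearby base points, because the projection of a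
  closed subset is closed. This also covers branch points, where z1 = z0.\<close>

lemma surf_slices:
  assumes p: "p \<in> surf A B C D" "open V" "p \<in> V"
  shows "\<exists>\<delta>>0. \<exists>W. open W \<and> p \<in> W \<and>
    (\<forall>q\<in>surf A B C D \<inter> closure W. (\<forall>i<4. \<bar>base_coord i q - base_coord i p\<bar> \<le> \<delta>) \<longrightarrow> q \<in> W \<inter> V)"
proof -
  obtain x0 y0 z0 where p0: "p = (x0, y0, z0)" by (cases p)
  obtain e where e: "e > 0" "ball p e \<subseteq> V" using p open_contains_ball by blast
  define z1 where "z1 = C - x0 * y0 - z0"
  \<comment> \<open>Two candidate radii suffice, since only the single value
    \<open>norm (z1 - z0)\<close> is forbidden.\<close>
  obtain \<epsilon> where eps: "0 < \<epsilon>" "\<epsilon> \<le> e / 3" "\<epsilon> \<noteq> norm (z1 - z0)"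
  proof (cases "e / 3 = norm (z1 - z0)")
    case True
    then show ?thesis using that[of "e / 4"] e(1) by auto
  next
    case False
    then show ?thesis using that[of "e / 3"] e(1) by auto
  qed
  define T where "T = surf A B C D \<inter> {q. norm (snd (snd q) - z0) = \<epsilon>}"
  have "closed {q :: point. norm (snd (snd q) - z0) = \<epsilon>}"
    by (intro closed_Collect_eq continuous_intros)
  then have "closed T" unfolding T_def using closed_surf by (intro closed_Int)
  then have clT: "closed (proj ` T)" by (rule closed_proj_image) (auto simp: T_def)
  have "(x0, y0) \<notin> proj ` T"
  proof
    assume "(x0, y0) \<in> proj ` T"
    then obtain z where z: "(x0, y0, z) \<in> surf A B C D" "norm (z - z0) = \<epsilon>"
      by (auto simp: T_def proj_def)
    then have "z = z0 \<or> z = z1" using surf_fibre[of x0 y0 z0 A B C D z] p(1) p0 by (simp add: z1_def)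
    then show False using z eps by auto
  qed
  then obtain d where d: "d > 0" "ball (x0, y0) d \<subseteq> - proj ` T"
    using open_Compl[OF clT] unfolding open_contains_ball by blast
  \<comment> \<open>Four real deviations of size \<delta> move the base point by at most 4 \<delta>,
    which is at most half of \<open>d\<close> and of \<open>e\<close>; with \<epsilon> at most a
    third of \<open>e\<close> the sum stays below \<open>e\<close>.\<close>
  define \<delta> where "\<delta> = min d e / 8"
  have del: "\<delta> > 0" "8 * \<delta> \<le> d" "8 * \<delta> \<le> e" using d e by (auto simp: \<delta>_def)
  define W where "W = {q :: point. norm (snd (snd q) - z0) < \<epsilon>}"
  have opW: "open W" unfolding W_def by (intro open_Collect_less continuous_intros)
  have "closed {q :: point. norm (snd (snd q) - z0) \<le> \<epsilon>}"
    by (intro closed_Collect_le continuous_intros)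
  then have clW: "closure W \<subseteq> {q. norm (snd (snd q) - z0) \<le> \<epsilon>}"
    by (rule closure_minimal[rotated]) (auto simp: W_def)
  have "q \<in> W \<inter> V" if q: "q \<in> surf A B C D" "q \<in> closure W" "\<forall>i<4. \<bar>base_coord i q - base_coord i p\<bar> \<le> \<delta>" for q
  proof -
    obtain x y z where q0: "q = (x, y, z)" by (cases q)
    have c: "\<bar>Re x - Re x0\<bar> \<le> \<delta>" "\<bar>Im x - Im x0\<bar> \<le> \<delta>" "\<bar>Re y - Re y0\<bar> \<le> \<delta>" "\<bar>Im y - Im y0\<bar> \<le> \<delta>"
      using q(3) unfolding all_less_4 by (simp_all add: q0 p0)
    have nx: "norm (x - x0) \<le> 2 * \<delta>" using cmod_le[of "x - x0"] c by simp
    have ny: "norm (y - y0) \<le> 2 * \<delta>" using cmod_le[of "y - y0"] c by simp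
    have nz: "norm (z - z0) \<le> \<epsilon>" using clW q(2) q0 by auto
    have xy: "norm ((x, y) - (x0, y0)) \<le> 4 * \<delta>"
      using norm_Pair_le[of "x - x0" "y - y0"] nx ny by simp
    then have "norm ((x, y) - (x0, y0)) < d" using del by linarith
    then have "(x, y) \<in> ball (x0, y0) d" by (metis dist_commute dist_norm mem_ball)
    then have "q \<notin> T" using d(2) q0 by (force simp: image_iff)
    then have "norm (z - z0) \<noteq> \<epsilon>" using q(1) q0 by (auto simp: T_def)
    then have "q \<in> W" using nz q0 by (simp add: W_def)
    have "norm (q - p) \<le> norm (x - x0) + norm ((y, z) - (y0, z0))"
      using norm_Pair_le[of "x - x0" "(y - y0, z - z0)"] by (simp add: q0 p0)
    also have "\<dots> \<le> norm (x - x0) + (norm (y - y0) + norm (z - z0))"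
      using norm_Pair_le[of "y - y0" "z - z0"] by simp
    also have "\<dots> < e" using nx ny nz del eps by linarith
    finally have "q \<in> ball p e" by (metis dist_commute dist_norm mem_ball)
    then show ?thesis using e(2) \<open>q \<in> W\<close> by blast
  qed
  moreover have "p \<in> W" using eps by (simp add: W_def p0)
  ultimately show ?thesis using del(1) opW by (intro exI[of _ \<delta>] exI[of _ W] conjI) auto
qed

text \<open>For each \<open>q\<close> the good translations form an open dense set, so by Baire
  category some translation is good for all countably many \<open>q\<close> at once.\<close>

lemma translate_avoiding_closed:
  fixes X Q :: "'a::euclidean_space set"
  assumes "closed X" "interior X = {}" "countable Q"
  obtains t where "\<And>q. q \<in> Q \<Longrightarrow> t + q \<notin> X"
proof -
  define G where "G = (\<lambda>q. {t. t + q \<notin> X}) ` Q"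
  have eq: "{t. t + q \<notin> X} = - ((+) (- q) ` X)" for q by force
  have "UNIV \<subseteq> closure (\<Inter>G)"
  proof (rule Baire)
    show "countable G" using assms(3) by (simp add: G_def)
    fix T assume "T \<in> G"
    then obtain q where T: "T = - ((+) (- q) ` X)" by (auto simp: G_def eq)
    have "closed ((+) (- q) ` X)" using assms(1) by (rule closed_translation)
    moreover have "interior ((+) (- q) ` X) = {}" by (simp only: interior_translation assms(2) image_empty)
    ultimately show "openin (top_of_set UNIV) T \<and> UNIV \<subseteq> closure T"
      unfolding T closure_complement by (simp add: open_Compl)
  qed simp
  then have "\<Inter>G \<noteq> {}" by auto
  then obtain t where "t \<in> \<Inter>G" by blast
  then show thesis using that[of t] by (auto simp: G_def)
qed

lemma dim_le_3_if_nowhere_dense_projection: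
  assumes X: "closed X" "X \<subseteq> surf A B C D" and int: "interior (proj ` X) = {}"
  shows "top_of_set X dim_le 3"
proof -
  define gauss where "gauss = (\<lambda>(a, b). Complex a b) ` (\<rat> \<times> \<rat>)"
  have "countable gauss" unfolding gauss_def by (intro countable_image countable_SIGMA countable_rat)
  then have "countable (gauss \<times> gauss)" by (intro countable_SIGMA)
  then obtain t where t: "\<And>q. q \<in> gauss \<times> gauss \<Longrightarrow> t + q \<notin> proj ` X"
    using translate_avoiding_closed[OF closed_proj_image[OF X] int] by metis
  define off where "off i = base_coord i (fst t, snd t, 0)" for i
  define E where "E i = (+) (off i) ` \<rat>" for i
  have "top_of_set X dim_le (int 4 - 1)"
  proof (rule grid_avoiding_dim_le[where c = base_coord and E = E])
    fix i :: nat and a b :: real assume "a < b"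
    then obtain r where "r \<in> \<rat>" "a - off i < r" "r < b - off i"
      using Rats_dense_in_real[of "a - off i" "b - off i"] by auto
    then show "\<exists>e\<in>E i. a < e \<and> e < b"
      by (intro bexI[of _ "off i + r"]) (auto simp: E_def)
  next
    fix p V assume p: "p \<in> X" "open V" "p \<in> V"
    obtain \<delta> W where "\<delta> > 0" "open W" "p \<in> W"
      "\<forall>q\<in>surf A B C D \<inter> closure W. (\<forall>i<4. \<bar>base_coord i q - base_coord i p\<bar> \<le> \<delta>) \<longrightarrow> q \<in> W \<inter> V"
      using surf_slices[OF subsetD[OF X(2) p(1)] p(2,3)] by blast
    then show "\<exists>\<delta>>0. \<exists>W. open W \<and> p \<in> W \<and>
        (\<forall>q\<in>X \<inter> closure W. (\<forall>i<4. \<bar>base_coord i q - base_coord i p\<bar> \<le> \<delta>) \<longrightarrow> q \<in> W \<inter> V)"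
      using X(2) by (intro exI[of _ \<delta>] exI[of _ W] conjI ballI) auto
  next
    fix p assume p: "p \<in> X"
    show "\<exists>i<4. base_coord i p \<notin> E i"
    proof (rule ccontr)
      assume "\<not> ?thesis"
      then have all: "\<forall>i<4. base_coord i p \<in> E i" by blast
      obtain x y z where p0: "p = (x, y, z)" by (cases p)
      have r: "Re x - Re (fst t) \<in> \<rat>" "Im x - Im (fst t) \<in> \<rat>" "Re y - Re (snd t) \<in> \<rat>" "Im y - Im (snd t) \<in> \<rat>"
        using all unfolding all_less_4 by (auto simp: E_def off_def p0)
      have g: "x - fst t \<in> gauss" "y - snd t \<in> gauss"
        unfolding gauss_def
        using image_eqI[of "x - fst t" "\<lambda>(a, b). Complex a b" "(Re x - Re (fst t), Im x - Im (fst t))" "\<rat> \<times> \<rat>"]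
          image_eqI[of "y - snd t" "\<lambda>(a, b). Complex a b" "(Re y - Re (snd t), Im y - Im (snd t))" "\<rat> \<times> \<rat>"] r
        by (simp_all add: complex_eq_iff)
      have "t + (x - fst t, y - snd t) = (x, y)" by (simp add: prod_eq_iff)
      moreover have "(x, y) \<in> proj ` X" using p p0 by (force simp: image_iff)
      ultimately show False using t[of "(x - fst t, y - snd t)"] g by simp
    qed
  qed (rule continuous_on_base_coord)
  then show ?thesis by simp
qed

section \<open>Sets saturated for the projection\<close>

lemma continuous_on_s_x: "continuous_on S (s_x A)"
  unfolding s_x_def case_prod_unfold by (intro continuous_intros)

lemma continuous_on_s_y: "continuous_on S (s_y B)"
  unfolding s_y_def case_prod_unfold by (intro continuous_intros)

lemma continuous_on_s_z: "continuous_on S (s_z C)"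
  unfolding s_z_def case_prod_unfold by (intro continuous_intros)

lemma same_projection:
  assumes "p \<in> surf A B C D" "q \<in> surf A B C D" "proj p = proj q"
  shows "q = p \<or> q = s_z C p"
proof -
  obtain x y z where p: "p = (x, y, z)" by (cases p)
  obtain z' where q: "q = (x, y, z')" using assms(3) p by (cases q) auto
  show ?thesis using surf_fibre[of x y z A B C D z'] assms p q by (auto simp: s_z_def algebra_simps)
qed

lemma proj_s_z [simp]: "proj (s_z C p) = proj p"
  by (cases p) (simp add: s_z_def)

text \<open>A set closed under \<open>s_z\<close> contains the whole fibre over each point of its
  image, so an open set inside the image would pull back to a nonempty relatively open subset of
  \<open>X\<close>.\<close>

lemma empty_interior_projection:
  assumes X: "X \<subseteq> surf A B C D" "s_z C ` X \<subseteq> X"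
    and nd: "\<And>O'. openin (top_of_set (surf A B C D)) O' \<Longrightarrow> O' \<subseteq> X \<Longrightarrow> O' = {}"
  shows "interior (proj ` X) = {}"
proof (rule ccontr)
  assume ne: "interior (proj ` X) \<noteq> {}"
  define O' where "O' = surf A B C D \<inter> proj -` interior (proj ` X)"
  have "open (proj -` interior (proj ` X))"
    by (intro open_vimage continuous_on_proj) simp
  then have "openin (top_of_set (surf A B C D)) O'" unfolding O'_def by blast
  moreover have "O' \<subseteq> X"
  proof
    fix p assume p: "p \<in> O'"
    then have "proj p \<in> proj ` X"
      using subsetD[OF interior_subset[of "proj ` X"], of "proj p"] by (simp add: O'_def)
    then obtain q where q: "q \<in> X" "proj q = proj p" by (metis imageE)
    then have "p = q \<or> p = s_z C q"
      using same_projection[of q A B C D p] p X(1) unfolding O'_def by blast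
    then show "p \<in> X" using q(1) X(2) by auto
  qed
  moreover have "O' \<noteq> {}"
  proof -
    obtain b where b: "b \<in> interior (proj ` X)" using ne by blast
    then obtain q where "q \<in> X" "proj q = b" using interior_subset[of "proj ` X"] by blast
    then have "q \<in> O'" using b X(1) by (auto simp: O'_def)
    then show ?thesis by blast
  qed
  ultimately show False using nd by blast
qed

section \<open>Separation in the surface\<close>

text \<open>The discriminant of the surface equation as a quadratic in z. Its zeros form the branch
  curve of \<open>proj\<close>; locally off the curve the two sheets are graphs.\<close>

definition disc :: "complex \<Rightarrow> complex \<Rightarrow> complex \<Rightarrow> complex \<Rightarrow> complex \<times> complex \<Rightarrow> complex" where
  "disc A B C D q = (fst q * snd q - C)\<^sup>2 - 4 * ((fst q)\<^sup>2 + (snd q)\<^sup>2 - A * fst q - B * snd q - D)"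

lemma surf_root:
  assumes "w\<^sup>2 = disc A B C D (x, y)"
  shows "(x, y, (C - x * y + w) / 2) \<in> surf A B C D"
proof -
  define z where "z = (C - x * y + w) / 2"
  have w: "w = 2 * z - C + x * y" by (simp add: z_def field_simps)
  have "4 * (x\<^sup>2 + y\<^sup>2 + z\<^sup>2 + x * y * z) = 4 * (A * x + B * y + C * z + D)"
    using assms unfolding w disc_def fst_conv snd_conv by algebra
  then have "x\<^sup>2 + y\<^sup>2 + z\<^sup>2 + x * y * z = A * x + B * y + C * z + D"
    by (metis mult_cancel_left zero_neq_numeral)
  then show ?thesis by (simp add: surf_def flip: z_def)
qed

lemma proj_surf: "proj ` surf A B C D = UNIV"
proof -
  have "q \<in> proj ` surf A B C D" for q
  proof -
    obtain x y where q: "q = (x, y)" by (cases q)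
    have "(csqrt (disc A B C D (x, y)))\<^sup>2 = disc A B C D (x, y)" by simp
    from surf_root[OF this] show ?thesis unfolding q by (metis image_eqI proj_simp)
  qed
  then show ?thesis by blast
qed

lemma finite_disc_zeros_on_line:
  assumes "disc A B C D (a + b * t0, c + e * t0) \<noteq> 0"
  shows "finite {t. disc A B C D (a + b * t, c + e * t) = 0}"
proof -
  define p where "p = ([:a, b:] * [:c, e:] - [:C:])\<^sup>2
    - [:4:] * ([:a, b:]\<^sup>2 + [:c, e:]\<^sup>2 - [:A:] * [:a, b:] - [:B:] * [:c, e:] - [:D:])"
  have p: "poly p t = disc A B C D (a + b * t, c + e * t)" for t
    by (simp add: p_def disc_def algebra_simps power2_eq_square)
  then have "p \<noteq> 0" using assms by (metis poly_0)
  then show ?thesis using poly_roots_finite[of p] by (simp add: p)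
qed

lemma disc_nonzero_dense:
  assumes "open G" "G \<noteq> {}"
  obtains q where "q \<in> G" "disc A B C D q \<noteq> 0"
proof (rule ccontr)
  assume "\<not> thesis"
  then have zero: "\<And>q. q \<in> G \<Longrightarrow> disc A B C D q = 0" using that by blast
  obtain x0 y0 where q0: "(x0, y0) \<in> G" using assms(2) by auto
  have "open ((\<lambda>y. (x0, y)) -` G)" by (intro open_vimage assms continuous_intros)
  moreover have "y0 \<in> (\<lambda>y. (x0, y)) -` G" using q0 by simp
  ultimately have "infinite ((\<lambda>y. (x0, y)) -` G)"
    using finite_imp_not_open by blast
  then obtain y where y: "y \<in> (\<lambda>y. (x0, y)) -` G" "y \<notin> {2, - 2}"
    by (metis finite.emptyI finite.insertI finite_subset subsetI)
  have y4: "y\<^sup>2 \<noteq> 4"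
  proof
    assume "y\<^sup>2 = 4"
    then have "(y - 2) * (y + 2) = 0" by (simp add: algebra_simps power2_eq_square)
    then have "y = 2 \<or> y = - 2" by (metis eq_neg_iff_add_eq_0 mult_eq_0_iff right_minus_eq)
    then show False using y(2) by blast
  qed
  have "open ((\<lambda>x. (x, y)) -` G)" by (intro open_vimage assms continuous_intros)
  moreover have "x0 \<in> (\<lambda>x. (x, y)) -` G" using y by simp
  ultimately have inf: "infinite ((\<lambda>x. (x, y)) -` G)"
    using finite_imp_not_open by blast
  have "finite {t. disc A B C D (0 + 1 * t, y + 0 * t) = 0}"
  proof (rule ccontr)
    assume nf: "\<not> ?thesis"
    have all0: "disc A B C D (t, y) = 0" for t
      using finite_disc_zeros_on_line[of A B C D 0 1 t y 0] nf by auto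
    \<comment> \<open>The second difference isolates the coefficient of the square of x, which is
      \<open>y\<^sup>2 - 4\<close>; this is why y was chosen different from 2 and -2.\<close>
    have "disc A B C D (1, y) + disc A B C D (- 1, y) - 2 * disc A B C D (0, y) = 2 * (y\<^sup>2 - 4)"
      by (simp add: disc_def algebra_simps power2_eq_square)
    then show False using y4 unfolding all0 by simp
  qed
  moreover have "(\<lambda>x. (x, y)) -` G \<subseteq> {t. disc A B C D (0 + 1 * t, y + 0 * t) = 0}"
    using zero by auto
  ultimately show False using inf finite_subset by blast
qed

lemma continuous_on_disc: "continuous_on S (disc A B C D)"
  unfolding disc_def by (intro continuous_intros)

text \<open>A complex line, not a real segment, joins an inner to an outer point: it meets the
  branch curve in finitely many parameters, and the complex plane minus finitely many points stays
  connected. The point found is a limit of the exterior of \<open>closure G\<close>, not just a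
  frontier point of \<open>G\<close>, because the separation argument needs exterior points
  arbitrarily near.\<close>

lemma frontier_point_off_disc:
  assumes "open G" "G \<noteq> {}" "- closure G \<noteq> {}"
  obtains w where "w \<in> closure G" "w \<in> closure (- closure G)" "disc A B C D w \<noteq> 0"
proof -
  obtain u where u: "u \<in> G" "disc A B C D u \<noteq> 0" using disc_nonzero_dense[OF assms(1,2)] by metis
  have opE: "open (- closure G)" by (rule open_Compl[OF closed_closure])
  obtain v where v: "v \<in> - closure G" "disc A B C D v \<noteq> 0" using disc_nonzero_dense[OF opE assms(3)] by metis
  define \<gamma> where "\<gamma> t = (fst u + (fst v - fst u) * t, snd u + (snd v - snd u) * t)" for t
  define F where "F = {t. disc A B C D (\<gamma> t) = 0}"
  have g01: "\<gamma> 0 = u" "\<gamma> 1 = v" by (simp_all add: \<gamma>_def)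
  have "finite F" unfolding F_def \<gamma>_def
    by (rule finite_disc_zeros_on_line[where ?t0.0 = 0]) (use u(2) in simp)
  then have "connected (- F)"
    by (intro path_connected_imp_connected path_connected_complement_countable) (auto simp: uncountable_infinite countable_finite)
  moreover have "continuous_on (- F) \<gamma>" unfolding \<gamma>_def by (intro continuous_intros)
  ultimately have con: "connected (\<gamma> ` (- F))" by (rule connected_continuous_image[rotated])
  have "u \<in> \<gamma> ` (- F)" "v \<in> \<gamma> ` (- F)"
    using u(2) v(2) g01 by (auto simp: F_def intro!: image_eqI[of u \<gamma> 0] image_eqI[of v \<gamma> 1])
  moreover have "u \<in> closure G" using u(1) closure_subset by blast
  ultimately have "\<gamma> ` (- F) \<inter> frontier (- closure G) \<noteq> {}"
    using v(1) by (intro connected_Int_frontier[OF con]) auto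
  then obtain t where t: "t \<notin> F" "\<gamma> t \<in> frontier (- closure G)" by auto
  then have "\<gamma> t \<in> closure (- closure G)" "\<gamma> t \<notin> - closure G"
    using opE by (auto simp: frontier_def interior_open)
  then show thesis using that[of "\<gamma> t"] t(1) by (simp add: F_def)
qed

lemma frontier_of_openin_surf:
  assumes "openin (top_of_set (surf A B C D)) N"
  shows "top_of_set (surf A B C D) frontier_of N = closure N - N"
proof -
  have N: "N \<subseteq> surf A B C D" using openin_imp_subset[OF assms] .
  then have "surf A B C D \<inter> N = N" "surf A B C D \<inter> closure N = closure N"
    using closure_minimal[OF N closed_surf] by auto
  then show ?thesis
    using assms by (simp add: frontier_of_def interior_of_openin closure_of_subtopology)
qed

text \<open>For a saturated set the complement of the image is the image of the complement, so
  openness follows from \<open>proj\<close> being a closed map on the surface.\<close>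

lemma open_saturated_projection:
  assumes N: "openin (top_of_set (surf A B C D)) N" and sat: "s_z C ` N \<subseteq> N"
  shows "open (proj ` N)"
proof -
  obtain T where T: "open T" "N = surf A B C D \<inter> T" using N unfolding openin_open by blast
  have "- proj ` N = proj ` (surf A B C D \<inter> - T)"
  proof (intro equalityI subsetI)
    fix q assume q: "q \<in> - proj ` N"
    obtain p where "p \<in> surf A B C D" "proj p = q" using proj_surf[of A B C D] by (metis UNIV_I imageE)
    then show "q \<in> proj ` (surf A B C D \<inter> - T)" using q T(2) by blast
  next
    fix q assume "q \<in> proj ` (surf A B C D \<inter> - T)"
    then obtain p where p: "p \<in> surf A B C D" "p \<notin> T" "q = proj p" by blast
    show "q \<in> - proj ` N"
    proof
      assume "q \<in> proj ` N"
      then obtain p' where p': "p' \<in> N" "proj p' = proj p" using p(3) by (metis imageE)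
      then have "p = p' \<or> p = s_z C p'" using same_projection[of p' A B C D p] p(1) T(2) by blast
      then have "p \<in> N" using p'(1) sat by blast
      then show False using p(2) T(2) by blast
    qed
  qed
  moreover have "closed (surf A B C D \<inter> - T)" using closed_surf T(1) by (simp add: closed_Int closed_Compl)
  then have "closed (proj ` (surf A B C D \<inter> - T))" by (rule closed_proj_image) blast
  ultimately show ?thesis by (metis closed_def double_compl)
qed

lemma frontier_not_dim_le_2_surf:
  assumes N: "openin (top_of_set (surf A B C D)) N" and sat: "s_z C ` N \<subseteq> N"
    and ne: "N \<noteq> {}" and v: "v \<in> surf A B C D - closure N"
  shows "\<not> top_of_set (top_of_set (surf A B C D) frontier_of N) dim_le 2"
proof
  define S where "S = surf A B C D"
  assume dim: "top_of_set (top_of_set (surf A B C D) frontier_of N) dim_le 2"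
  have NS: "N \<subseteq> S" using openin_imp_subset[OF N] by (simp add: S_def)
  define G where "G = proj ` N"
  have opG: "open G" unfolding G_def by (rule open_saturated_projection[OF N sat])
  have clS: "closure N \<subseteq> S" using NS closed_surf by (simp add: S_def closure_minimal)
  have satc: "s_z C ` closure N \<subseteq> closure N"
    by (rule image_closure_subset[OF continuous_on_s_z closed_closure]) (use sat closure_subset in blast)
  have "closed (proj ` closure N)" using clS by (intro closed_proj_image) (auto simp: S_def)
  then have clG: "closure G \<subseteq> proj ` closure N"
    unfolding G_def by (intro closure_minimal image_mono closure_subset)
  have "proj v \<notin> proj ` closure N"
  proof
    assume "proj v \<in> proj ` closure N"
    then obtain p where p: "p \<in> closure N" "proj p = proj v" by (metis imageE)
    then have "v = p \<or> v = s_z C p" using same_projection[of p A B C D v] v clS by (auto simp: S_def)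
    then show False using p(1) satc v by blast
  qed
  then have ext_ne: "- closure G \<noteq> {}" using clG by blast
  have "G \<noteq> {}" using ne by (simp add: G_def)
  then obtain w where w: "w \<in> closure G" "w \<in> closure (- closure G)" "disc A B C D w \<noteq> 0"
    using frontier_point_off_disc[OF opG _ ext_ne] by metis
  have "disc A B C D -` (- {0}) = {q. disc A B C D q \<noteq> 0}" by auto
  moreover have "open (disc A B C D -` (- {0}))"
    by (rule open_vimage[OF open_Compl[OF closed_singleton] continuous_on_disc])
  ultimately have "open {q. disc A B C D q \<noteq> 0}" by simp
  then obtain \<rho> where rho: "\<rho> > 0" "ball w \<rho> \<subseteq> {q. disc A B C D q \<noteq> 0}"
    using w(3) unfolding open_contains_ball by blast
  have "\<rho> / 4 > 0" using rho by simp
  \<comment> \<open>With both points within \<rho>/4 of \<open>w\<close>, the ball of radius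
    \<rho>/2 around \<open>v2\<close> reaches \<open>u2\<close> and still lies where the
    discriminant is nonzero.\<close>
  then obtain v2 u2 where uv: "v2 \<in> - closure G" "dist v2 w < \<rho> / 4" "u2 \<in> G" "dist u2 w < \<rho> / 4"
    using w(1,2) unfolding closure_approachable by metis
  have "dist v2 u2 < \<rho> / 2" using uv dist_triangle2[of v2 u2 w] by linarith
  then have nd: "\<not> top_of_set (frontier G \<inter> cball v2 (\<rho> / 2)) dim_le 2"
    using frontier_not_dim_le_2[OF opG _ uv(3)] uv(1) by blast
  have sub: "cball v2 (\<rho> / 2) \<subseteq> ball w \<rho>"
  proof
    fix q assume "q \<in> cball v2 (\<rho> / 2)"
    then have "dist w q < \<rho>" using dist_triangle[of w q v2] uv(2) rho(1) by (simp add: dist_commute)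
    then show "q \<in> ball w \<rho>" by simp
  qed
  obtain g where g: "continuous_on (ball w \<rho>) g" "\<And>q. q \<in> ball w \<rho> \<Longrightarrow> disc A B C D q = (g q)\<^sup>2"
  proof (rule continuous_sqrt_on_contractible[OF continuous_on_disc[of "ball w \<rho>" A B C D]])
    show "contractible (ball w \<rho>)" by (simp add: convex_imp_contractible)
    show "disc A B C D q \<noteq> 0" if "q \<in> ball w \<rho>" for q using rho(2) that by blast
  qed (rule that)
  define \<sigma> where "\<sigma> q = (fst q, snd q, (C - fst q * snd q + g q) / 2)" for q
  have cs: "continuous_on (ball w \<rho>) \<sigma>" unfolding \<sigma>_def by (intro continuous_intros g(1)) auto
  have sS: "\<sigma> q \<in> S" if "q \<in> ball w \<rho>" for q
    unfolding \<sigma>_def S_def using g(2)[OF that] by (intro surf_root) simp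
  have ps: "proj (\<sigma> q) = q" for q by (simp add: \<sigma>_def)
  \<comment> \<open>The section follows one of the two sheets; since \<open>N\<close> is invariant
    under \<open>s_z\<close>, the choice of sheet does not affect membership.\<close>
  have sN: "\<sigma> q \<in> N \<longleftrightarrow> q \<in> G" if q: "q \<in> ball w \<rho>" for q
  proof
    assume "\<sigma> q \<in> N"
    then show "q \<in> G" unfolding G_def by (metis imageI ps)
  next
    assume "q \<in> G"
    then obtain p where p: "p \<in> N" "proj p = proj (\<sigma> q)" unfolding G_def using ps by (metis imageE)
    then have "\<sigma> q = p \<or> \<sigma> q = s_z C p"
      using same_projection[of p A B C D "\<sigma> q"] sS[OF q] NS by (auto simp: S_def)
    then show "\<sigma> q \<in> N" using p(1) sat by blast
  qed
  define Y where "Y = frontier G \<inter> cball v2 (\<rho> / 2)"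
  have Yb: "Y \<subseteq> ball w \<rho>" using sub by (auto simp: Y_def)
  have "\<sigma> ` Y \<subseteq> closure N - N"
  proof (rule image_subsetI)
    fix q assume q: "q \<in> Y"
    then have qb: "q \<in> ball w \<rho>" using Yb by blast
    have qG: "q \<in> closure G" "q \<notin> G" using q opG by (auto simp: Y_def frontier_def interior_open)
    have "q \<in> closure (ball w \<rho> \<inter> G)"
      using open_Int_closure_subset[of "ball w \<rho>" G] qb qG(1) by auto
    then obtain s where s: "\<And>n. s n \<in> ball w \<rho> \<inter> G" "s \<longlonglongrightarrow> q" unfolding closure_sequential by blast
    have "isCont \<sigma> q" using cs qb by (simp add: continuous_on_eq_continuous_at)
    then have "(\<lambda>n. \<sigma> (s n)) \<longlonglongrightarrow> \<sigma> q" using s(2) by (rule isCont_tendsto_compose)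
    moreover have "\<sigma> (s n) \<in> N" for n using s(1)[of n] sN by blast
    ultimately have "\<sigma> q \<in> closure N"
      unfolding closure_sequential by (intro exI[of _ "\<lambda>n. \<sigma> (s n)"]) simp
    then show "\<sigma> q \<in> closure N - N" using sN[OF qb] qG(2) by blast
  qed
  then have "\<sigma> ` Y \<subseteq> top_of_set (surf A B C D) frontier_of N"
    using frontier_of_openin_surf[OF N] by simp
  then have d1: "top_of_set (\<sigma> ` Y) dim_le 2" using dim dimension_le_subtopologies by blast
  have csY: "continuous_on Y \<sigma>" using cs Yb continuous_on_subset by blast
  have "homeomorphic_maps (top_of_set Y) (top_of_set (\<sigma> ` Y)) \<sigma> proj"
    unfolding homeomorphic_maps_def
    by (auto simp: continuous_map_iff_continuous2 csY continuous_on_proj ps)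
  then have "top_of_set Y homeomorphic_space top_of_set (\<sigma> ` Y)"
    unfolding homeomorphic_space_def by blast
  then have "top_of_set Y dim_le 2" using d1 homeomorphic_space_dimension_le by blast
  then show False using nd by (simp add: Y_def)
qed

section \<open>Words in the three reflections\<close>

datatype axis = X_axis | Y_axis | Z_axis

fun reflection :: "complex \<Rightarrow> complex \<Rightarrow> complex \<Rightarrow> axis \<Rightarrow> point \<Rightarrow> point" where
  "reflection A B C X_axis = s_x A"
| "reflection A B C Y_axis = s_y B"
| "reflection A B C Z_axis = s_z C"

text \<open>With \<open>foldr\<close> the head letter acts last, so concatenation of words is
  composition of maps, and reversal is inversion because each letter is an involution.\<close>

abbreviation word_map :: "complex \<Rightarrow> complex \<Rightarrow> complex \<Rightarrow> axis list \<Rightarrow> point \<Rightarrow> point" where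
  "word_map A B C w \<equiv> foldr (reflection A B C) w"

lemma reflection_invol [simp]: "reflection A B C i (reflection A B C i p) = p"
  by (cases i) simp_all

lemma reflection_surf: "p \<in> surf A B C D \<Longrightarrow> reflection A B C i p \<in> surf A B C D"
  by (cases i) (simp_all add: s_x_surf s_y_surf s_z_surf)

lemma continuous_on_reflection: "continuous_on S (reflection A B C i)"
  by (cases i) (simp_all add: continuous_on_s_x continuous_on_s_y continuous_on_s_z)

lemma word_map_surf: "p \<in> surf A B C D \<Longrightarrow> word_map A B C w p \<in> surf A B C D"
  by (induction w) (simp_all add: reflection_surf)

lemma word_map_rev [simp]: "word_map A B C (rev w) (word_map A B C w p) = p"
  by (induction w arbitrary: p) simp_all

lemma word_map_rev' [simp]: "word_map A B C w (word_map A B C (rev w) p) = p"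
  using word_map_rev[of A B C "rev w" p] by simp

lemma word_map_Bij: "restrict (word_map A B C w) (surf A B C D) \<in> Bij (surf A B C D)"
proof -
  have "bij_betw (word_map A B C w) (surf A B C D) (surf A B C D)"
    by (rule bij_betw_byWitness[where f' = "word_map A B C (rev w)"]) (auto simp: word_map_surf)
  then show ?thesis by (simp add: Bij_def cong: bij_betw_cong)
qed

lemma word_map_mult:
  "restrict (word_map A B C u) (surf A B C D) \<otimes>\<^bsub>BijGroup (surf A B C D)\<^esub> restrict (word_map A B C v) (surf A B C D)
    = restrict (word_map A B C (u @ v)) (surf A B C D)"
  using word_map_Bij[of A B C u D] word_map_Bij[of A B C v D]
  by (simp add: BijGroup_def compose_def word_map_surf cong: restrict_cong)

lemma word_map_one: "restrict (word_map A B C []) (surf A B C D) = \<one>\<^bsub>BijGroup (surf A B C D)\<^esub>"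
  by (simp add: BijGroup_def id_def)

lemma word_map_inv:
  "inv\<^bsub>BijGroup (surf A B C D)\<^esub> restrict (word_map A B C w) (surf A B C D)
    = restrict (word_map A B C (rev w)) (surf A B C D)"
proof (rule group.inv_equality[OF group_BijGroup])
  show "restrict (word_map A B C (rev w)) (surf A B C D) \<otimes>\<^bsub>BijGroup (surf A B C D)\<^esub>
      restrict (word_map A B C w) (surf A B C D) = \<one>\<^bsub>BijGroup (surf A B C D)\<^esub>"
    unfolding word_map_mult by (auto simp: BijGroup_def restrict_def)
qed (simp_all add: BijGroup_def word_map_Bij)

lemma generator_words:
  "g_x B C = word_map A B C [Z_axis, Y_axis]"
  "g_y A C = word_map A B C [X_axis, Z_axis]"
  "g_z A B = word_map A B C [Y_axis, X_axis]"
  by (simp_all add: g_x_def g_y_def g_z_def fun_eq_iff)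

lemma \<G>_word:
  assumes "g \<in> \<G> A B C D"
  obtains w where "even (length w)" "g = restrict (word_map A B C w) (surf A B C D)"
proof -
  have gens: "{restrict (g_x B C) (surf A B C D), restrict (g_y A C) (surf A B C D), restrict (g_z A B) (surf A B C D)}
      = (\<lambda>w. restrict (word_map A B C w) (surf A B C D)) ` {[Z_axis, Y_axis], [X_axis, Z_axis], [Y_axis, X_axis]}"
    by (simp only: image_insert image_empty generator_words(1)[where A = A] generator_words(2)[where B = B]
        generator_words(3)[where C = C])
  have "\<exists>w. even (length w) \<and> g = restrict (word_map A B C w) (surf A B C D)"
    using assms unfolding \<G>_def
  proof (induction rule: generate.induct)
    case one
    show ?case by (rule exI[of _ "[]"]) (simp only: word_map_one list.size even_zero)
  next
    case (incl h)
    then obtain w where "w \<in> {[Z_axis, Y_axis], [X_axis, Z_axis], [Y_axis, X_axis]}"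
      "h = restrict (word_map A B C w) (surf A B C D)"
      unfolding gens by (elim imageE)
    then show ?case by (intro exI[of _ w]) auto
  next
    case (inv h)
    then obtain w where "w \<in> {[Z_axis, Y_axis], [X_axis, Z_axis], [Y_axis, X_axis]}"
      "h = restrict (word_map A B C w) (surf A B C D)"
      unfolding gens by (elim imageE)
    then show ?case by (intro exI[of _ "rev w"]) (simp only: word_map_inv, auto)
  next
    case (eng h1 h2)
    then obtain u v where "even (length u)" "h1 = restrict (word_map A B C u) (surf A B C D)"
      "even (length v)" "h2 = restrict (word_map A B C v) (surf A B C D)" by blast
    then show ?case by (intro exI[of _ "u @ v"]) (simp only: word_map_mult length_append even_add simp_thms)
  qed
  then show thesis using that by blast
qed

text \<open>An even word splits into pairs, and each pair of letters is a generator, the inverse of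
  one, or trivial. The group is therefore the even subgroup of the group of all words.\<close>

lemma even_word_in_\<G>:
  assumes "even (length w)"
  shows "restrict (word_map A B C w) (surf A B C D) \<in> \<G> A B C D"
proof -
  have sg: "subgroup (\<G> A B C D) (BijGroup (surf A B C D))" by (rule subgroup_\<G>)
  have gens: "restrict (word_map A B C [Z_axis, Y_axis]) (surf A B C D) \<in> \<G> A B C D"
    "restrict (word_map A B C [X_axis, Z_axis]) (surf A B C D) \<in> \<G> A B C D"
    "restrict (word_map A B C [Y_axis, X_axis]) (surf A B C D) \<in> \<G> A B C D"
    unfolding \<G>_def generator_words[symmetric] by (rule generate.incl; simp)+
  have invs: "restrict (word_map A B C (rev u)) (surf A B C D) \<in> \<G> A B C D"
    if "restrict (word_map A B C u) (surf A B C D) \<in> \<G> A B C D" for u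
    using subgroup.m_inv_closed[OF sg that] by (simp only: word_map_inv)
  have one: "restrict (word_map A B C []) (surf A B C D) \<in> \<G> A B C D"
    unfolding word_map_one by (rule subgroup.one_closed[OF sg])
  have pair: "restrict (word_map A B C [i, j]) (surf A B C D) \<in> \<G> A B C D" for i j
  proof (cases "i = j")
    case True
    then have "word_map A B C [i, j] = word_map A B C []" by auto
    then show ?thesis using one by simp
  next
    case False
    then show ?thesis
      using gens invs[OF gens(1)] invs[OF gens(2)] invs[OF gens(3)]
      by (cases i; cases j; simp only: rev.simps append.simps; blast)
  qed
  show ?thesis
    using assms
  proof (induction w rule: induct_list012)
    case 1
    show ?case by (rule one)
  next
    case (3 i j w)
    then have "even (length w)" by simp
    then have "restrict (word_map A B C w) (surf A B C D) \<in> \<G> A B C D" by (rule 3(1))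
    then have "restrict (word_map A B C ([i, j] @ w)) (surf A B C D) \<in> \<G> A B C D"
      unfolding word_map_mult[symmetric] by (rule subgroup.m_closed[OF sg pair])
    then show ?case by (simp only: append_Cons append_Nil)
  qed simp
qed

lemma reduced_word:
  obtains w' where "distinct_adj w'" "word_map A B C w' = word_map A B C w"
proof -
  have "\<exists>w'. distinct_adj w' \<and> word_map A B C w' = word_map A B C w"
  proof (induction w)
    case Nil
    show ?case by (intro exI[of _ "[]"]) simp
  next
    case (Cons a w)
    then obtain w' where w': "distinct_adj w'" "word_map A B C w' = word_map A B C w" by blast
    show ?case
    proof (cases w')
      case (Cons b t)
      show ?thesis
      proof (cases "a = b")
        case True
        have "word_map A B C (a # w) = word_map A B C (a # w')" using w'(2) by simp
        also have "\<dots> = word_map A B C t" by (auto simp: Cons True)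
        finally show ?thesis using w'(1) Cons by (intro exI[of _ t]) (auto dest: distinct_adj_ConsD)
      next
        case False
        then show ?thesis using w' Cons by (intro exI[of _ "a # w'"]) simp
      qed
    next
      case Nil
      then show ?thesis using w' by (intro exI[of _ "[a]"]) simp
    qed
  qed
  then show thesis using that by blast
qed

section \<open>Invariance of the non-discreteness locus and its frontier\<close>

lemma openin_\<N>: "openin (top_of_set (surf A B C D)) (\<N> A B C D)"
proof -
  have "\<N> A B C D = \<Union> {U. locally_nondiscrete A B C D U}" by (auto simp: \<N>_def)
  also have "openin (top_of_set (surf A B C D)) \<dots>"
    by (rule openin_Union) (simp add: locally_nondiscrete_def)
  finally show ?thesis .
qed

lemma reflection_\<N>_subset: "reflection A B C i ` \<N> A B C D \<subseteq> \<N> A B C D"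
proof (rule image_subsetI)
  fix p assume "p \<in> \<N> A B C D"
  define S where "S = surf A B C D"
  define r where "r = reflection A B C i"
  obtain U f where U: "p \<in> U" "openin (top_of_set S) U"
    and f: "\<And>n. f n \<in> \<G> A B C D - {\<one>\<^bsub>BijGroup S\<^esub>}"
    and lim: "\<And>K. compact K \<Longrightarrow> K \<subseteq> U \<Longrightarrow> uniform_limit K f (\<lambda>p. p) sequentially"
    using \<open>p \<in> \<N> A B C D\<close> unfolding \<N>_def locally_nondiscrete_def S_def by blast
  have US: "U \<subseteq> S" using openin_imp_subset[OF U(2)] .
  have rr: "r (r q) = q" for q by (simp add: r_def)
  have rS: "r q \<in> S" if "q \<in> S" for q using that by (simp add: r_def S_def reflection_surf)
  have cr: "continuous_on T r" for T by (simp add: r_def continuous_on_reflection)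
  have "\<forall>n. \<exists>w. even (length w) \<and> f n = restrict (word_map A B C w) S"
    using f \<G>_word unfolding S_def by (metis DiffD1)
  then obtain w where w: "\<And>n. even (length (w n))" "\<And>n. f n = restrict (word_map A B C (w n)) S"
    by metis
  \<comment> \<open>A single reflection is an odd word, but conjugating by it adds two letters and
    keeps the parity.\<close>
  define h where "h n = restrict (word_map A B C (i # w n @ [i])) S" for n
  have h: "h n q = r (f n (r q))" if "q \<in> S" for n q
    using that rS[OF that] by (simp add: h_def w(2) r_def)
  have hG: "h n \<in> \<G> A B C D - {\<one>\<^bsub>BijGroup S\<^esub>}" for n
  proof -
    have "h n \<in> \<G> A B C D" unfolding h_def S_def by (rule even_word_in_\<G>) (use w(1) in simp)
    moreover have "h n \<noteq> \<one>\<^bsub>BijGroup S\<^esub>"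
    proof
      assume "h n = \<one>\<^bsub>BijGroup S\<^esub>"
      then have hid: "h n q = q" if "q \<in> S" for q using that by (simp add: BijGroup_def)
      have "f n q = q" if "q \<in> S" for q
      proof -
        have "r (f n (r (r q))) = r q" using h[OF rS[OF that], of n] hid[OF rS[OF that]] by simp
        then show ?thesis using rr by metis
      qed
      then have "f n = \<one>\<^bsub>BijGroup S\<^esub>"
        by (auto simp: BijGroup_def w(2) restrict_def fun_eq_iff)
      then show False using f by blast
    qed
    ultimately show ?thesis by blast
  qed
  define U' where "U' = S \<inter> r -` U"
  obtain T where T: "open T" "U = S \<inter> T" using U(2) unfolding openin_open by blast
  have "U' = S \<inter> r -` T" using rS by (auto simp: U'_def T(2))
  moreover have "open (r -` T)" by (rule open_vimage[OF T(1) cr])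
  ultimately have opU': "openin (top_of_set S) U'" by (metis openin_open_Int)
  have "uniform_limit K h (\<lambda>p. p) sequentially" if K: "compact K" "K \<subseteq> U'" for K
    unfolding uniform_limit_iff
  proof (intro allI impI)
    fix e :: real assume e: "e > 0"
    have K1: "compact (r ` K)" using cr K(1) by (rule compact_continuous_image)
    have K1U: "r ` K \<subseteq> U" using K(2) by (auto simp: U'_def)
    obtain M where M: "\<And>q. q \<in> r ` K \<Longrightarrow> norm q \<le> M"
      using compact_imp_bounded[OF K1] unfolding bounded_iff by blast
    have "uniformly_continuous_on (cball 0 (M + 1)) r"
      by (rule compact_uniformly_continuous[OF cr compact_cball])
    then obtain d where d: "d > 0"
      "\<And>a b. a \<in> cball 0 (M + 1) \<Longrightarrow> b \<in> cball 0 (M + 1) \<Longrightarrow> dist b a < d \<Longrightarrow> dist (r b) (r a) < e"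
      using e unfolding uniformly_continuous_on_def by metis
    have "\<forall>\<^sub>F n in sequentially. \<forall>q\<in>r ` K. dist (f n q) q < min d 1"
      using uniform_limitD[OF lim[OF K1 K1U], of "min d 1"] d(1) by simp
    then show "\<forall>\<^sub>F n in sequentially. \<forall>q\<in>K. dist (h n q) q < e"
    proof eventually_elim
      case (elim n)
      show ?case
      proof
        fix q assume q: "q \<in> K"
        then have qS: "q \<in> S" using K(2) by (auto simp: U'_def)
        have close: "dist (f n (r q)) (r q) < min d 1" using elim q by blast
        have "norm (f n (r q)) \<le> norm (r q) + dist (f n (r q)) (r q)"
          using norm_triangle_sub[of "f n (r q)" "r q"] by (simp add: dist_norm)
        then have in2: "f n (r q) \<in> cball 0 (M + 1)" "r q \<in> cball 0 (M + 1)"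
          using close M[of "r q"] q by auto
        have "dist (r (f n (r q))) (r (r q)) < e" using d(2)[OF in2(2,1)] close by simp
        then show "dist (h n q) q < e" by (simp add: h[OF qS] rr)
      qed
    qed
  qed
  then have "locally_nondiscrete A B C D U'"
    unfolding locally_nondiscrete_def using opU' hG unfolding S_def by blast
  moreover have "r p \<in> U'" using U(1) rS[OF subsetD[OF US U(1)]] by (simp add: U'_def rr)
  ultimately show "reflection A B C i p \<in> \<N> A B C D" unfolding \<N>_def r_def by blast
qed

lemma reflection_frontier_\<N>:
  assumes "p \<in> closure (\<N> A B C D) - \<N> A B C D"
  shows "reflection A B C i p \<in> closure (\<N> A B C D) - \<N> A B C D"
proof -
  have "reflection A B C i ` closure (\<N> A B C D) \<subseteq> closure (\<N> A B C D)"
    by (rule image_closure_subset[OF continuous_on_reflection closed_closure])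
      (use reflection_\<N>_subset closure_subset in blast)
  moreover have "reflection A B C i p \<notin> \<N> A B C D"
  proof
    assume "reflection A B C i p \<in> \<N> A B C D"
    then have "reflection A B C i (reflection A B C i p) \<in> \<N> A B C D"
      using reflection_\<N>_subset[of A B C i D] by blast
    then show False using assms by simp
  qed
  ultimately show ?thesis using assms by blast
qed

lemma frontier_\<N>_invariant:
  assumes "g \<in> \<G> A B C D"
  defines "F \<equiv> closure (\<N> A B C D) - \<N> A B C D"
  shows "g ` F = F"
proof -
  have step: "reflection A B C i p \<in> F" if "p \<in> F" for i p
    using that unfolding F_def by (rule reflection_frontier_\<N>)
  have word: "word_map A B C w p \<in> F" if "p \<in> F" for w p
    using that by (induction w) (simp_all add: step)
  have FS: "F \<subseteq> surf A B C D"
    using closure_minimal[OF openin_imp_subset[OF openin_\<N>] closed_surf] unfolding F_def by blast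
  obtain w where w: "g = restrict (word_map A B C w) (surf A B C D)" using \<G>_word[OF assms(1)] by blast
  then have "g ` F = word_map A B C w ` F" using FS by (intro image_cong) auto
  also have "\<dots> = F"
  proof (intro equalityI subsetI)
    fix p assume "p \<in> F"
    then have "word_map A B C (rev w) p \<in> F" by (rule word)
    then show "p \<in> word_map A B C w ` F" by (intro image_eqI[of _ _ "word_map A B C (rev w) p"]) simp_all
  qed (use word in blast)
  finally show ?thesis .
qed

section \<open>Expanding points and ping-pong\<close>

fun coord :: "axis \<Rightarrow> point \<Rightarrow> complex" where
  "coord X_axis (x, y, z) = x"
| "coord Y_axis (x, y, z) = y"
| "coord Z_axis (x, y, z) = z"

lemma all_axis: "(\<forall>j. P j) \<longleftrightarrow> P X_axis \<and> P Y_axis \<and> P Z_axis"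
  by (metis axis.exhaust)

text \<open>Coordinate \<open>i\<close> dominates, which records the last letter applied. The first
  inequality says that the gain from multiplying by a coordinate of size at least \<open>m\<close>
  outweighs a parameter of size \<kappa>.\<close>

definition sector :: "real \<Rightarrow> real \<Rightarrow> axis \<Rightarrow> point set" where
  "sector m \<kappa> i = {p. \<kappa> < norm (coord i p) * (m - 2) \<and>
     (\<forall>j. j \<noteq> i \<longrightarrow> m \<le> norm (coord j p) \<and> norm (coord j p) < norm (coord i p))}"

lemma sector_disjoint: "i \<noteq> j \<Longrightarrow> sector m \<kappa> i \<inter> sector m \<kappa> j = {}"
  by (force simp: sector_def)

lemma coord_reflection_other: "k \<noteq> j \<Longrightarrow> coord k (reflection A B C j p) = coord k p"
  by (cases p; cases k; cases j) (simp_all add: s_x_def s_y_def s_z_def)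

text \<open>The product contributes at least \<open>norm b * m\<close>, while \<open>a\<close> and
  the parameter take away less than \<open>norm b + \<kappa>\<close>. Exceeding
  \<open>norm b\<close> again is the reason for the factor \<open>m - 2\<close>.\<close>

lemma reflected_coordinate_grows:
  fixes a b c P :: complex
  assumes "norm a < norm b" "m \<le> norm c" "norm P \<le> \<kappa>" "\<kappa> < norm b * (m - 2)"
  shows "norm b < norm (- a - b * c + P)"
proof -
  have "norm b * m \<le> norm b * norm c" using assms(2) by (intro mult_left_mono) auto
  also have "\<dots> = norm ((- a - b * c + P) + (a - P))"
    by (simp add: norm_mult[symmetric] norm_minus_commute)
  also have "\<dots> \<le> norm (- a - b * c + P) + norm (a - P)" by (rule norm_triangle_ineq)
  also have "norm (a - P) \<le> norm a + norm P" by (rule norm_triangle_ineq4)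
  finally have "norm b * m \<le> norm (- a - b * c + P) + (norm a + norm P)" by simp
  then show ?thesis using assms by (simp add: algebra_simps)
qed

lemma reflection_sector:
  assumes "m > 2" "norm A \<le> \<kappa>" "norm B \<le> \<kappa>" "norm C \<le> \<kappa>" and p: "p \<in> sector m \<kappa> i" and ij: "j \<noteq> i"
  shows "reflection A B C j p \<in> sector m \<kappa> j"
    and "norm (coord i p) < norm (coord j (reflection A B C j p))"
proof -
  obtain x y z where xyz: "p = (x, y, z)" by (cases p)
  have p': "\<kappa> < norm (coord i p) * (m - 2)"
    "\<And>k. k \<noteq> i \<Longrightarrow> m \<le> norm (coord k p)" "\<And>k. k \<noteq> i \<Longrightarrow> norm (coord k p) < norm (coord i p)"
    using p by (auto simp: sector_def)
  show grow: "norm (coord i p) < norm (coord j (reflection A B C j p))"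
  proof (cases j)
    case X_axis
    then show ?thesis
      using p'(1) p'(2,3)[of X_axis] p'(2,3)[of Y_axis] p'(2,3)[of Z_axis] assms(2) ij
        reflected_coordinate_grows[of x y m z A \<kappa>] reflected_coordinate_grows[of x z m y A \<kappa>]
      by (cases i) (simp_all add: xyz s_x_def mult.commute)
  next
    case Y_axis
    then show ?thesis
      using p'(1) p'(2,3)[of X_axis] p'(2,3)[of Y_axis] p'(2,3)[of Z_axis] assms(3) ij
        reflected_coordinate_grows[of y x m z B \<kappa>] reflected_coordinate_grows[of y z m x B \<kappa>]
      by (cases i) (simp_all add: xyz s_y_def mult.commute)
  next
    case Z_axis
    then show ?thesis
      using p'(1) p'(2,3)[of X_axis] p'(2,3)[of Y_axis] p'(2,3)[of Z_axis] assms(4) ij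
        reflected_coordinate_grows[of z x m y C \<kappa>] reflected_coordinate_grows[of z y m x C \<kappa>]
      by (cases i) (simp_all add: xyz s_z_def mult.commute)
  qed
  have "m \<le> norm (coord k p)" if "k \<noteq> j" for k
  proof (cases "k = i")
    case True
    then show ?thesis using p'(2,3)[OF ij] by simp
  qed (use p'(2) in blast)
  moreover have "norm (coord k p) < norm (coord j (reflection A B C j p))" if "k \<noteq> j" for k
    using p'(3)[of k] grow by (cases "k = i") auto
  moreover have "\<kappa> < norm (coord j (reflection A B C j p)) * (m - 2)"
  proof -
    have "norm (coord i p) * (m - 2) \<le> norm (coord j (reflection A B C j p)) * (m - 2)"
      using grow assms(1) by (intro mult_right_mono) auto
    then show ?thesis using p'(1) by linarith
  qed
  ultimately show "reflection A B C j p \<in> sector m \<kappa> j"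
    by (simp add: sector_def coord_reflection_other)
qed

text \<open>The gap between \<open>c'\<close> and \<open>c\<close> separates the coordinates of
  \<open>p\<close> from all reflected ones. The constants are explicit arguments, so that the same
  ones serve nearby points and parameters: every condition on the point and the parameters is a
  strict inequality.\<close>

definition expanding :: "real \<Rightarrow> real \<Rightarrow> real \<Rightarrow> real \<Rightarrow> complex \<Rightarrow> complex \<Rightarrow> complex \<Rightarrow> point \<Rightarrow> bool" where
  "expanding m \<kappa> c' c A B C p \<longleftrightarrow> 2 < m \<and> c' < c \<and> \<kappa> \<le> c * (m - 2) \<and>
     norm A < \<kappa> \<and> norm B < \<kappa> \<and> norm C < \<kappa> \<and>
     (\<forall>j. m < norm (coord j p) \<and> norm (coord j p) < c' \<and> c < norm (coord j (reflection A B C j p)))"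

lemma expanding_reflection_sector:
  assumes "expanding m \<kappa> c' c A B C p"
  shows "reflection A B C j p \<in> sector m \<kappa> j"
proof -
  have e: "2 < m" "c' < c" "\<kappa> \<le> c * (m - 2)" "\<And>j. m < norm (coord j p)" "\<And>j. norm (coord j p) < c'"
    "\<And>j. c < norm (coord j (reflection A B C j p))"
    using assms by (auto simp: expanding_def)
  have "c * (m - 2) < norm (coord j (reflection A B C j p)) * (m - 2)"
    using e(1,6) by (intro mult_strict_right_mono) auto
  moreover have "norm (coord k p) < norm (coord j (reflection A B C j p))" for k
    using e(2) e(5)[of k] e(6)[of j] by linarith
  ultimately show ?thesis
    using e(3) e(4) by (auto simp: sector_def coord_reflection_other less_imp_le)
qed

lemma reduced_word_expands:
  assumes e: "expanding m \<kappa> c' c A B C p" and "distinct_adj (j # w)"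
  shows "word_map A B C (j # w) p \<in> sector m \<kappa> j \<and> c < norm (coord j (word_map A B C (j # w) p))"
  using assms(2)
proof (induction w arbitrary: j)
  case Nil
  then show ?case using expanding_reflection_sector[OF e, of j] e by (simp add: expanding_def)
next
  case (Cons k w)
  have jk: "j \<noteq> k" "distinct_adj (k # w)" using Cons.prems by auto
  define q where "q = word_map A B C (k # w) p"
  have q: "q \<in> sector m \<kappa> k" "c < norm (coord k q)" using Cons.IH[OF jk(2)] by (simp_all add: q_def)
  have "m > 2" "norm A \<le> \<kappa>" "norm B \<le> \<kappa>" "norm C \<le> \<kappa>" using e by (auto simp: expanding_def)
  note step = reflection_sector[OF this q(1) jk(1)]
  have "word_map A B C (j # k # w) p = reflection A B C j q" by (simp add: q_def)
  then show ?case using step q(2) by simp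
qed

lemma norm_coord_diff_le: "norm (coord j p) \<le> norm (coord j q) + dist p q"
proof -
  have "\<forall>j. norm (coord j p - coord j q) \<le> norm (p - q)"
  proof -
    obtain x y z x' y' z' where "p = (x, y, z)" "q = (x', y', z')" by (cases p, cases q)
    then show ?thesis
      using norm_fst_le[of "x - x'" "(y - y', z - z')"] norm_snd_le[of "(y - y', z - z')" "x - x'"]
        norm_fst_le[of "y - y'" "z - z'"] norm_snd_le[of "z - z'" "y - y'"]
      unfolding all_axis by auto
  qed
  then have "norm (coord j p - coord j q) \<le> dist p q" by (simp add: dist_norm)
  then show ?thesis using norm_triangle_ineq2[of "coord j p" "coord j q"] by linarith
qed

text \<open>Pointwise convergence at \<open>p\<close> alone is already impossible: a nontrivial
  element has a nonempty reduced word, whose first letter names a coordinate that is moved from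
  below \<open>c'\<close> to above \<open>c\<close>.\<close>

lemma expanding_not_in_\<N>:
  assumes e: "expanding m \<kappa> c' c A B C p"
  shows "p \<notin> \<N> A B C D"
proof
  assume "p \<in> \<N> A B C D"
  then obtain U f where U: "p \<in> U" "openin (top_of_set (surf A B C D)) U"
    and f: "\<And>n. f n \<in> \<G> A B C D - {\<one>\<^bsub>BijGroup (surf A B C D)\<^esub>}"
    and lim: "\<And>K. compact K \<Longrightarrow> K \<subseteq> U \<Longrightarrow> uniform_limit K f (\<lambda>p. p) sequentially"
    unfolding \<N>_def locally_nondiscrete_def by blast
  have pS: "p \<in> surf A B C D" using U openin_imp_subset by blast
  have cc: "c - c' > 0" using e by (simp add: expanding_def)
  have "uniform_limit {p} f (\<lambda>p. p) sequentially" using lim[of "{p}"] U(1) by simp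
  then have "\<forall>\<^sub>F n in sequentially. \<forall>q\<in>{p}. dist (f n q) q < c - c'"
    using cc by (rule uniform_limitD)
  then obtain n where n: "dist (f n p) p < c - c'"
    by (auto simp: eventually_sequentially)
  obtain w0 where w0: "f n = restrict (word_map A B C w0) (surf A B C D)"
    using \<G>_word[of "f n" A B C D] f by blast
  obtain w where w: "distinct_adj w" "word_map A B C w = word_map A B C w0" by (rule reduced_word)
  have fn: "f n = restrict (word_map A B C w) (surf A B C D)" using w0 w(2) by simp
  then have "w \<noteq> []" using f[of n] word_map_one[of A B C D] by auto
  then obtain j w' where jw: "w = j # w'" by (cases w) auto
  have "c < norm (coord j (f n p))"
    using reduced_word_expands[OF e] w(1) unfolding fn jw using pS by simp
  moreover have "norm (coord j (f n p)) \<le> norm (coord j p) + dist (f n p) p" by (rule norm_coord_diff_le)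
  moreover have "norm (coord j p) < c'" using e by (simp add: expanding_def)
  ultimately show False using n by linarith
qed

lemma open_expanding:
  "open {((A, B, C), p). expanding m \<kappa> c' c A B C p}"
proof -
  have eq: "{((A, B, C), p). expanding m \<kappa> c' c A B C p} = {w. 2 < m \<and> c' < c \<and> \<kappa> \<le> c * (m - 2) \<and>
      norm (fst (fst w)) < \<kappa> \<and> norm (fst (snd (fst w))) < \<kappa> \<and> norm (snd (snd (fst w))) < \<kappa> \<and>
      m < norm (fst (snd w)) \<and> norm (fst (snd w)) < c' \<and>
      c < norm (- fst (snd w) - fst (snd (snd w)) * snd (snd (snd w)) + fst (fst w)) \<and>
      m < norm (fst (snd (snd w))) \<and> norm (fst (snd (snd w))) < c' \<and>
      c < norm (- fst (snd (snd w)) - fst (snd w) * snd (snd (snd w)) + fst (snd (fst w))) \<and>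
      m < norm (snd (snd (snd w))) \<and> norm (snd (snd (snd w))) < c' \<and>
      c < norm (- snd (snd (snd w)) - fst (snd w) * fst (snd (snd w)) + snd (snd (fst w)))}"
    unfolding expanding_def all_axis by (auto simp: s_x_def s_y_def s_z_def)
  show ?thesis unfolding eq
    by (intro open_Collect_conj open_Collect_const open_Collect_less continuous_intros)
qed

lemma expanding_not_in_closure_\<N>:
  assumes "expanding m \<kappa> c' c A B C p"
  shows "p \<notin> closure (\<N> A B C D)"
proof -
  have "{q. expanding m \<kappa> c' c A B C q} = (\<lambda>q. ((A, B, C), q)) -` {((A, B, C), p). expanding m \<kappa> c' c A B C p}"
    by auto
  also have "open \<dots>" by (intro open_vimage open_expanding continuous_intros)
  finally have "open {q. expanding m \<kappa> c' c A B C q}" .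
  moreover have "{q. expanding m \<kappa> c' c A B C q} \<inter> \<N> A B C D = {}"
    using expanding_not_in_\<N> by blast
  ultimately have "{q. expanding m \<kappa> c' c A B C q} \<inter> closure (\<N> A B C D) = {}"
    by (simp add: open_Int_closure_eq_empty)
  then show ?thesis using assms by blast
qed

lemma diagonal_point_expanding:
  fixes t a :: real
  assumes "0 \<le> a" "2 < t" "a < t * (t - 2)"
  defines "A \<equiv> complex_of_real a" and "p \<equiv> (- complex_of_real t, - complex_of_real t, - complex_of_real t)"
  obtains m \<kappa> c' c where "expanding m \<kappa> c' c A A A p"
proof -
  define T where "T = t\<^sup>2 - t - a"
  have T: "t < T" using assms(3) by (simp add: T_def power2_eq_square algebra_simps)
  \<comment> \<open>\<kappa> is the midpoint of the available interval, \<open>m\<close> is then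
    read off from \<open>\<kappa> = t * (m - 2)\<close>, and \<open>c'\<close>, \<open>c\<close> cut
    the interval from t to T into thirds, where T is the size of each reflected coordinate.\<close>
  define \<kappa> where "\<kappa> = (a + t * (t - 2)) / 2"
  have k: "a < \<kappa>" "\<kappa> < t * (t - 2)" using assms(3) by (auto simp: \<kappa>_def field_simps)
  define m where "m = 2 + \<kappa> / t"
  have m: "2 < m" "m < t" using k assms(1,2) by (auto simp: m_def field_simps)
  define c' where "c' = (2 * t + T) / 3"
  define c where "c = (t + 2 * T) / 3"
  have c: "t < c'" "c' < c" "c < T" using T by (auto simp: c_def c'_def)
  have "\<kappa> = t * (m - 2)" using assms(2) by (simp add: m_def)
  also have "\<dots> \<le> c * (m - 2)" using c m by (intro mult_right_mono) auto
  finally have kc: "\<kappa> \<le> c * (m - 2)" .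
  have "complex_of_real t - complex_of_real t * complex_of_real t + complex_of_real a = - complex_of_real T"
    by (simp add: T_def power2_eq_square)
  then have n: "norm (complex_of_real t - complex_of_real t * complex_of_real t + complex_of_real a) = T"
    using T assms(2) by (metis abs_of_pos norm_minus_cancel norm_of_real order_less_trans zero_less_numeral)
  have "expanding m \<kappa> c' c A A A p"
    unfolding expanding_def all_axis
    using m c kc k n assms(1,2) by (simp add: A_def p_def s_x_def s_y_def s_z_def)
  then show thesis by (rule that)
qed

definition ping_pong :: "'p set \<Rightarrow> ('p \<Rightarrow> 'p) \<Rightarrow> ('p \<Rightarrow> 'p) \<Rightarrow> ('p \<Rightarrow> 'p) \<Rightarrow> ('p \<Rightarrow> 'p) \<Rightarrow>
    'p set \<Rightarrow> 'p set \<Rightarrow> 'p set \<Rightarrow> 'p set \<Rightarrow> bool" where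
  "ping_pong S f f' g g' a b c d \<longleftrightarrow>
     f ` (a \<union> c \<union> d) \<subseteq> a \<and> f' ` (b \<union> c \<union> d) \<subseteq> b \<and> g ` (c \<union> a \<union> b) \<subseteq> c \<and> g' ` (d \<union> a \<union> b) \<subseteq> d \<and>
     a \<inter> b = {} \<and> a \<inter> c = {} \<and> a \<inter> d = {} \<and> b \<inter> c = {} \<and> b \<inter> d = {} \<and> c \<inter> d = {} \<and>
     S \<inter> a \<noteq> {} \<and> S \<inter> b \<noteq> {} \<and> S \<inter> c \<noteq> {} \<and> S \<inter> d \<noteq> {}"

lemma ping_pongD:
  assumes "ping_pong S f f' g g' a b c d"
  shows "f ` (a \<union> c \<union> d) \<subseteq> a" "f' ` (b \<union> c \<union> d) \<subseteq> b" "g ` (c \<union> a \<union> b) \<subseteq> c" "g' ` (d \<union> a \<union> b) \<subseteq> d"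
    "a \<inter> b = {}" "a \<inter> c = {}" "a \<inter> d = {}" "b \<inter> c = {}" "b \<inter> d = {}" "c \<inter> d = {}"
    "S \<inter> a \<noteq> {}" "S \<inter> b \<noteq> {}" "S \<inter> c \<noteq> {}" "S \<inter> d \<noteq> {}"
  using assms unfolding ping_pong_def by (simp_all only: simp_thms)

text \<open>Each commutator sends points into the set of its outermost letter. The four commutators
  begin with \<open>f\<close>, \<open>g\<close>, \<open>f'\<close>, \<open>g'\<close>, so the same
  sets serve again in the order a, c, b, d, and the construction can be iterated. The requirement
  that \<open>S\<close> meets all four sets makes nontriviality visible on the surface
  itself.\<close>

lemma ping_pong_commutators:
  assumes "ping_pong S f f' g g' a b c d"
  shows "ping_pong S (f \<circ> g \<circ> f' \<circ> g') (g \<circ> f \<circ> g' \<circ> f') (f' \<circ> g' \<circ> f \<circ> g) (g' \<circ> f' \<circ> g \<circ> f) a c b d"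
proof -
  have maps: "\<And>p. p \<in> a \<union> c \<union> d \<Longrightarrow> f p \<in> a" "\<And>p. p \<in> b \<union> c \<union> d \<Longrightarrow> f' p \<in> b"
    "\<And>p. p \<in> c \<union> a \<union> b \<Longrightarrow> g p \<in> c" "\<And>p. p \<in> d \<union> a \<union> b \<Longrightarrow> g' p \<in> d"
    using ping_pongD[OF assms] by blast+
  have sets: "a \<inter> b = {}" "a \<inter> c = {}" "a \<inter> d = {}" "b \<inter> c = {}" "b \<inter> d = {}" "c \<inter> d = {}"
    "S \<inter> a \<noteq> {}" "S \<inter> b \<noteq> {}" "S \<inter> c \<noteq> {}" "S \<inter> d \<noteq> {}"
    using ping_pongD[OF assms] by blast+
  have "(f \<circ> g \<circ> f' \<circ> g') ` (a \<union> b \<union> d) \<subseteq> a" "(g \<circ> f \<circ> g' \<circ> f') ` (c \<union> b \<union> d) \<subseteq> c"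
    "(f' \<circ> g' \<circ> f \<circ> g) ` (b \<union> a \<union> c) \<subseteq> b" "(g' \<circ> f' \<circ> g \<circ> f) ` (d \<union> a \<union> c) \<subseteq> d"
    using maps by auto
  then show ?thesis
    unfolding ping_pong_def using sets by (intro conjI) (simp_all add: Int_commute)
qed

lemma ping_pong_nontrivial:
  assumes "ping_pong S f f' g g' a b c d"
  obtains p where "p \<in> S" "f p \<noteq> p"
proof -
  obtain p where "p \<in> S" "p \<in> c" using ping_pongD(13)[OF assms] by blast
  moreover have "f p \<in> a" "a \<inter> c = {}" using ping_pongD(1,6)[OF assms] \<open>p \<in> c\<close> by blast+
  ultimately show thesis using that[of p] by (metis IntI empty_iff)
qed

section \<open>Convergence of iterated commutators\<close>

text \<open>Words are polynomial maps of three variables; composing them with complex lines reduces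
  the needed estimates to holomorphic functions of one variable.\<close>

definition holomorphic_curve :: "(complex \<Rightarrow> point) \<Rightarrow> complex set \<Rightarrow> bool" where
  "holomorphic_curve \<gamma> T \<longleftrightarrow> (\<forall>j. (\<lambda>t. coord j (\<gamma> t)) holomorphic_on T)"

lemma holomorphic_curve_reflection:
  assumes "holomorphic_curve \<gamma> T"
  shows "holomorphic_curve (\<lambda>t. reflection A B C i (\<gamma> t)) T"
proof -
  have h: "(\<lambda>t. coord X_axis (\<gamma> t)) holomorphic_on T" "(\<lambda>t. coord Y_axis (\<gamma> t)) holomorphic_on T"
    "(\<lambda>t. coord Z_axis (\<gamma> t)) holomorphic_on T"
    using assms by (auto simp: holomorphic_curve_def)
  have f: "coord X_axis (s_x A p) = - coord X_axis p - coord Y_axis p * coord Z_axis p + A"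
    "coord Y_axis (s_y B p) = - coord Y_axis p - coord X_axis p * coord Z_axis p + B"
    "coord Z_axis (s_z C p) = - coord Z_axis p - coord X_axis p * coord Y_axis p + C" for p
    by (cases p; simp add: s_x_def s_y_def s_z_def)+
  have o: "coord Y_axis (s_x A p) = coord Y_axis p" "coord Z_axis (s_x A p) = coord Z_axis p"
    "coord X_axis (s_y B p) = coord X_axis p" "coord Z_axis (s_y B p) = coord Z_axis p"
    "coord X_axis (s_z C p) = coord X_axis p" "coord Y_axis (s_z C p) = coord Y_axis p" for p
    by (cases p; simp add: s_x_def s_y_def s_z_def)+
  show ?thesis
    unfolding holomorphic_curve_def all_axis
    by (cases i) (simp_all add: f o h holomorphic_intros)
qed

lemma holomorphic_curve_word_map:
  "holomorphic_curve \<gamma> T \<Longrightarrow> holomorphic_curve (\<lambda>t. word_map A B C w (\<gamma> t)) T"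
  by (induction w) (simp_all add: holomorphic_curve_reflection)

lemma Schwarz_bound:
  assumes "G holomorphic_on ball 0 1" "G 0 = 0" "\<And>t. norm t < 1 \<Longrightarrow> norm (G t) < c" "norm t < 1"
  shows "norm (G t) \<le> c * norm t"
proof -
  have c: "c > 0" using assms(2) assms(3)[of 0] by simp
  have "norm ((\<lambda>t. G t / complex_of_real c) t) \<le> norm t"
  proof (rule Schwarz_Lemma(1)[OF _ _ _ assms(4)])
    show "(\<lambda>t. G t / complex_of_real c) holomorphic_on ball 0 1"
      using c assms(1) by (intro holomorphic_intros) auto
  qed (use assms c in \<open>auto simp: norm_divide divide_less_eq\<close>)
  then show ?thesis using c by (simp add: norm_divide divide_le_eq mult.commute)
qed

definition cscale :: "complex \<Rightarrow> point \<Rightarrow> point" where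
  "cscale s = (\<lambda>(x, y, z). (s * x, s * y, s * z))"

lemma norm_cscale: "norm (cscale s h) = norm s * norm h"
  by (cases h) (simp add: cscale_def norm_Pair norm_mult power_mult_distrib real_sqrt_mult flip: distrib_left)

lemma coord_add [simp]: "coord j (p + q) = coord j p + coord j q"
  by (cases p; cases q; cases j) simp_all

lemma coord_diff [simp]: "coord j (p - q) = coord j p - coord j q"
  by (cases p; cases q; cases j) simp_all

lemma coord_cscale [simp]: "coord j (cscale s p) = s * coord j p"
  by (cases p; cases j) (simp_all add: cscale_def)

lemma norm_coord_le: "norm (coord j p) \<le> norm p"
proof -
  have "coord j 0 = 0" by (cases j) (simp_all add: zero_prod_def)
  then show ?thesis using norm_coord_diff_le[of j p 0] by simp
qed

lemma norm_le_sum_coord: "norm p \<le> norm (coord X_axis p) + norm (coord Y_axis p) + norm (coord Z_axis p)"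
proof -
  obtain x y z where p: "p = (x, y, z)" by (cases p)
  show ?thesis using norm_Pair_le[of x "(y, z)"] norm_Pair_le[of y z] by (simp add: p)
qed

text \<open>A Cauchy-type estimate: on the complex disc of radius \<tau> through \<open>x\<close> in
  direction \<open>h\<close>, each coordinate of the displacement is holomorphic and bounded, so the
  Schwarz lemma controls its variation. The 9 is a factor 3 from the bound and a factor 3 from
  summing the coordinates.\<close>

lemma word_displacement_Lipschitz:
  assumes small: "\<And>q. dist p q \<le> r \<Longrightarrow> norm (word_map A B C w q - q) \<le> \<delta>" and "\<delta> > 0" "\<tau> > 0"
    and x: "dist p x \<le> r - \<tau>" and h: "norm h < \<tau>"
  shows "norm ((word_map A B C w (x + h) - (x + h)) - (word_map A B C w x - x)) \<le> 9 * \<delta> / \<tau> * norm h"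
proof (cases "h = 0")
  case False
  define f where "f q = word_map A B C w q - q" for q
  define \<gamma> where "\<gamma> t = x + cscale (t * of_real (\<tau> / norm h)) h" for t
  have nh: "norm h > 0" using False by simp
  have dist: "dist p (\<gamma> t) \<le> r" if "norm t < 1" for t
  proof -
    have "norm (cscale (t * of_real (\<tau> / norm h)) h) = norm t * \<tau>"
      using nh assms(3) by (simp add: norm_cscale norm_mult norm_divide)
    also have "\<dots> \<le> \<tau>" using that assms(3) by (simp add: mult_le_cancel_right1)
    finally have "dist x (\<gamma> t) \<le> \<tau>" by (simp add: \<gamma>_def dist_norm)
    then show ?thesis using dist_triangle[of p "\<gamma> t" x] x by linarith
  qed
  have "holomorphic_curve \<gamma> (ball 0 1)"
    unfolding holomorphic_curve_def \<gamma>_def by (auto intro!: holomorphic_intros)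
  then have "holomorphic_curve (\<lambda>t. word_map A B C w (\<gamma> t)) (ball 0 1)" "holomorphic_curve \<gamma> (ball 0 1)"
    using holomorphic_curve_word_map by blast+
  then have hol: "(\<lambda>t. coord j (f (\<gamma> t)) - coord j (f x)) holomorphic_on ball 0 1" for j
    unfolding holomorphic_curve_def f_def by (auto intro!: holomorphic_intros)
  have g0: "\<gamma> 0 = x" by (cases h) (simp add: \<gamma>_def cscale_def zero_prod_def[symmetric])
  have dx: "dist p x \<le> r" using x assms(3) by linarith
  define t where "t = complex_of_real (norm h / \<tau>)"
  have t: "norm t = norm h / \<tau>" "norm t < 1" using h assms(3) by (simp_all add: t_def norm_divide)
  have "t * of_real (\<tau> / norm h) = 1" using nh assms(3) by (simp add: t_def)
  then have gt: "\<gamma> t = x + h" unfolding \<gamma>_def by (cases h) (simp add: cscale_def)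
  have "norm (coord j (f (x + h)) - coord j (f x)) \<le> 3 * \<delta> * (norm h / \<tau>)" for j
  proof -
    \<comment> \<open>The triangle inequality gives 2 \<delta>; the bound 3 \<delta> supplies the
      strict inequality that \<open>Schwarz_bound\<close> asks for.\<close>
    have "norm (coord j (f (\<gamma> t)) - coord j (f x)) \<le> (3 * \<delta>) * norm t"
    proof (rule Schwarz_bound[OF hol _ _ t(2)])
      fix s :: complex assume "norm s < 1"
      then have "norm (f (\<gamma> s)) \<le> \<delta>" using small[OF dist] by (simp add: f_def)
      moreover have "norm (f x) \<le> \<delta>" using small[OF dx] by (simp add: f_def)
      ultimately have "norm (coord j (f (\<gamma> s))) \<le> \<delta>" "norm (coord j (f x)) \<le> \<delta>"
        using norm_coord_le order_trans by blast+
      then show "norm (coord j (f (\<gamma> s)) - coord j (f x)) < 3 * \<delta>"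
        using norm_triangle_ineq4[of "coord j (f (\<gamma> s))" "coord j (f x)"] assms(2) by linarith
    qed (simp add: g0)
    then show ?thesis by (simp only: gt t(1))
  qed
  note bound = this
  have "9 * \<delta> / \<tau> * norm h = 3 * (3 * \<delta> * (norm h / \<tau>))" by simp
  then have "norm (f (x + h) - f x) \<le> 9 * \<delta> / \<tau> * norm h"
    using norm_le_sum_coord[of "f (x + h) - f x", unfolded coord_diff]
      bound[of X_axis] bound[of Y_axis] bound[of Z_axis]
    by linarith
  then show ?thesis by (simp add: f_def)
qed simp

text \<open>The ball is taken in the ambient space, not in the surface, because the discs behind the
  Lipschitz estimate leave the surface.\<close>

definition displaces :: "complex \<Rightarrow> complex \<Rightarrow> complex \<Rightarrow> point \<Rightarrow> real \<Rightarrow> real \<Rightarrow> axis list \<Rightarrow> bool" where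
  "displaces A B C p r \<delta> w \<longleftrightarrow> (\<forall>q. dist p q \<le> r \<longrightarrow> norm (word_map A B C w q - q) \<le> \<delta>)"

text \<open>After pulling \<open>q\<close> back to \<open>x\<close>, the commutator moves
  \<open>q\<close> by the difference of \<open>?f (?g x)\<close> and \<open>?g (?f x)\<close>. This
  equals the variation of the displacement of \<open>?f\<close> over a step \<open>b\<close> minus
  that of \<open>?g\<close> over a step \<open>a\<close>, each at most 9 \<delta> / \<tau> times
  \<delta>. The lost radius 2 \<tau> pays for two pullbacks of size \<delta> and one disc of radius
  \<tau>.\<close>

lemma commutator_displacement:
  assumes d: "displaces A B C p r \<delta> u" "displaces A B C p r \<delta> v" "displaces A B C p r \<delta> (rev u)" "displaces A B C p r \<delta> (rev v)"
    and "\<delta> > 0" "2 * \<delta> \<le> \<tau>"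
  shows "displaces A B C p (r - 2 * \<tau>) (18 * \<delta>\<^sup>2 / \<tau>) (u @ v @ rev u @ rev v)"
  unfolding displaces_def
proof (intro allI impI)
  fix q assume q: "dist p q \<le> r - 2 * \<tau>"
  let ?f = "word_map A B C u" and ?g = "word_map A B C v"
  have tau: "\<tau> > 0" using assms(5,6) by linarith
  have small: "\<And>q. dist p q \<le> r \<Longrightarrow> norm (?f q - q) \<le> \<delta>" "\<And>q. dist p q \<le> r \<Longrightarrow> norm (?g q - q) \<le> \<delta>"
    "\<And>q. dist p q \<le> r \<Longrightarrow> norm (word_map A B C (rev u) q - q) \<le> \<delta>"
    "\<And>q. dist p q \<le> r \<Longrightarrow> norm (word_map A B C (rev v) q - q) \<le> \<delta>"
    using d unfolding displaces_def by blast+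
  define y where "y = word_map A B C (rev v) q"
  define x where "x = word_map A B C (rev u) y"
  have "dist q y \<le> \<delta>" using small(4)[of q] q tau by (simp add: y_def dist_norm norm_minus_commute)
  then have py: "dist p y \<le> r - 2 * \<tau> + \<delta>" using dist_triangle[of p y q] q by linarith
  then have "dist y x \<le> \<delta>" using small(3)[of y] assms(5,6) by (simp add: x_def dist_norm norm_minus_commute)
  then have px: "dist p x \<le> r - \<tau>" using dist_triangle[of p x y] py assms(6) by linarith
  have gfx: "?g (?f x) = q" by (simp add: x_def y_def)
  define a where "a = ?f x - x"
  define b where "b = ?g x - x"
  have ab: "norm a \<le> \<delta>" "norm b \<le> \<delta>" using small(1,2)[of x] px tau by (simp_all add: a_def b_def)
  have lt: "norm a < \<tau>" "norm b < \<tau>" using ab assms(5,6) by linarith+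
  have 1: "norm ((?f (x + b) - (x + b)) - (?f x - x)) \<le> 9 * \<delta> / \<tau> * norm b"
    by (rule word_displacement_Lipschitz[OF small(1) assms(5) tau px lt(2)])
  have 2: "norm ((?g (x + a) - (x + a)) - (?g x - x)) \<le> 9 * \<delta> / \<tau> * norm a"
    by (rule word_displacement_Lipschitz[OF small(2) assms(5) tau px lt(1)])
  have "9 * \<delta> / \<tau> * norm b \<le> 9 * \<delta> / \<tau> * \<delta>" "9 * \<delta> / \<tau> * norm a \<le> 9 * \<delta> / \<tau> * \<delta>"
    using ab assms(5) tau by (intro mult_left_mono; simp)+
  then have 3: "norm ((?f (x + b) - (x + b)) - (?f x - x)) + norm ((?g (x + a) - (x + a)) - (?g x - x)) \<le> 18 * \<delta>\<^sup>2 / \<tau>"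
    using 1 2 by (simp add: power2_eq_square)
  have eq: "?f (?g x) - ?g (?f x) = ((?f (x + b) - (x + b)) - (?f x - x)) - ((?g (x + a) - (x + a)) - (?g x - x))"
    by (simp add: a_def b_def)
  have "norm (?f (?g x) - ?g (?f x)) \<le> 18 * \<delta>\<^sup>2 / \<tau>"
    unfolding eq by (rule order_trans[OF norm_triangle_ineq4 3])
  then show "norm (word_map A B C (u @ v @ rev u @ rev v) q - q) \<le> 18 * \<delta>\<^sup>2 / \<tau>"
    by (simp add: gfx) (simp add: x_def y_def)
qed

text \<open>Taking \<open>[u\<^sup>-\<^sup>1, v\<^sup>-\<^sup>1]\<close> as the second commutator permutes the four ping-pong sets, whereas
  fixing \<open>v\<close> would only give linear convergence on shrinking balls.\<close>

fun commutators :: "axis list \<Rightarrow> axis list \<Rightarrow> nat \<Rightarrow> axis list \<times> axis list" where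
  "commutators u v 0 = (u, v)"
| "commutators u v (Suc n) = (case commutators u v n of (u', v') \<Rightarrow>
     (u' @ v' @ rev u' @ rev v', rev u' @ rev v' @ u' @ v'))"

text \<open>The radii decrease to r/2, with \<tau> = r/8 times 2 to the power -n, so that 2 \<tau>
  is exactly the radius lost in a step. The number 600 is large enough for 18 * 8 / 600 to be at
  most 1/4, which closes the induction. Inverse words are carried along because the next commutators
  contain them.\<close>

lemma commutators_displace:
  assumes "displaces A B C p r (r / 600) u" "displaces A B C p r (r / 600) v"
    "displaces A B C p r (r / 600) (rev u)" "displaces A B C p r (r / 600) (rev v)" and r: "r > 0"
    and "commutators u v n = (u', v')"
  shows "\<forall>w\<in>{u', v', rev u', rev v'}. displaces A B C p (r / 2 + r / 2 * (1/2)^n) (r / 600 * (1/4)^n) w"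
  using assms(6)
proof (induction n arbitrary: u' v')
  case 0
  then show ?case using assms by auto
next
  case (Suc n)
  obtain a b where ab: "commutators u v n = (a, b)" by (cases "commutators u v n")
  then have uv: "u' = a @ b @ rev a @ rev b" "v' = rev a @ rev b @ a @ b" using Suc.prems by auto
  define R where "R = r / 2 + r / 2 * (1/2)^n"
  define \<delta> where "\<delta> = r / 600 * (1/4)^n"
  define \<tau> where "\<tau> = r / 8 * (1/2)^n"
  have IH: "displaces A B C p R \<delta> a" "displaces A B C p R \<delta> b" "displaces A B C p R \<delta> (rev a)" "displaces A B C p R \<delta> (rev b)"
    using Suc.IH[OF ab] by (simp_all add: R_def \<delta>_def)
  have d: "\<delta> > 0" using r by (simp add: \<delta>_def)
  have pw: "(1/4::real)^n = (1/2)^n * (1/2)^n" by (simp add: power_mult_distrib[symmetric])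
  have le1: "(1/2::real)^n \<le> 1" "(1/2::real)^n > 0" by (simp_all add: power_le_one)
  have "2 * \<delta> = (r / 300) * (1/2)^n * (1/2)^n" by (simp add: \<delta>_def pw)
  also have "\<dots> \<le> (r / 300) * (1/2)^n * 1" using le1 r by (intro mult_left_mono) auto
  also have "\<dots> \<le> \<tau>" using le1 r by (simp add: \<tau>_def)
  finally have dt: "2 * \<delta> \<le> \<tau>" .
  have RR: "R - 2 * \<tau> = r / 2 + r / 2 * (1/2)^Suc n" by (simp add: R_def \<tau>_def field_simps)
  have "18 * \<delta>\<^sup>2 / \<tau> = (18 * 8 / 360000) * r * (1/2)^n * ((1/2)^n * (1/2)^n)"
  proof -
    have "18 * (r / 600 * (q * q))\<^sup>2 / (r / 8 * q) = (18 * 8 / 360000) * r * q * (q * q)" if "q > 0" for q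
      using r that by (simp add: power2_eq_square field_simps)
    then show ?thesis using le1(2) by (simp only: \<delta>_def \<tau>_def pw)
  qed
  also have "\<dots> \<le> (18 * 8 / 360000) * r * 1 * ((1/2)^n * (1/2)^n)"
    using r le1 by (intro mult_right_mono mult_left_mono) auto
  also have "\<dots> \<le> r / 600 * (1/4)^Suc n"
  proof -
    have "(18 * 8 / 360000) * r * 1 * s \<le> r / 600 * (s * (1/4))" if "s > 0" for s
      using r that by (simp add: field_simps)
    then show ?thesis using le1(2) by (simp only: power_Suc2 pw mult_pos_pos)
  qed
  finally have dd: "18 * \<delta>\<^sup>2 / \<tau> \<le> r / 600 * (1/4)^Suc n" .
  have weaken: "displaces A B C p (r / 2 + r / 2 * (1/2)^Suc n) (r / 600 * (1/4)^Suc n) w"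
    if "displaces A B C p (R - 2 * \<tau>) (18 * \<delta>\<^sup>2 / \<tau>) w" for w
    using that dd unfolding displaces_def RR by (meson order_trans)
  have "displaces A B C p (R - 2 * \<tau>) (18 * \<delta>\<^sup>2 / \<tau>) (a @ b @ rev a @ rev b)"
    "displaces A B C p (R - 2 * \<tau>) (18 * \<delta>\<^sup>2 / \<tau>) (b @ a @ rev b @ rev a)"
    by (rule commutator_displacement; use IH d dt in simp)+
  moreover have "displaces A B C p (R - 2 * \<tau>) (18 * \<delta>\<^sup>2 / \<tau>) (rev a @ rev b @ rev (rev a) @ rev (rev b))"
    "displaces A B C p (R - 2 * \<tau>) (18 * \<delta>\<^sup>2 / \<tau>) (rev b @ rev a @ rev (rev b) @ rev (rev a))"
    by (rule commutator_displacement; use IH d dt in simp)+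
  ultimately show ?case using weaken by (simp add: uv)
qed

lemma word_map_append: "word_map A B C (u @ v) = word_map A B C u \<circ> word_map A B C v"
  by (simp add: fun_eq_iff)

lemma commutators_ping_pong:
  assumes "ping_pong S (word_map A B C u) (word_map A B C (rev u)) (word_map A B C v) (word_map A B C (rev v)) a b c d"
    and "commutators u v n = (u', v')"
  shows "\<exists>a b c d. ping_pong S (word_map A B C u') (word_map A B C (rev u')) (word_map A B C v') (word_map A B C (rev v')) a b c d"
  using assms(2)
proof (induction n arbitrary: u' v')
  case 0
  then show ?case using assms(1) by auto
next
  case (Suc n)
  obtain u1 v1 where uv1: "commutators u v n = (u1, v1)" by (cases "commutators u v n")
  then have uv: "u' = u1 @ v1 @ rev u1 @ rev v1" "v' = rev u1 @ rev v1 @ u1 @ v1" using Suc.prems by auto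
  obtain a b c d where pp: "ping_pong S (word_map A B C u1) (word_map A B C (rev u1)) (word_map A B C v1) (word_map A B C (rev v1)) a b c d"
    using Suc.IH[OF uv1] by blast
  have "ping_pong S (word_map A B C u') (word_map A B C (rev u')) (word_map A B C v') (word_map A B C (rev v')) a c b d"
    using ping_pong_commutators[OF pp] by (simp only: uv rev_append rev_rev_ident word_map_append comp_assoc append_assoc)
  then show ?case by blast
qed

lemma even_commutators:
  "commutators u v n = (u', v') \<Longrightarrow> even (length u) \<Longrightarrow> even (length v) \<Longrightarrow> even (length u') \<and> even (length v')"
  by (induction n arbitrary: u' v') (auto split: prod.splits)

lemma locally_nondiscrete_if_ping_pong:
  assumes d: "displaces A B C p r (r / 600) u" "displaces A B C p r (r / 600) v"
    "displaces A B C p r (r / 600) (rev u)" "displaces A B C p r (r / 600) (rev v)" and r: "r > 0"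
    and pp: "ping_pong (surf A B C D) (word_map A B C u) (word_map A B C (rev u)) (word_map A B C v) (word_map A B C (rev v)) a b c d"
    and ev: "even (length u)" "even (length v)"
  shows "locally_nondiscrete A B C D (surf A B C D \<inter> ball p (r / 2))"
proof -
  define w where "w n = fst (commutators u v n)" for n
  define f where "f n = restrict (word_map A B C (w n)) (surf A B C D)" for n
  have "f n \<in> \<G> A B C D - {\<one>\<^bsub>BijGroup (surf A B C D)\<^esub>}" for n
  proof -
    obtain u' v' where uv: "commutators u v n = (u', v')" by (cases "commutators u v n")
    have "even (length (w n))" using even_commutators[OF uv ev] by (simp add: w_def uv)
    then have "f n \<in> \<G> A B C D" unfolding f_def by (rule even_word_in_\<G>)
    moreover obtain a b c d where "ping_pong (surf A B C D) (word_map A B C u') (word_map A B C (rev u'))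
        (word_map A B C v') (word_map A B C (rev v')) a b c d"
      using commutators_ping_pong[OF pp uv] by blast
    then obtain q where "q \<in> surf A B C D" "word_map A B C u' q \<noteq> q" by (rule ping_pong_nontrivial)
    then have "f n q \<noteq> q" "q \<in> surf A B C D" by (simp_all add: f_def w_def uv)
    then have "f n \<noteq> \<one>\<^bsub>BijGroup (surf A B C D)\<^esub>" by (auto simp: BijGroup_def)
    ultimately show ?thesis by blast
  qed
  moreover have "uniform_limit K f (\<lambda>p. p) sequentially" if K: "K \<subseteq> surf A B C D \<inter> ball p (r / 2)" for K
    unfolding uniform_limit_iff
  proof (intro allI impI)
    fix e :: real assume e: "e > 0"
    have "(\<lambda>n. r / 600 * (1/4)^n) \<longlonglongrightarrow> r / 600 * 0" by (intro tendsto_intros LIMSEQ_realpow_zero) auto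
    then have "\<forall>\<^sub>F n in sequentially. r / 600 * (1/4)^n < e" using e order_tendstoD(2) by fastforce
    then show "\<forall>\<^sub>F n in sequentially. \<forall>x\<in>K. dist (f n x) x < e"
    proof eventually_elim
      case (elim n)
      show ?case
      proof
        fix x assume x: "x \<in> K"
        obtain u' v' where uv: "commutators u v n = (u', v')" by (cases "commutators u v n")
        have "displaces A B C p (r / 2 + r / 2 * (1/2)^n) (r / 600 * (1/4)^n) u'"
          using commutators_displace[OF d r uv] by blast
        moreover have "dist p x \<le> r / 2 + r / 2 * (1/2)^n"
        proof -
          have "dist p x < r / 2" using x K by auto
          moreover have "r / 2 * (1/2)^n \<ge> 0" using r by simp
          ultimately show ?thesis by linarith
        qed
        ultimately have "norm (word_map A B C u' x - x) \<le> r / 600 * (1/4)^n" unfolding displaces_def by blast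
        moreover have "f n x = word_map A B C u' x" using x K by (auto simp: f_def w_def uv)
        ultimately show "dist (f n x) x < e" using elim by (simp add: dist_norm)
      qed
    qed
  qed
  moreover have "openin (top_of_set (surf A B C D)) (surf A B C D \<inter> ball p (r / 2))" by (intro openin_open_Int open_ball)
  ultimately show ?thesis unfolding locally_nondiscrete_def by blast
qed

lemma rev_concat_replicate_pair:
  "rev (concat (replicate n [i, j])) = concat (replicate n [j, i])"
proof (induction n)
  case (Suc n)
  have "rev (concat (replicate (Suc n) [i, j])) = rev (concat (replicate n [i, j])) @ [j, i]" by simp
  also have "\<dots> = concat (replicate n [j, i] @ [[j, i]])" by (simp add: Suc)
  also have "replicate n [j, i] @ [[j, i]] = replicate (Suc n) [j, i]" by (simp add: replicate_append_same)
  finally show ?case .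
qed simp

lemma alternating_word_sector:
  assumes "m > 2" "norm A \<le> \<kappa>" "norm B \<le> \<kappa>" "norm C \<le> \<kappa>" "i \<noteq> j" "k \<noteq> j" "p \<in> sector m \<kappa> k"
  shows "word_map A B C (concat (replicate (Suc n) [i, j])) p \<in> sector m \<kappa> i"
proof (induction n)
  case 0
  have "reflection A B C j p \<in> sector m \<kappa> j" using reflection_sector(1)[OF assms(1-4,7)] assms(6) by simp
  from reflection_sector(1)[OF assms(1-4) this] show ?case using assms(5) by simp
next
  case (Suc n)
  define q where "q = word_map A B C (concat (replicate (Suc n) [i, j])) p"
  have "reflection A B C j q \<in> sector m \<kappa> j"
    using reflection_sector(1)[OF assms(1-4) Suc.IH] assms(5) by (simp add: q_def)
  from reflection_sector(1)[OF assms(1-4) this] have "reflection A B C i (reflection A B C j q) \<in> sector m \<kappa> i"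
    using assms(5) by simp
  then show ?case by (simp add: q_def)
qed

text \<open>The powers of \<open>g_z\<close> in either direction accept the whole Z-sector. Inside
  it, the images under \<open>s_z\<close> of the other two sectors are disjoint and serve the
  conjugated word; this yields four sets from three sectors. The reflections of the expanding point
  provide surface points in all of them.\<close>

lemma ping_pong_words:
  fixes n :: nat
  assumes e: "expanding m \<kappa> c' c A B C p" and p: "p \<in> surf A B C D"
  defines "u \<equiv> concat (replicate (Suc n) [Y_axis, X_axis])"
  defines "v \<equiv> Z_axis # rev u @ [Z_axis]"
  shows "ping_pong (surf A B C D) (word_map A B C u) (word_map A B C (rev u)) (word_map A B C v) (word_map A B C (rev v))
    (sector m \<kappa> Y_axis) (sector m \<kappa> X_axis) (s_z C ` sector m \<kappa> X_axis) (s_z C ` sector m \<kappa> Y_axis)"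
proof -
  have h: "m > 2" "norm A \<le> \<kappa>" "norm B \<le> \<kappa>" "norm C \<le> \<kappa>" using e by (auto simp: expanding_def)
  let ?X = "sector m \<kappa> X_axis" and ?Y = "sector m \<kappa> Y_axis" and ?Z = "sector m \<kappa> Z_axis"
  let ?f = "word_map A B C u" and ?f' = "word_map A B C (rev u)"
  have ru: "rev u = concat (replicate (Suc n) [X_axis, Y_axis])" unfolding u_def by (rule rev_concat_replicate_pair)
  have f: "?f q \<in> ?Y" if "q \<in> ?Y \<union> ?Z" for q
    using that alternating_word_sector[OF h, of Y_axis X_axis Y_axis q n]
      alternating_word_sector[OF h, of Y_axis X_axis Z_axis q n] unfolding u_def by blast
  have f': "?f' q \<in> ?X" if "q \<in> ?X \<union> ?Z" for q
    using that alternating_word_sector[OF h, of X_axis Y_axis X_axis q n]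
      alternating_word_sector[OF h, of X_axis Y_axis Z_axis q n] unfolding ru by blast
  have z: "s_z C q \<in> ?Z" if "q \<in> ?X \<union> ?Y" for q
    using that reflection_sector(1)[OF h, of q X_axis Z_axis] reflection_sector(1)[OF h, of q Y_axis Z_axis] by auto
  have g: "word_map A B C v q = s_z C (?f' (s_z C q))" "word_map A B C (rev v) q = s_z C (?f (s_z C q))" for q
    by (simp_all add: v_def)
  have dj: "?X \<inter> ?Y = {}" "?X \<inter> ?Z = {}" "?Y \<inter> ?Z = {}" by (simp_all add: sector_disjoint)
  have zz: "s_z C ` ?X \<subseteq> ?Z" "s_z C ` ?Y \<subseteq> ?Z" using z by auto
  have zd: "s_z C ` ?X \<inter> s_z C ` ?Y = {}"
  proof (rule ccontr)
    assume "\<not> ?thesis"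
    then obtain q q' where "q \<in> ?X" "q' \<in> ?Y" "s_z C q = s_z C q'" by blast
    then show False using dj(1) s_z_invol[of C q] s_z_invol[of C q'] by (metis IntI empty_iff)
  qed
  have pX: "reflection A B C X_axis p \<in> surf A B C D \<inter> ?X" "reflection A B C Y_axis p \<in> surf A B C D \<inter> ?Y"
    using expanding_reflection_sector[OF e] reflection_surf[OF p] by blast+
  then have pZ: "s_z C (reflection A B C X_axis p) \<in> surf A B C D \<inter> s_z C ` ?X"
    "s_z C (reflection A B C Y_axis p) \<in> surf A B C D \<inter> s_z C ` ?Y"
    using s_z_surf by blast+
  have "?f ` (?Y \<union> s_z C ` ?X \<union> s_z C ` ?Y) \<subseteq> ?Y" using f zz by blast
  moreover have "?f' ` (?X \<union> s_z C ` ?X \<union> s_z C ` ?Y) \<subseteq> ?X" using f' zz by blast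
  moreover have "word_map A B C v ` (s_z C ` ?X \<union> ?Y \<union> ?X) \<subseteq> s_z C ` ?X"
  proof (rule image_subsetI)
    fix q assume "q \<in> s_z C ` ?X \<union> ?Y \<union> ?X"
    then consider "s_z C q \<in> ?X" | "q \<in> ?X \<union> ?Y" by (elim UnE imageE) simp_all
    then have "s_z C q \<in> ?X \<union> ?Z" by cases (use z in blast)+
    then show "word_map A B C v q \<in> s_z C ` ?X" unfolding g by (intro imageI f')
  qed
  moreover have "word_map A B C (rev v) ` (s_z C ` ?Y \<union> ?Y \<union> ?X) \<subseteq> s_z C ` ?Y"
  proof (rule image_subsetI)
    fix q assume "q \<in> s_z C ` ?Y \<union> ?Y \<union> ?X"
    then consider "s_z C q \<in> ?Y" | "q \<in> ?X \<union> ?Y" by (elim UnE imageE) simp_all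
    then have "s_z C q \<in> ?Y \<union> ?Z" by cases (use z in blast)+
    then show "word_map A B C (rev v) q \<in> s_z C ` ?Y" unfolding g by (intro imageI f)
  qed
  moreover have "?Y \<inter> ?X = {}" "?Y \<inter> s_z C ` ?X = {}" "?Y \<inter> s_z C ` ?Y = {}" "?X \<inter> s_z C ` ?X = {}" "?X \<inter> s_z C ` ?Y = {}"
    using dj zz by blast+
  ultimately show ?thesis unfolding ping_pong_def using zd pX pZ by (intro conjI) blast+
qed

text \<open>Invariance of \<open>Q\<close> bounds all powers of \<open>M\<close> in operator norm,
  so two of them are close by compactness, and their quotient is close to the identity. No
  eigenvalues occur, and rational and irrational rotations are treated alike.\<close>

lemma power_near_identity:
  fixes M M' :: "'a::euclidean_space \<Rightarrow> 'a" and Q :: "'a \<Rightarrow> real"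
  assumes lin: "linear M" "linear M'" and inv: "\<And>h. M (M' h) = h" "\<And>h. M' (M h) = h"
    and Q: "continuous_on UNIV Q" "\<And>s h. Q (s *\<^sub>R h) = s\<^sup>2 * Q h" "\<And>h. h \<noteq> 0 \<Longrightarrow> Q h > 0" "\<And>h. Q (M h) = Q h"
    and "\<epsilon> > 0"
  obtains n where "\<And>h. norm ((M ^^ Suc n) h - h) \<le> \<epsilon> * norm h" "\<And>h. norm ((M' ^^ Suc n) h - h) \<le> \<epsilon> * norm h"
proof -
  have "sphere (0::'a) 1 \<noteq> {}" by simp
  moreover have "compact (sphere (0::'a) 1)" by simp
  moreover have Qs: "continuous_on (sphere (0::'a) 1) Q" using Q(1) continuous_on_subset by blast
  ultimately obtain a b where ab: "a \<in> sphere 0 1" "\<And>h. h \<in> sphere 0 1 \<Longrightarrow> Q a \<le> Q h"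
    "b \<in> sphere 0 1" "\<And>h. h \<in> sphere 0 1 \<Longrightarrow> Q h \<le> Q b"
    using continuous_attains_inf[of "sphere 0 1" Q] continuous_attains_sup[of "sphere 0 1" Q] by metis
  have pos: "Q a > 0" "Q b > 0" using ab(1,3) by (auto intro!: Q(3))
  have Qn: "Q a * (norm h)\<^sup>2 \<le> Q h \<and> Q h \<le> Q b * (norm h)\<^sup>2" for h
  proof (cases "h = 0")
    case True
    have "Q (0 *\<^sub>R a) = 0" using Q(2)[of 0 a] by simp
    then show ?thesis using True by simp
  next
    case False
    have "(1 / norm h) *\<^sub>R h \<in> sphere 0 1" using False by simp
    then have "Q a \<le> (1 / norm h)\<^sup>2 * Q h" "(1 / norm h)\<^sup>2 * Q h \<le> Q b"
      using ab(2,4) Q(2)[of "1 / norm h" h] by fastforce+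
    then show ?thesis using False by (simp add: field_simps power_divide)
  qed
  define K where "K = sqrt (Q b / Q a)"
  have Kb: "norm k \<le> K * norm h" if "Q k = Q h" for k h
  proof -
    have "Q a * (norm k)\<^sup>2 \<le> Q b * (norm h)\<^sup>2" using Qn[of k] Qn[of h] that by linarith
    then have "(norm k)\<^sup>2 \<le> Q b / Q a * (norm h)\<^sup>2" using pos by (simp add: field_simps)
    also have "\<dots> = (K * norm h)\<^sup>2" using pos by (simp add: K_def power_mult_distrib)
    finally show ?thesis using pos by (simp add: K_def power2_le_iff_abs_le)
  qed
  have QM: "Q ((M ^^ n) h) = Q h" for n h by (induction n) (simp_all add: Q(4))
  have "Q (M' h) = Q h" for h using Q(4)[of "M' h"] inv(1) by simp
  then have QM': "Q ((M' ^^ n) h) = Q h" for n h by (induction n) simp_all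
  have inv_pow: "(M' ^^ n) ((M ^^ n) h) = h" for n h
  proof (induction n arbitrary: h)
    case (Suc n)
    show ?case by (subst funpow_Suc_right) (simp add: inv Suc)
  qed simp
  have K1: "K > 0" using pos by (simp add: K_def)
  have blin: "bounded_linear (M ^^ n)" for n
  proof -
    have "linear (M ^^ n)"
    proof (induction n)
      case (Suc n)
      from linear_compose[OF this lin(1)] show ?case by (simp only: funpow.simps)
    qed (simp only: funpow.simps linear_id)
    then show ?thesis by (simp add: linear_conv_bounded_linear)
  qed
  define F where "F n = Blinfun (M ^^ n)" for n
  have Fa: "blinfun_apply (F n) = M ^^ n" for n unfolding F_def by (rule bounded_linear_Blinfun_apply[OF blin])
  have "norm (F n) \<le> K" for n
    by (rule norm_blinfun_bound) (use K1 Kb[OF QM] in \<open>auto simp: Fa\<close>)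
  then have "bounded (range F)" by (auto simp: bounded_iff)
  then obtain l s where s: "strict_mono (s :: nat \<Rightarrow> nat)" "(F \<circ> s) \<longlonglongrightarrow> l"
    using bounded_imp_convergent_subsequence by blast
  then have "Cauchy (F \<circ> s)" by (simp add: LIMSEQ_imp_Cauchy)
  \<comment> \<open>Cancelling \<open>M ^^ i\<close> costs a factor K, and passing to the inverse
    costs another; this \<eta> makes \<open>K * \<eta>\<close> and \<open>K * (K * \<eta>)\<close>
    sum to \<epsilon>.\<close>
  define \<eta> where "\<eta> = \<epsilon> / (K * (1 + K))"
  have eta: "\<eta> > 0" using K1 assms(9) by (simp add: \<eta>_def)
  obtain N where N: "\<And>i j. i \<ge> N \<Longrightarrow> j \<ge> N \<Longrightarrow> dist ((F \<circ> s) i) ((F \<circ> s) j) < \<eta>"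
    using \<open>Cauchy (F \<circ> s)\<close> eta unfolding Cauchy_def by blast
  define i where "i = s N"
  define k where "k = s (Suc N) - s N"
  have sl: "s N < s (Suc N)" using s(1) by (simp add: strict_mono_def)
  then obtain n where n: "k = Suc n" by (cases k) (auto simp: k_def)
  have ik: "s (Suc N) = i + k" using sl by (simp add: i_def k_def)
  have "norm (F (i + k) - F i) < \<eta>" using N[of "Suc N" N] by (simp add: dist_norm ik i_def[symmetric])
  then have near: "norm ((M ^^ i) ((M ^^ k) h) - (M ^^ i) h) \<le> \<eta> * norm h" for h
    using norm_blinfun[of "F (i + k) - F i" h] mult_right_mono[of "norm (F (i + k) - F i)" \<eta> "norm h"]
    by (simp add: blinfun.diff_left Fa funpow_add)
  have lini: "linear (M ^^ i)" using blin linear_conv_bounded_linear by blast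
  have M1: "norm ((M ^^ k) h - h) \<le> K * (\<eta> * norm h)" for h
  proof -
    have "norm ((M ^^ k) h - h) \<le> K * norm ((M ^^ i) ((M ^^ k) h - h))" by (rule Kb) (simp add: QM)
    also have "\<dots> \<le> K * (\<eta> * norm h)" using near[of h] K1 by (simp add: linear_diff[OF lini])
    finally show ?thesis .
  qed
  have M2: "norm ((M' ^^ k) h - h) \<le> K * (K * (\<eta> * norm h))" for h
  proof -
    define g where "g = (M' ^^ k) h"
    have "Q g = Q h" by (simp add: g_def QM')
    have inv': "(M ^^ k) g = h"
    proof -
      have "(M ^^ n) ((M' ^^ n) h) = h" for n h
      proof (induction n arbitrary: h)
        case (Suc n)
        show ?case by (subst funpow_Suc_right) (simp add: inv Suc)
      qed simp
      then show ?thesis by (simp add: g_def)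
    qed
    have "norm (g - h) = norm ((M ^^ k) g - g)" by (simp add: inv' norm_minus_commute)
    also have "\<dots> \<le> K * (\<eta> * norm g)" by (rule M1)
    also have "\<dots> \<le> K * (\<eta> * (K * norm h))"
      using Kb[OF \<open>Q g = Q h\<close>] K1 eta by (intro mult_left_mono) auto
    finally show ?thesis by (simp add: g_def mult_ac)
  qed
  have "K * (\<eta> * norm h) \<le> \<epsilon> * norm h" "K * (K * (\<eta> * norm h)) \<le> \<epsilon> * norm h" for h
  proof -
    have "K * \<eta> * (1 + K) = \<epsilon>" using K1 by (simp add: \<eta>_def field_simps add_nonneg_eq_0_iff)
    then have e: "K * \<eta> + K * (K * \<eta>) = \<epsilon>" by (simp add: algebra_simps)
    have "K * \<eta> > 0" "K * (K * \<eta>) > 0" using K1 eta by simp_all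
    then have "K * \<eta> \<le> \<epsilon>" "K * (K * \<eta>) \<le> \<epsilon>" using e by linarith+
    then have "K * \<eta> * norm h \<le> \<epsilon> * norm h" "K * (K * \<eta>) * norm h \<le> \<epsilon> * norm h"
      by (simp_all add: mult_right_mono)
    then show "K * (\<eta> * norm h) \<le> \<epsilon> * norm h" "K * (K * (\<eta> * norm h)) \<le> \<epsilon> * norm h"
      by (simp_all add: mult_ac)
  qed
  then have "\<And>h. norm ((M ^^ k) h - h) \<le> \<epsilon> * norm h" "\<And>h. norm ((M' ^^ k) h - h) \<le> \<epsilon> * norm h"
    using M1 M2 order_trans by blast+
  then show thesis using that unfolding n by blast
qed

section \<open>Elements close to the identity near a fixed point\<close>

text \<open>The derivative of \<open>s_x\<close> at (x, y, z); it depends neither on the reflected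
  coordinate x nor on the parameter A.\<close>

definition tangent_x :: "complex \<Rightarrow> complex \<Rightarrow> point \<Rightarrow> point" where
  "tangent_x y z = (\<lambda>h. (- fst h - z * fst (snd h) - y * snd (snd h), fst (snd h), snd (snd h)))"

definition tangent_y :: "complex \<Rightarrow> complex \<Rightarrow> point \<Rightarrow> point" where
  "tangent_y x z = (\<lambda>h. (fst h, - fst (snd h) - z * fst h - x * snd (snd h), snd (snd h)))"

definition tangent_z :: "complex \<Rightarrow> complex \<Rightarrow> point \<Rightarrow> point" where
  "tangent_z x y = (\<lambda>h. (fst h, fst (snd h), - snd (snd h) - y * fst h - x * fst (snd h)))"

lemma has_derivative_s_x: "(s_x A has_derivative tangent_x y z) (at (x, y, z))"
  unfolding s_x_def tangent_x_def case_prod_unfold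
  by (auto intro!: derivative_eq_intros simp: fun_eq_iff)

lemma has_derivative_s_y: "(s_y B has_derivative tangent_y x z) (at (x, y, z))"
  unfolding s_y_def tangent_y_def case_prod_unfold
  by (auto intro!: derivative_eq_intros simp: fun_eq_iff)

lemma has_derivative_s_z: "(s_z C has_derivative tangent_z x y) (at (x, y, z))"
  unfolding s_z_def tangent_z_def case_prod_unfold
  by (auto intro!: derivative_eq_intros simp: fun_eq_iff)

lemma has_derivative_funpow_fixpoint:
  assumes "(f has_derivative L) (at p)" "f p = p"
  shows "((f ^^ n) has_derivative (L ^^ n)) (at p)"
proof (induction n)
  case 0
  show ?case by (simp add: id_def)
next
  case (Suc n)
  have "(f ^^ n) p = p" using assms(2) by (induction n) simp_all
  then have "(f has_derivative L) (at ((f ^^ n) p))" using assms(1) by simp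
  from diff_chain_at[OF Suc this] show ?case by (simp only: funpow.simps)
qed

text \<open>The bound is proportional to every smaller radius \<open>s\<close>, so that several
  words can share the least of their radii.\<close>

lemma displacement_near_fixpoint:
  fixes f :: "'a::real_normed_vector \<Rightarrow> 'a"
  assumes "(f has_derivative L) (at p)" "f p = p" "\<And>h. norm (L h - h) \<le> \<epsilon> * norm h" "\<epsilon> > 0"
  obtains r where "r > 0" "\<And>s q. s \<le> r \<Longrightarrow> dist p q \<le> s \<Longrightarrow> norm (f q - q) \<le> 2 * \<epsilon> * s"
proof -
  obtain d where d: "d > 0" "\<And>y. norm (y - p) < d \<Longrightarrow> norm (f y - f p - L (y - p)) \<le> \<epsilon> * norm (y - p)"
    using assms(1,4) unfolding has_derivative_at_alt by blast
  have "norm (f q - q) \<le> 2 * \<epsilon> * s" if s: "s \<le> d / 2" "dist p q \<le> s" for s q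
  proof -
    have n: "norm (q - p) \<le> s" using s(2) by (simp add: dist_norm norm_minus_commute)
    then have "norm (f q - f p - L (q - p)) \<le> \<epsilon> * norm (q - p)" using d s(1) by simp
    moreover have "norm (L (q - p) - (q - p)) \<le> \<epsilon> * norm (q - p)" by (rule assms(3))
    moreover have "f q - q = (f q - f p - L (q - p)) + (L (q - p) - (q - p))" using assms(2) by simp
    ultimately have "norm (f q - q) \<le> \<epsilon> * norm (q - p) + \<epsilon> * norm (q - p)"
      by (metis norm_triangle_mono)
    also have "\<dots> \<le> 2 * \<epsilon> * s" using n assms(4) by (simp add: mult_left_mono)
    finally show ?thesis .
  qed
  then show thesis using d(1) by (intro that[of "d / 2"]) auto
qed

lemma rotation_power_near_identity:
  fixes x y :: complex and \<zeta> :: real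
  assumes z: "\<bar>\<zeta>\<bar> < 2" and "\<epsilon> > 0"
  defines "M \<equiv> tangent_y x \<zeta> \<circ> tangent_x y \<zeta>" and "M' \<equiv> tangent_x y \<zeta> \<circ> tangent_y x \<zeta>"
  obtains n where "\<And>h. norm ((M ^^ Suc n) h - h) \<le> \<epsilon> * norm h" "\<And>h. norm ((M' ^^ Suc n) h - h) \<le> \<epsilon> * norm h"
proof -
  \<comment> \<open>In the coordinates \<open>U\<close>, \<open>V\<close> centred at the common fixed line both reflections preserve the
    Hermitian form \<open>q\<close>, which is definite because \<open>\<bar>\<zeta>\<bar> < 2\<close>.\<close>
  define \<alpha> where "\<alpha> = (\<zeta> * x - 2 * y) / (4 - complex_of_real \<zeta> ^ 2)"
  define \<beta> where "\<beta> = (\<zeta> * y - 2 * x) / (4 - complex_of_real \<zeta> ^ 2)"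
  have "\<zeta>\<^sup>2 < 4" using z abs_square_less_1[of "\<zeta> / 2"] by (simp add: power_divide)
  then have "complex_of_real (4 - \<zeta>\<^sup>2) \<noteq> 0" by (metis less_iff_diff_less_0 less_numeral_extra(3) neg_less_0_iff_less minus_diff_eq of_real_eq_0_iff)
  then have ne: "4 - complex_of_real \<zeta> ^ 2 \<noteq> 0" by simp
  \<comment> \<open>These equations say that (\<alpha>, \<beta>, 1) is fixed by both tangent maps;
    \<alpha> and \<beta> come from Cramer's rule with determinant
    \<open>4 - \<zeta>\<^sup>2\<close>.\<close>
  have ab: "2 * \<alpha> + \<zeta> * \<beta> + y = 0" "2 * \<beta> + \<zeta> * \<alpha> + x = 0"
  proof -
    define d where "d = 4 - complex_of_real \<zeta> ^ 2"
    have d: "\<alpha> * d = \<zeta> * x - 2 * y" "\<beta> * d = \<zeta> * y - 2 * x" "d \<noteq> 0"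
      using ne by (simp_all add: \<alpha>_def \<beta>_def d_def)
    have "(2 * \<alpha> + \<zeta> * \<beta> + y) * d = 2 * (\<alpha> * d) + \<zeta> * (\<beta> * d) + y * d"
      "(2 * \<beta> + \<zeta> * \<alpha> + x) * d = 2 * (\<beta> * d) + \<zeta> * (\<alpha> * d) + x * d"
      by (simp_all add: algebra_simps)
    then have "(2 * \<alpha> + \<zeta> * \<beta> + y) * d = 0" "(2 * \<beta> + \<zeta> * \<alpha> + x) * d = 0"
      unfolding d(1,2) by (simp_all add: d_def algebra_simps power2_eq_square)
    then show "2 * \<alpha> + \<zeta> * \<beta> + y = 0" "2 * \<beta> + \<zeta> * \<alpha> + x = 0" using d(3) by simp_all
  qed
  define U where "U h = fst h - \<alpha> * snd (snd h)" for h :: point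
  define V where "V h = fst (snd h) - \<beta> * snd (snd h)" for h :: point
  define q where "q a b = (norm a)\<^sup>2 + (norm b)\<^sup>2 + \<zeta> * (Re a * Re b + Im a * Im b)" for a b :: complex
  \<comment> \<open>The form \<open>q\<close> vanishes along the fixed line; the last summand, also
    invariant, makes \<open>Q\<close> definite on the whole space.\<close>
  define Q where "Q h = q (U h) (V h) + (norm (snd (snd h)))\<^sup>2" for h
  have tx: "U (tangent_x y \<zeta> h) = - U h - \<zeta> * V h" "V (tangent_x y \<zeta> h) = V h" "snd (snd (tangent_x y \<zeta> h)) = snd (snd h)" for h
  proof -
    have "U (tangent_x y \<zeta> h) - (- U h - \<zeta> * V h) = - (2 * \<alpha> + \<zeta> * \<beta> + y) * snd (snd h)"
      by (simp add: U_def V_def tangent_x_def algebra_simps)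
    then show "U (tangent_x y \<zeta> h) = - U h - \<zeta> * V h" using ab(1) by simp
  qed (simp_all add: V_def tangent_x_def)
  have ty: "V (tangent_y x \<zeta> h) = - V h - \<zeta> * U h" "U (tangent_y x \<zeta> h) = U h" "snd (snd (tangent_y x \<zeta> h)) = snd (snd h)" for h
  proof -
    have "V (tangent_y x \<zeta> h) - (- V h - \<zeta> * U h) = - (2 * \<beta> + \<zeta> * \<alpha> + x) * snd (snd h)"
      by (simp add: U_def V_def tangent_y_def algebra_simps)
    then show "V (tangent_y x \<zeta> h) = - V h - \<zeta> * U h" using ab(2) by simp
  qed (simp_all add: U_def tangent_y_def)
  have q1: "q (- a - \<zeta> * b) b = q a b" for a b :: complex
    unfolding q_def cmod_power2 by (simp add: power2_eq_square algebra_simps)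
  have q2: "q a (- b - \<zeta> * a) = q a b" for a b :: complex
    unfolding q_def cmod_power2 by (simp add: power2_eq_square algebra_simps)
  have qpos: "q a b > 0" if "a \<noteq> 0 \<or> b \<noteq> 0" for a b
  proof -
    have "\<bar>Re a * Re b + Im a * Im b\<bar> \<le> norm a * norm b"
      using Cauchy_Schwarz_ineq2[of a b] by (simp add: inner_complex_def)
    then have "\<bar>\<zeta> * (Re a * Re b + Im a * Im b)\<bar> \<le> \<bar>\<zeta>\<bar> * (norm a * norm b)"
      by (simp add: abs_mult mult_left_mono)
    moreover have "2 * (norm a * norm b) \<le> (norm a)\<^sup>2 + (norm b)\<^sup>2"
      using sum_squares_bound[of "norm a" "norm b"] by simp
    then have "\<bar>\<zeta>\<bar> * (norm a * norm b) \<le> \<bar>\<zeta>\<bar> * (((norm a)\<^sup>2 + (norm b)\<^sup>2) / 2)"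
      by (intro mult_left_mono) auto
    moreover have "(norm a)\<^sup>2 + (norm b)\<^sup>2 > 0" using that
      by (metis add_nonneg_pos add_pos_nonneg norm_eq_zero zero_le_power2 zero_less_power2)
    then have "\<bar>\<zeta>\<bar> * (((norm a)\<^sup>2 + (norm b)\<^sup>2) / 2) < 2 * (((norm a)\<^sup>2 + (norm b)\<^sup>2) / 2)"
      using z by (intro mult_strict_right_mono) auto
    ultimately have "\<bar>\<zeta> * (Re a * Re b + Im a * Im b)\<bar> < (norm a)\<^sup>2 + (norm b)\<^sup>2" by argo
    then show ?thesis unfolding q_def by (simp only: abs_less_iff) linarith
  qed
  have lin: "linear (tangent_x y \<zeta>)" "linear (tangent_y x \<zeta>)"
    using has_derivative_linear[OF has_derivative_s_x] has_derivative_linear[OF has_derivative_s_y] by blast+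
  have inv: "tangent_x y \<zeta> (tangent_x y \<zeta> h) = h" "tangent_y x \<zeta> (tangent_y x \<zeta> h) = h" for h
    by (cases h; simp add: tangent_x_def tangent_y_def)+
  show thesis
  proof (rule power_near_identity[of M M' Q \<epsilon>])
    show "linear M" "linear M'" unfolding M_def M'_def using lin linear_compose by blast+
    show "M (M' h) = h" "M' (M h) = h" for h by (simp_all add: M_def M'_def inv)
    show "continuous_on UNIV Q" unfolding Q_def q_def U_def V_def by (intro continuous_intros)
    show "Q (s *\<^sub>R h) = s\<^sup>2 * Q h" for s h
    proof -
      have "U (s *\<^sub>R h) = s *\<^sub>R U h" "V (s *\<^sub>R h) = s *\<^sub>R V h" by (simp_all add: U_def V_def algebra_simps)
      then show ?thesis by (simp add: Q_def q_def power_mult_distrib algebra_simps power2_eq_square)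
    qed
    show "Q h > 0" if "h \<noteq> 0" for h
    proof (cases "U h \<noteq> 0 \<or> V h \<noteq> 0")
      case True
      then show ?thesis using qpos[of "U h" "V h"] by (simp add: Q_def add_pos_nonneg)
    next
      case False
      have "snd (snd h) \<noteq> 0"
      proof
        assume "snd (snd h) = 0"
        then show False using False that by (simp add: U_def V_def prod_eq_iff)
      qed
      then show ?thesis using False by (simp add: Q_def q_def)
    qed
    show "Q (M h) = Q h" for h by (simp add: M_def Q_def tx ty q1 q2)
    show "\<epsilon> > 0" by fact
  qed (rule that)
qed

lemma word_map_concat_replicate: "word_map A B C (concat (replicate n w)) = (word_map A B C w) ^^ n"
  by (induction n) (simp_all add: fun_eq_iff)

lemma small_words_at_fixed_point:
  fixes x y :: complex and \<zeta> :: real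
  defines "p \<equiv> (x, y, complex_of_real \<zeta>)"
  assumes fixed: "\<And>i. reflection A B C i p = p" and z: "\<bar>\<zeta>\<bar> < 2"
  obtains n r where "r > 0"
    "\<And>w. w \<in> {concat (replicate (Suc n) [Y_axis, X_axis]), concat (replicate (Suc n) [X_axis, Y_axis]),
        Z_axis # concat (replicate (Suc n) [X_axis, Y_axis]) @ [Z_axis],
        Z_axis # concat (replicate (Suc n) [Y_axis, X_axis]) @ [Z_axis]} \<Longrightarrow> displaces A B C p r (r / 1200) w"
proof -
  have fp: "s_x A p = p" "s_y B p = p" "s_z C p = p" using fixed[of X_axis] fixed[of Y_axis] fixed[of Z_axis] by simp_all
  define T where "T = tangent_z x y"
  have Tder: "(s_z C has_derivative T) (at p)" unfolding T_def p_def by (rule has_derivative_s_z)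
  have TT: "T (T h) = h" for h by (cases h) (simp add: T_def tangent_z_def)
  have Tlin: "bounded_linear T" by (rule has_derivative_bounded_linear[OF Tder])
  obtain K where K: "K > 0" "\<And>h. norm (T h) \<le> norm h * K" using bounded_linear.pos_bounded[OF Tlin] by blast
  \<comment> \<open>Conjugation by the derivative of \<open>s_z\<close> costs at most K * K. The
    resulting 1/2400 becomes 1/1200 after linearization, which is half of the required 1/600 and
    leaves room to vary the parameters.\<close>
  define \<epsilon> where "\<epsilon> = 1 / (2400 * (1 + K * K))"
  have eps: "\<epsilon> > 0" using K(1) by (simp add: \<epsilon>_def add_pos_pos)
  have eK: "\<epsilon> * (1 + K * K) = 1 / 2400" using K(1) by (simp add: \<epsilon>_def field_simps add_nonneg_eq_0_iff)
  then have "\<epsilon> + \<epsilon> * (K * K) = 1 / 2400" by (simp only: ring_distribs mult_1_right)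
  moreover have "\<epsilon> * (K * K) > 0" using eps K(1) by simp
  ultimately have eKs: "\<epsilon> \<le> 1 / 2400" "\<epsilon> * (K * K) \<le> 1 / 2400" using eps by linarith+
  define M where "M = tangent_y x \<zeta> \<circ> tangent_x y \<zeta>"
  define M' where "M' = tangent_x y \<zeta> \<circ> tangent_y x \<zeta>"
  obtain n where n: "\<And>h. norm ((M ^^ Suc n) h - h) \<le> \<epsilon> * norm h" "\<And>h. norm ((M' ^^ Suc n) h - h) \<le> \<epsilon> * norm h"
    by (rule rotation_power_near_identity[OF z eps, of x y, folded M_def M'_def]) (rule that)
  define f where "f = (s_y B \<circ> s_x A) ^^ Suc n"
  define f' where "f' = (s_x A \<circ> s_y B) ^^ Suc n"
  have dxy: "(s_x A has_derivative tangent_x y \<zeta>) (at p)" "(s_y B has_derivative tangent_y x \<zeta>) (at p)"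
    unfolding p_def by (rule has_derivative_s_x has_derivative_s_y)+
  have "((s_y B \<circ> s_x A) has_derivative M) (at p)" "((s_x A \<circ> s_y B) has_derivative M') (at p)"
    unfolding M_def M'_def using diff_chain_at[OF dxy(1)] diff_chain_at[OF dxy(2)] dxy fp by simp_all
  then have der: "(f has_derivative (M ^^ Suc n)) (at p)" "(f' has_derivative (M' ^^ Suc n)) (at p)"
    unfolding f_def f'_def
    using has_derivative_funpow_fixpoint[of "s_y B \<circ> s_x A" M p "Suc n"]
      has_derivative_funpow_fixpoint[of "s_x A \<circ> s_y B" M' p "Suc n"] fp by (simp_all only: comp_apply)
  have fpp: "((s_y B \<circ> s_x A) ^^ k) p = p" "((s_x A \<circ> s_y B) ^^ k) p = p" for k
    by (induction k) (simp_all add: fp)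
  have ffix: "f p = p" "f' p = p" unfolding f_def f'_def by (rule fpp)+
  have conj_der: "((s_z C \<circ> g \<circ> s_z C) has_derivative (T \<circ> L \<circ> T)) (at p)"
    if "(g has_derivative L) (at p)" "g p = p" for g L
  proof -
    have "((g \<circ> s_z C) has_derivative (L \<circ> T)) (at p)" using diff_chain_at[OF Tder] that(1) fp by simp
    from diff_chain_at[OF this, of "s_z C" T] show ?thesis using Tder fp that(2) by (simp add: comp_assoc)
  qed
  have conj_small: "norm ((T \<circ> L \<circ> T) h - h) \<le> 1 / 2400 * norm h"
    if "\<And>h. norm (L h - h) \<le> \<epsilon> * norm h" for L h
  proof -
    have "(T \<circ> L \<circ> T) h - h = T (L (T h) - T h)"
      by (simp add: linear_diff[OF bounded_linear.linear[OF Tlin]] TT)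
    then have "norm ((T \<circ> L \<circ> T) h - h) \<le> norm (L (T h) - T h) * K" using K(2) by simp
    also have "\<dots> \<le> \<epsilon> * norm (T h) * K" using that[of "T h"] K(1) by (intro mult_right_mono) auto
    also have "\<dots> \<le> \<epsilon> * (norm h * K) * K" using K eps by (intro mult_right_mono mult_left_mono) auto
    also have "\<dots> = \<epsilon> * (K * K) * norm h" by simp
    also have "\<dots> \<le> 1 / 2400 * norm h" using eKs(2) by (intro mult_right_mono) auto
    finally show ?thesis .
  qed
  have small: "norm ((M ^^ Suc n) h - h) \<le> 1 / 2400 * norm h" "norm ((M' ^^ Suc n) h - h) \<le> 1 / 2400 * norm h" for h
    using n[of h] eKs(1) mult_right_mono[of \<epsilon> "1 / 2400" "norm h"] norm_ge_zero[of h] by linarith+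
  have e0: "(1 / 2400 :: real) > 0" by simp
  obtain r1 where r1: "r1 > 0" "\<And>s q. s \<le> r1 \<Longrightarrow> dist p q \<le> s \<Longrightarrow> norm (f q - q) \<le> 2 * (1 / 2400) * s"
    by (rule displacement_near_fixpoint[OF der(1) ffix(1) small(1) e0]) (rule that)
  obtain r2 where r2: "r2 > 0" "\<And>s q. s \<le> r2 \<Longrightarrow> dist p q \<le> s \<Longrightarrow> norm (f' q - q) \<le> 2 * (1 / 2400) * s"
    by (rule displacement_near_fixpoint[OF der(2) ffix(2) small(2) e0]) (rule that)
  have fz: "(s_z C \<circ> f \<circ> s_z C) p = p" "(s_z C \<circ> f' \<circ> s_z C) p = p" using fp ffix by simp_all
  obtain r3 where r3: "r3 > 0" "\<And>s q. s \<le> r3 \<Longrightarrow> dist p q \<le> s \<Longrightarrow> norm ((s_z C \<circ> f \<circ> s_z C) q - q) \<le> 2 * (1 / 2400) * s"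
    by (rule displacement_near_fixpoint[OF conj_der[OF der(1) ffix(1)] fz(1) conj_small[OF n(1)] e0]) (rule that)
  obtain r4 where r4: "r4 > 0" "\<And>s q. s \<le> r4 \<Longrightarrow> dist p q \<le> s \<Longrightarrow> norm ((s_z C \<circ> f' \<circ> s_z C) q - q) \<le> 2 * (1 / 2400) * s"
    by (rule displacement_near_fixpoint[OF conj_der[OF der(2) ffix(2)] fz(2) conj_small[OF n(2)] e0]) (rule that)
  define r where "r = min (min r1 r2) (min r3 r4)"
  have r: "r > 0" "r \<le> r1" "r \<le> r2" "r \<le> r3" "r \<le> r4" using r1(1) r2(1) r3(1) r4(1) by (auto simp: r_def)
  have W2: "word_map A B C [Y_axis, X_axis] = s_y B \<circ> s_x A" "word_map A B C [X_axis, Y_axis] = s_x A \<circ> s_y B"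
    by (simp_all add: fun_eq_iff)
  have W: "word_map A B C (concat (replicate (Suc n) [Y_axis, X_axis])) = f"
    "word_map A B C (concat (replicate (Suc n) [X_axis, Y_axis])) = f'"
    unfolding word_map_concat_replicate W2 f_def f'_def by (rule refl)+
  have W3: "word_map A B C (Z_axis # w @ [Z_axis]) = s_z C \<circ> word_map A B C w \<circ> s_z C" for w
    by (simp add: fun_eq_iff)
  show thesis
  proof (rule that[OF r(1)])
    fix w assume "w \<in> {concat (replicate (Suc n) [Y_axis, X_axis]), concat (replicate (Suc n) [X_axis, Y_axis]),
        Z_axis # concat (replicate (Suc n) [X_axis, Y_axis]) @ [Z_axis],
        Z_axis # concat (replicate (Suc n) [Y_axis, X_axis]) @ [Z_axis]}"
    then have "word_map A B C w \<in> {f, f', s_z C \<circ> f' \<circ> s_z C, s_z C \<circ> f \<circ> s_z C}"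
      using W W3 by (metis insert_iff empty_iff)
    then have "norm (word_map A B C w q - q) \<le> 2 * (1 / 2400) * r" if "dist p q \<le> r" for q
      using r1(2)[OF r(2) that] r2(2)[OF r(3) that] r3(2)[OF r(4) that] r4(2)[OF r(5) that] by auto
    then show "displaces A B C p r (r / 1200) w" by (simp add: displaces_def)
  qed
qed

section \<open>Persistence under change of parameters\<close>

lemma continuous_on_word_map_params:
  "continuous_on UNIV (\<lambda>(q, A, B, C). word_map A B C w q)"
proof -
  have refl: "continuous_on UNIV (\<lambda>(q, A, B, C). reflection A B C i q)" for i
    by (cases i) (simp_all add: s_x_def s_y_def s_z_def case_prod_unfold continuous_intros)
  show ?thesis
  proof (induction w)
    case Nil
    show ?case by (simp add: case_prod_unfold continuous_intros)
  next
    case (Cons i w)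
    have "continuous_on UNIV (\<lambda>v. (\<lambda>(q, A, B, C). reflection A B C i q) ((\<lambda>(q, A, B, C). word_map A B C w q) v, snd v))"
      by (rule continuous_on_compose2[OF refl]) (intro continuous_intros Cons.IH | simp)+
    then show ?case by (simp add: case_prod_unfold)
  qed
qed

lemma displaces_nearby_parameters:
  assumes d: "displaces A0 B0 C0 p r \<delta> w" "\<delta> < \<delta>'" "r > 0"
  obtains P where "open P" "(A0, B0, C0) \<in> P" "\<And>A B C. (A, B, C) \<in> P \<Longrightarrow> displaces A B C p r \<delta>' w"
proof -
  define W where "W = {v :: point \<times> complex \<times> complex \<times> complex. norm ((\<lambda>(q, A, B, C). word_map A B C w q) v - fst v) < \<delta>'}"
  have opW: "open W" unfolding W_def
    by (intro open_Collect_less continuous_intros continuous_on_word_map_params)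
  obtain V where V: "openin (top_of_set UNIV) V" "(A0, B0, C0) \<in> V" "cball p r \<times> V \<subseteq> (cball p r \<times> UNIV) \<inter> W"
  proof (rule tube_lemma[of "cball p r" "(A0, B0, C0)" "(cball p r \<times> UNIV) \<inter> W" UNIV])
    show "cball p r \<noteq> {}" using d(3) by simp
    show "(\<lambda>x. (x, (A0, B0, C0))) ` cball p r \<subseteq> (cball p r \<times> UNIV) \<inter> W"
      using d(1,2) by (force simp: W_def displaces_def)
    show "openin (top_of_set (cball p r \<times> UNIV)) ((cball p r \<times> UNIV) \<inter> W)" using opW by blast
  qed (simp, rule that)
  show thesis
  proof (rule that[of V])
    show "open V" using V(1) by simp
    fix A B C assume "(A, B, C) \<in> V"
    then have "(q, A, B, C) \<in> W" if "dist p q \<le> r" for q using V(3) that by auto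
    then show "displaces A B C p r \<delta>' w" by (auto simp: W_def displaces_def less_imp_le)
  qed (rule V(2))
qed

text \<open>With x and y kept, the perturbed defining polynomial at z is the product of the
  distances to its two roots, up to sign; if it is small, one root is near z. This works at singular
  points, where the implicit function theorem does not apply.\<close>

lemma surf_meets_nearby:
  assumes V: "open V" "p \<in> V" and p: "p \<in> surf A0 B0 C0 D0"
  obtains P where "open P" "(A0, B0, C0, D0) \<in> P" "\<And>A B C D. (A, B, C, D) \<in> P \<Longrightarrow> surf A B C D \<inter> V \<noteq> {}"
proof -
  obtain x y z where xyz: "p = (x, y, z)" by (cases p)
  obtain e where e: "e > 0" "ball p e \<subseteq> V" using V open_contains_ball by blast
  define F where "F v = x\<^sup>2 + y\<^sup>2 + z\<^sup>2 + x * y * z - fst v * x - fst (snd v) * y - fst (snd (snd v)) * z - snd (snd (snd v))"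
    for v :: "complex \<times> complex \<times> complex \<times> complex"
  show thesis
  proof (rule that[of "{v. norm (F v) < e\<^sup>2}"])
    show "open {v. norm (F v) < e\<^sup>2}" unfolding F_def by (intro open_Collect_less continuous_intros)
    show "(A0, B0, C0, D0) \<in> {v. norm (F v) < e\<^sup>2}" using p e(1) by (simp add: F_def xyz surf_def)
    fix A B C D assume small: "(A, B, C, D) \<in> {v. norm (F v) < e\<^sup>2}"
    define g where "g = csqrt (disc A B C D (x, y))"
    have g2: "g\<^sup>2 = disc A B C D (x, y)" by (simp add: g_def)
    have g2': "(- g)\<^sup>2 = disc A B C D (x, y)" by (simp add: g2)
    define a where "a = (C - x * y + g) / 2"
    define b where "b = (C - x * y + - g) / 2"
    have S: "(x, y, a) \<in> surf A B C D" "(x, y, b) \<in> surf A B C D"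
      unfolding a_def b_def using surf_root[OF g2] surf_root[OF g2'] by blast+
    have sum: "a + b = C - x * y" by (simp add: a_def b_def field_simps)
    have "x\<^sup>2 + y\<^sup>2 + a\<^sup>2 + x * y * a = A * x + B * y + C * a + D" using S(1) by (simp add: surf_def)
    then have "F (A, B, C, D) = (z - a) * (z - b)" using sum unfolding F_def fst_conv snd_conv by algebra
    then have "norm (z - a) * norm (z - b) < e * e" using small by (simp add: norm_mult power2_eq_square)
    then have "norm (z - a) < e \<or> norm (z - b) < e"
      using mult_mono'[of e "norm (z - a)" e "norm (z - b)"] e(1) by linarith
    then have "(x, y, a) \<in> ball p e \<or> (x, y, b) \<in> ball p e" by (simp add: xyz dist_Pair_Pair dist_norm)
    then show "surf A B C D \<inter> V \<noteq> {}" using S e(2) by blast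
  qed
qed

section \<open>Coexistence of both behaviours and the dimension of the frontier\<close>

lemma frontier_\<N>_dim_3:
  assumes ne: "\<N> A B C D \<noteq> {}" and v: "v \<in> surf A B C D - closure (\<N> A B C D)"
  defines "F \<equiv> top_of_set (surf A B C D) frontier_of \<N> A B C D"
  shows "has_top_dim (top_of_set F) 3"
proof -
  define S where "S = surf A B C D"
  define N where "N = \<N> A B C D"
  have N: "openin (top_of_set S) N" unfolding S_def N_def by (rule openin_\<N>)
  have F: "F = closure N - N"
    unfolding F_def N_def by (rule frontier_of_openin_surf[OF openin_\<N>])
  obtain T where T: "open T" "N = S \<inter> T" using N unfolding openin_open by blast
  have clS: "closure N \<subseteq> S" using closure_minimal[of N S] T(2) closed_surf by (auto simp: S_def)
  then have "F = closure N \<inter> - T" using T(2) by (auto simp: F)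
  then have clF: "closed F" using T(1) by (simp add: closed_Int closed_Compl)
  have FS: "F \<subseteq> surf A B C D" using clS by (auto simp: F S_def)
  have sz: "s_z C ` \<N> A B C D \<subseteq> \<N> A B C D" using reflection_\<N>_subset[of A B C Z_axis D] by simp
  have "interior (proj ` F) = {}"
  proof (rule empty_interior_projection[OF FS])
    show "s_z C ` F \<subseteq> F"
      using reflection_frontier_\<N>[of _ A B C D Z_axis] unfolding F N_def by auto
    fix O' assume O': "openin (top_of_set (surf A B C D)) O'" "O' \<subseteq> F"
    show "O' = {}"
    proof (rule ccontr)
      assume "O' \<noteq> {}"
      then obtain q where q: "q \<in> O'" by blast
      obtain V where V: "open V" "O' = S \<inter> V" using O'(1) unfolding openin_open S_def by blast
      have "q \<in> closure N" "q \<in> V" using q O'(2) V(2) by (auto simp: F)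
      then obtain q' where "q' \<in> N" "q' \<in> V" using V(1) by (metis closure_iff_nhds_not_empty disjoint_iff subsetI)
      then show False using V(2) O'(2) T(2) F by blast
    qed
  qed
  then have "top_of_set F dim_le 3" by (rule dim_le_3_if_nowhere_dense_projection[OF clF FS])
  moreover have "\<not> top_of_set F dim_le 2"
    unfolding F_def by (rule frontier_not_dim_le_2_surf[OF openin_\<N> sz ne v])
  ultimately show ?thesis by (simp add: has_top_dim_def)
qed

definition coexistence :: "complex \<times> complex \<times> complex \<times> complex \<Rightarrow> bool" where
  "coexistence = (\<lambda>(A, B, C, D). \<N> A B C D \<noteq> {} \<and> surf A B C D - closure (\<N> A B C D) \<noteq> {})"

text \<open>Nearby surfaces need contain neither \<open>q\<close> nor \<open>p\<close>. The ball
  around \<open>q\<close> keeps its displacement bounds and still meets the surface, and some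
  surface point \<open>p'\<close> near \<open>p\<close> is expanding. That point does double duty:
  it lies off the closure of the non-discreteness locus and supplies the ping-pong sets.\<close>

lemma coexistence_nearby:
  fixes x y :: complex and \<zeta> :: real
  defines "q \<equiv> (x, y, complex_of_real \<zeta>)"
  assumes q: "q \<in> surf A0 B0 C0 D0" "\<And>i. reflection A0 B0 C0 i q = q" "\<bar>\<zeta>\<bar> < 2"
    and p: "p \<in> surf A0 B0 C0 D0" "expanding m \<kappa> c' c A0 B0 C0 p"
  shows "(A0, B0, C0, D0) \<in> interior (Collect coexistence)"
proof -
  obtain n r where r: "r > 0" and small: "\<And>w. w \<in> {concat (replicate (Suc n) [Y_axis, X_axis]), concat (replicate (Suc n) [X_axis, Y_axis]),
        Z_axis # concat (replicate (Suc n) [X_axis, Y_axis]) @ [Z_axis],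
        Z_axis # concat (replicate (Suc n) [Y_axis, X_axis]) @ [Z_axis]} \<Longrightarrow> displaces A0 B0 C0 q r (r / 1200) w"
    using small_words_at_fixed_point[of A0 B0 C0 x y \<zeta>] q(2,3) unfolding q_def by metis
  define u where "u = concat (replicate (Suc n) [Y_axis, X_axis])"
  define v where "v = Z_axis # rev u @ [Z_axis]"
  have ru: "rev u = concat (replicate (Suc n) [X_axis, Y_axis])" unfolding u_def by (rule rev_concat_replicate_pair)
  have rv: "rev v = Z_axis # u @ [Z_axis]" by (simp add: v_def)
  have len: "length (concat (replicate k [i, j])) = 2 * k" for k and i j :: axis by (induction k) simp_all
  have ev: "even (length u)" "even (length v)" unfolding v_def u_def by (simp_all only: length_rev length_append length_Cons len list.size, simp_all)
  have d0: "displaces A0 B0 C0 q r (r / 1200) u" "displaces A0 B0 C0 q r (r / 1200) v"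
    "displaces A0 B0 C0 q r (r / 1200) (rev u)" "displaces A0 B0 C0 q r (r / 1200) (rev v)"
    unfolding rv unfolding v_def ru unfolding u_def by (rule small; blast)+
  have lt: "r / 1200 < r / 600" using r by simp
  obtain P1 where P1: "open P1" "(A0, B0, C0) \<in> P1" "\<And>A B C. (A, B, C) \<in> P1 \<Longrightarrow> displaces A B C q r (r / 600) u"
    using displaces_nearby_parameters[OF d0(1) lt r] by metis
  obtain P2 where P2: "open P2" "(A0, B0, C0) \<in> P2" "\<And>A B C. (A, B, C) \<in> P2 \<Longrightarrow> displaces A B C q r (r / 600) v"
    using displaces_nearby_parameters[OF d0(2) lt r] by metis
  obtain P3 where P3: "open P3" "(A0, B0, C0) \<in> P3" "\<And>A B C. (A, B, C) \<in> P3 \<Longrightarrow> displaces A B C q r (r / 600) (rev u)"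
    using displaces_nearby_parameters[OF d0(3) lt r] by metis
  obtain P4 where P4: "open P4" "(A0, B0, C0) \<in> P4" "\<And>A B C. (A, B, C) \<in> P4 \<Longrightarrow> displaces A B C q r (r / 600) (rev v)"
    using displaces_nearby_parameters[OF d0(4) lt r] by metis
  have "q \<in> ball q (r / 2)" using r by simp
  then obtain P5 where P5: "open P5" "(A0, B0, C0, D0) \<in> P5" "\<And>A B C D. (A, B, C, D) \<in> P5 \<Longrightarrow> surf A B C D \<inter> ball q (r / 2) \<noteq> {}"
    using surf_meets_nearby[OF open_ball _ q(1)] by metis
  have "((A0, B0, C0), p) \<in> {((A, B, C), p). expanding m \<kappa> c' c A B C p}" using p(2) by simp
  then obtain P6 V where V: "open P6" "open V" "((A0, B0, C0), p) \<in> P6 \<times> V"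
    "P6 \<times> V \<subseteq> {((A, B, C), p). expanding m \<kappa> c' c A B C p}"
    by (rule open_prod_elim[OF open_expanding])
  have "p \<in> V" using V(3) by simp
  then obtain P7 where P7: "open P7" "(A0, B0, C0, D0) \<in> P7" "\<And>A B C D. (A, B, C, D) \<in> P7 \<Longrightarrow> surf A B C D \<inter> V \<noteq> {}"
    using surf_meets_nearby[OF V(2) _ p(1)] by metis
  define P where "P = (\<lambda>w :: complex \<times> complex \<times> complex \<times> complex. (fst w, fst (snd w), fst (snd (snd w)))) -`
    (P1 \<inter> P2 \<inter> P3 \<inter> P4 \<inter> P6) \<inter> P5 \<inter> P7"
  have "open P" unfolding P_def
    by (intro open_Int open_vimage P1 P2 P3 P4 V P5 P7 continuous_intros)
  moreover have "(A0, B0, C0, D0) \<in> P" using P1 P2 P3 P4 V P5 P7 by (simp add: P_def)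
  moreover have "P \<subseteq> Collect coexistence"
  proof (rule subsetI)
    fix w assume w: "w \<in> P"
    obtain A B C D where ABCD: "w = (A, B, C, D)" by (cases w)
    have mem: "(A, B, C) \<in> P1" "(A, B, C) \<in> P2" "(A, B, C) \<in> P3" "(A, B, C) \<in> P4" "(A, B, C) \<in> P6"
      "(A, B, C, D) \<in> P5" "(A, B, C, D) \<in> P7" using w by (simp_all add: P_def ABCD)
    obtain p' where p': "p' \<in> surf A B C D" "p' \<in> V" using P7(3)[OF mem(7)] by blast
    have e: "expanding m \<kappa> c' c A B C p'" using V(4) mem(5) p'(2) by blast
    have "locally_nondiscrete A B C D (surf A B C D \<inter> ball q (r / 2))"
      by (rule locally_nondiscrete_if_ping_pong[OF P1(3)[OF mem(1)] P2(3)[OF mem(2)] P3(3)[OF mem(3)] P4(3)[OF mem(4)] r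
          ping_pong_words[OF e p'(1), of n, folded u_def, folded v_def] ev])
    moreover obtain q' where "q' \<in> surf A B C D \<inter> ball q (r / 2)" using P5(3)[OF mem(6)] by blast
    ultimately have "q' \<in> \<N> A B C D" unfolding \<N>_def by blast
    moreover have "p' \<in> surf A B C D - closure (\<N> A B C D)"
      using p'(1) expanding_not_in_closure_\<N>[OF e] by blast
    ultimately show "w \<in> Collect coexistence" by (auto simp: coexistence_def ABCD)
  qed
  ultimately show ?thesis using interior_maximal by blast
qed

lemma diagonal_surf:
  fixes t a d :: real
  assumes "t ^ 3 - 3 * t\<^sup>2 - 3 * a * t + d = 0"
  shows "(- complex_of_real t, - complex_of_real t, - complex_of_real t)
    \<in> surf (complex_of_real a) (complex_of_real a) (complex_of_real a) (complex_of_real d)"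
proof -
  have "complex_of_real (t ^ 3 - 3 * t\<^sup>2 - 3 * a * t + d) = 0" using assms by simp
  then have "complex_of_real t ^ 3 - 3 * (complex_of_real t)\<^sup>2 - 3 * complex_of_real a * complex_of_real t + complex_of_real d = 0"
    by simp
  then show ?thesis unfolding surf_def mem_Collect_eq prod.case by algebra
qed

lemma coexistence_near_zero: "(0, 0, 0, 0) \<in> interior (Collect coexistence)"
proof -
  obtain m \<kappa> c' c where e: "expanding m \<kappa> c' c (complex_of_real 0) (complex_of_real 0) (complex_of_real 0)
      (- complex_of_real 3, - complex_of_real 3, - complex_of_real 3)"
    by (rule diagonal_point_expanding[of 0 3]) simp_all
  have "reflection 0 0 0 i (0, 0, 0) = (0, 0, 0)" for i
    by (cases i) (simp_all add: s_x_def s_y_def s_z_def)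
  moreover have "(0, 0, 0) \<in> surf 0 0 0 0" by (simp add: surf_def)
  ultimately show ?thesis
    using coexistence_nearby[of 0 0 0 0 0 0 0, OF _ _ _ diagonal_surf[of 3 0 0, unfolded of_real_0] e[unfolded of_real_0]]
    by simp
qed

lemma coexistence_near_Picard_parameters:
  fixes a :: real
  assumes a: "- 2 < a" "a < 2"
  shows "(complex_of_real (2 * a + 4), complex_of_real (2 * a + 4), complex_of_real (2 * a + 4),
    complex_of_real (- (a\<^sup>2 + 8 * a + 8))) \<in> interior (Collect coexistence)"
proof -
  define A where "A = 2 * a + 4"
  define D where "D = - (a\<^sup>2 + 8 * a + 8)"
  define g where "g t = t ^ 3 - 3 * t\<^sup>2 - 3 * A * t + D" for t
  have a2: "a\<^sup>2 < 4" using a abs_square_less_1[of "a / 2"] by (simp add: power_divide abs_less_iff)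
  \<comment> \<open>The cubic \<open>g\<close> describes the diagonal points (-t, -t, -t) of the
    surface; it is negative at 2 because of this factorization, so it has a root beyond 2.\<close>
  have "(a + 2) * (a + 18) > 0" using a by simp
  moreover have g2: "g 2 = - ((a + 2) * (a + 18))"
    by (simp add: g_def A_def D_def power2_eq_square power3_eq_cube algebra_simps)
  ultimately have g2n: "g 2 < 0" by simp
  have g10: "g 10 > 0" using a a2 by (simp add: g_def A_def D_def)
  have "continuous_on {2..10} g" unfolding g_def by (intro continuous_intros)
  then obtain t where t: "2 \<le> t" "t \<le> 10" "g t = 0"
    using IVT'[of g 2 0 10] g2n g10 by auto
  have t2: "t > 2" using t(1,3) g2n by (cases "t = 2") auto
  \<comment> \<open>Dividing by \<open>t - 2\<close> shows that 3A is below (t - 2)(t + 1), and t +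
    1 is at most 3t; this gives the expansion condition A < t (t - 2).\<close>
  have "(t - 2) * (t\<^sup>2 - t - 2 - 3 * A) = g t - g 2"
    by (simp add: g_def power2_eq_square power3_eq_cube algebra_simps)
  then have "(t - 2) * (t\<^sup>2 - t - 2 - 3 * A) > 0" using t(3) g2n by simp
  then have "t\<^sup>2 - t - 2 - 3 * A > 0" using t2 by (simp add: zero_less_mult_iff)
  moreover have "(2 * t - 1) * (t - 2) \<ge> 0" using t2 by simp
  then have "2 * t\<^sup>2 - 5 * t + 2 \<ge> 0" by (simp add: power2_eq_square algebra_simps)
  ultimately have At: "A < t * (t - 2)" by (simp add: power2_eq_square algebra_simps)
  have A0: "0 \<le> A" using a by (simp add: A_def)
  obtain m \<kappa> c' c where e: "expanding m \<kappa> c' c (complex_of_real A) (complex_of_real A) (complex_of_real A)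
      (- complex_of_real t, - complex_of_real t, - complex_of_real t)"
    by (rule diagonal_point_expanding[OF A0 t2 At])
  have S: "(- complex_of_real t, - complex_of_real t, - complex_of_real t)
      \<in> surf (complex_of_real A) (complex_of_real A) (complex_of_real A) (complex_of_real D)"
    by (rule diagonal_surf) (use t(3) in \<open>simp add: g_def\<close>)
  have "reflection (complex_of_real A) (complex_of_real A) (complex_of_real A) i (2, 2, complex_of_real a) = (2, 2, complex_of_real a)" for i
    by (cases i) (simp_all add: s_x_def s_y_def s_z_def A_def)
  moreover have "(2, 2, complex_of_real a) \<in> surf (complex_of_real A) (complex_of_real A) (complex_of_real A) (complex_of_real D)"
    by (simp add: surf_def A_def D_def algebra_simps power2_eq_square)
  moreover have "\<bar>a\<bar> < 2" using a by simp
  ultimately have "(complex_of_real A, complex_of_real A, complex_of_real A, complex_of_real D) \<in> interior (Collect coexistence)"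
    using coexistence_nearby[of 2 2 a, OF _ _ _ S e] by blast
  then show ?thesis by (simp only: A_def D_def)
qed

theorem mainTheorem8:
  shows "\<exists>P :: (complex \<times> complex \<times> complex \<times> complex) set.
    open P \<and>
    (0, 0, 0, 0) \<in> P \<and>
    (\<forall>a::real. - 2 < a \<and> a < 2 \<longrightarrow>
       (complex_of_real (2 * a + 4), complex_of_real (2 * a + 4), complex_of_real (2 * a + 4),
        complex_of_real (- (a\<^sup>2 + 8 * a + 8))) \<in> P) \<and>
    (\<forall>A B C D. (A, B, C, D) \<in> P \<longrightarrow>
       (top_of_set (surf A B C D)) frontier_of (\<N> A B C D) =
         (top_of_set (surf A B C D)) frontier_of (\<D> A B C D) \<and>
       (\<exists>\<B>. \<B> \<subseteq> (top_of_set (surf A B C D)) frontier_of (\<N> A B C D) \<and>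
            has_top_dim (top_of_set \<B>) 3 \<and>
            (\<forall>g \<in> \<G> A B C D. g ` \<B> = \<B>)))"
proof (rule exI[of _ "interior (Collect coexistence)"], intro conjI)
  show "open (interior (Collect coexistence))" by (rule open_interior)
  show "(0, 0, 0, 0) \<in> interior (Collect coexistence)" by (rule coexistence_near_zero)
  show "\<forall>a::real. - 2 < a \<and> a < 2 \<longrightarrow>
       (complex_of_real (2 * a + 4), complex_of_real (2 * a + 4), complex_of_real (2 * a + 4),
        complex_of_real (- (a\<^sup>2 + 8 * a + 8))) \<in> interior (Collect coexistence)"
    using coexistence_near_Picard_parameters by blast
  show "\<forall>A B C D. (A, B, C, D) \<in> interior (Collect coexistence) \<longrightarrow>
       (top_of_set (surf A B C D)) frontier_of (\<N> A B C D) =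
         (top_of_set (surf A B C D)) frontier_of (\<D> A B C D) \<and>
       (\<exists>\<B>. \<B> \<subseteq> (top_of_set (surf A B C D)) frontier_of (\<N> A B C D) \<and>
            has_top_dim (top_of_set \<B>) 3 \<and>
            (\<forall>g \<in> \<G> A B C D. g ` \<B> = \<B>))"
  proof (intro allI impI conjI)
    fix A B C D assume "(A, B, C, D) \<in> interior (Collect coexistence)"
    then have "coexistence (A, B, C, D)" using interior_subset by blast
    then obtain v where ne: "\<N> A B C D \<noteq> {}" and v: "v \<in> surf A B C D - closure (\<N> A B C D)"
      by (auto simp: coexistence_def)
    show "(top_of_set (surf A B C D)) frontier_of (\<N> A B C D) = (top_of_set (surf A B C D)) frontier_of (\<D> A B C D)"
      using frontier_of_complement[of "top_of_set (surf A B C D)" "\<N> A B C D"] by (simp add: \<D>_def)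
    have "\<forall>g \<in> \<G> A B C D. g ` (top_of_set (surf A B C D) frontier_of \<N> A B C D) = top_of_set (surf A B C D) frontier_of \<N> A B C D"
      unfolding frontier_of_openin_surf[OF openin_\<N>] by (intro ballI frontier_\<N>_invariant)
    then show "\<exists>\<B>. \<B> \<subseteq> (top_of_set (surf A B C D)) frontier_of (\<N> A B C D) \<and>
            has_top_dim (top_of_set \<B>) 3 \<and> (\<forall>g \<in> \<G> A B C D. g ` \<B> = \<B>)"
      using frontier_\<N>_dim_3[OF ne v] by blast
  qed
qed

end
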